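(* Let $d\ge 2$ be an integer. There exists a constant $c>0$ depending only on $d$ such that the following holds. Let $q$ be a prime power, let $A\subset\mathbb{F}_q^d$ be a set of points and let $R$ be a set of rigid motions in $\mathbb{F}_q^d$. Assume that either ($d\ge 3$ is odd) or ($d\equiv 2\bmod 4$ and $q\equiv 3\bmod 4$). (1) If $|A|<q^{\frac{d-1}{2}}$, then \[\left\vert \bigcup_{r\in R}\phi_r(A)\right\vert\ \ge\ c\,\min\left\lbrace q^d,\ \frac{|A||R|}{q^{d-1}|O(d-1)|}\right\rbrace.\] (2) If $q^{\frac{d-1}{2}}\le |A|\le q^{\frac{d+1}{2}}$, then \[\left\vert \bigcup_{r\in R}\phi_r(A)\right\vert\ \ge\ c\,\min\left\lbrace q^d,\ \frac{|R|}{q^{\frac{d-1}{2}}|O(d-1)|}\right\rbrace.\]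
   Context: $\mathbb{F}_q$ is the finite field of order $q$. $O(n)$ is the group of $n\times n$ orthogonal matrices over $\mathbb{F}_q$ ($g^Tg=I$). A rigid motion in $\mathbb{F}_q^d$ is a pair $r=(g,z)\in O(d)\times\mathbb{F}_q^d$, acting by $\phi_r(x):=gx+z$.
   Formalization: The formal theorem assumes that q is odd. For even q and odd d ≥ 3 the claim fails, since every orthogonal matrix then fixes the all-ones vector; for q ≡ 3 mod 4 nothing changes. *)

theory Defs
  imports
    "HOL-Algebra.Ring"
    "HOL-Computational_Algebra.Factorial_Ring"
    "HOL-Number_Theory.Prime_Powers"
    "HOL-Number_Theory.Cong"
    "HOL-Library.FuncSet"
    Complex_Main
begin

text \<open>
  The constant of the theorem has to be uniform over all finite fields, so it must be chosen before
  the field. Fields are therefore \<open>HOL-Algebra\<close> structures, which can be quantified inside a formula,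
  rather than types. The carrier type \<open>'a\<close> is arbitrary; for \<open>'a = nat\<close> every finite field occurs up
  to isomorphism, so that instance alone gives one constant valid for all \<open>q\<close>.

  The theorem is stated for odd \<open>q\<close>; for even \<open>q\<close> it fails. If \<open>q\<close> is even then
  \<open>g\<^sup>T g = I\<close> forces \<open>g 1 = 1\<close> for the all-ones vector \<open>1\<close>, since every column sum squares to
  \<open>1\<close>, hence equals \<open>1\<close>, and \<open>g g\<^sup>T = I\<close>. Let \<open>H\<close> be an additive subgroup of index \<open>2\<close> of the field,
  \<open>A = {t 1 | t \<in> H}\<close> and \<open>R = O(d) \<times> A\<close>. Then every rigid motion in \<open>R\<close> maps \<open>A\<close> onto itself, so the union has
  \<open>q / 2\<close> elements. For \<open>d = 3\<close> one has \<open>|A| = q / 2 < q\<close>, \<open>|O(3)| = q (q\<^sup>2 - 1)\<close> and \<open>|O(2)| = q\<close>,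
  and the lower bound would be \<open>c (q\<^sup>2 - 1) / 4\<close>, which exceeds \<open>q / 2\<close> for large \<open>q\<close>.

  Vectors and matrices are extensional functions, so that cardinalities of sets of vectors and
  matrices are the intended ones. The entry of \<open>g\<close> in row \<open>i\<close> and column \<open>j\<close> is \<open>g i j\<close>, and
  indices run over \<open>{..<n}\<close>.
\<close>

definition vecs :: "('a, 'm) ring_scheme \<Rightarrow> nat \<Rightarrow> (nat \<Rightarrow> 'a) set" where
  "vecs F n = ({..<n} \<rightarrow>\<^sub>E carrier F)"

definition sq_mats :: "('a, 'm) ring_scheme \<Rightarrow> nat \<Rightarrow> (nat \<Rightarrow> nat \<Rightarrow> 'a) set" where
  "sq_mats F n = ({..<n} \<rightarrow>\<^sub>E ({..<n} \<rightarrow>\<^sub>E carrier F))"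

definition mat_id :: "('a, 'm) ring_scheme \<Rightarrow> nat \<Rightarrow> nat \<Rightarrow> nat \<Rightarrow> 'a" where
  "mat_id F n = (\<lambda>i\<in>{..<n}. \<lambda>j\<in>{..<n}. if i = j then \<one>\<^bsub>F\<^esub> else \<zero>\<^bsub>F\<^esub>)"

definition mat_transpose :: "nat \<Rightarrow> (nat \<Rightarrow> nat \<Rightarrow> 'a) \<Rightarrow> nat \<Rightarrow> nat \<Rightarrow> 'a" where
  "mat_transpose n g = (\<lambda>i\<in>{..<n}. \<lambda>j\<in>{..<n}. g j i)"

definition mat_times ::
    "('a, 'm) ring_scheme \<Rightarrow> nat \<Rightarrow> (nat \<Rightarrow> nat \<Rightarrow> 'a) \<Rightarrow> (nat \<Rightarrow> nat \<Rightarrow> 'a) \<Rightarrow> nat \<Rightarrow> nat \<Rightarrow> 'a" where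
  "mat_times F n g h =
     (\<lambda>i\<in>{..<n}. \<lambda>j\<in>{..<n}. \<Oplus>\<^bsub>F\<^esub>k\<in>{..<n}. g i k \<otimes>\<^bsub>F\<^esub> h k j)"

definition mat_app ::
    "('a, 'm) ring_scheme \<Rightarrow> nat \<Rightarrow> (nat \<Rightarrow> nat \<Rightarrow> 'a) \<Rightarrow> (nat \<Rightarrow> 'a) \<Rightarrow> nat \<Rightarrow> 'a" where
  "mat_app F n g x = (\<lambda>i\<in>{..<n}. \<Oplus>\<^bsub>F\<^esub>j\<in>{..<n}. g i j \<otimes>\<^bsub>F\<^esub> x j)"

definition vec_plus ::
    "('a, 'm) ring_scheme \<Rightarrow> nat \<Rightarrow> (nat \<Rightarrow> 'a) \<Rightarrow> (nat \<Rightarrow> 'a) \<Rightarrow> nat \<Rightarrow> 'a" where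
  "vec_plus F n x y = (\<lambda>i\<in>{..<n}. x i \<oplus>\<^bsub>F\<^esub> y i)"

definition orthogonal_group :: "('a, 'm) ring_scheme \<Rightarrow> nat \<Rightarrow> (nat \<Rightarrow> nat \<Rightarrow> 'a) set" where
  "orthogonal_group F n =
     {g \<in> sq_mats F n. mat_times F n (mat_transpose n g) g = mat_id F n}"

definition rigid_motions ::
    "('a, 'm) ring_scheme \<Rightarrow> nat \<Rightarrow> ((nat \<Rightarrow> nat \<Rightarrow> 'a) \<times> (nat \<Rightarrow> 'a)) set" where
  "rigid_motions F d = orthogonal_group F d \<times> vecs F d"

definition rigid_map ::
    "('a, 'm) ring_scheme \<Rightarrow> nat \<Rightarrow> (nat \<Rightarrow> nat \<Rightarrow> 'a) \<times> (nat \<Rightarrow> 'a) \<Rightarrow> (nat \<Rightarrow> 'a) \<Rightarrow> nat \<Rightarrow> 'a" where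
  "rigid_map F d r x = (case r of (g, z) \<Rightarrow> vec_plus F d (mat_app F d g x) z)"

end

theory Submission
  imports Defs "HOL-Algebra.Algebraic_Closure" "HOL-Number_Theory.Residues"
begin

text \<open>
  Let \<open>B\<close> be the union of the images of \<open>A\<close>. For a rigid motion \<open>(g, z)\<close> consider how many points of \<open>A\<close> it
  moves into \<open>B\<close>, compared with the mean \<open>|A| |B| / q\<^sup>d\<close>. For the motions in \<open>R\<close> this number is \<open>|A|\<close>,
  at least \<open>|A| / 2\<close> above the mean unless \<open>B\<close> fills half of the space. So \<open>|R|\<close> is limited by the
  variance of this number over all rigid motions, and the theorem follows from an upper bound for the
  variance (\<open>incidence_inequality\<close>, \<open>growth_of_incidence\<close>).

  For fixed \<open>g\<close>, Parseval in \<open>z\<close> gives the variance as a sum of \<open>|A^(m)|\<^sup>2 |B^(g m)|\<^sup>2\<close> over the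
  frequencies \<open>m \<noteq> 0\<close>, where \<open>A^\<close> and \<open>B^\<close> are the Fourier transforms of the sets.
  When \<open>g\<close> runs over the orthogonal group, \<open>g m\<close> runs over vectors on the sphere of \<open>m\<close>, and at most a constant times \<open>|O(d - 1)|\<close> matrices give the same vector
  (\<open>card_transporter_le_orth\<close>); for this, reflections alone supply enough points in every orbit. It
  remains to bound the energy of \<open>A^\<close> on a sphere (\<open>sphere_energy\<close>), that is, the Fourier transform of the
  sphere at a difference of two points of \<open>A\<close> (\<open>sphere_decay\<close>). The diagonal contributes \<open>q ^ (d - 1) |A|\<close>, the
  off-diagonal pairs \<open>q ^ ((d - 1) / 2) |A|\<^sup>2\<close>, and the comparison of these two terms is the
  distinction between the two parts of the theorem.

  The transform of a sphere is an exponential sum in one variable. In odd dimension it contains the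
  quadratic character and is evaluated by hand (\<open>salie_bound\<close>). In even dimension it is a Kloosterman sum,
  which degenerates and is large when both the radius of the sphere and the norm of the difference
  vanish; if \<open>d \<equiv> 2\<close> and \<open>q \<equiv> 3\<close> modulo \<open>4\<close> the sign is such that the large value only helps. The bound \<open>2 \<surd>q\<close> for Kloosterman sums (\<open>kloosterman_weil\<close>) is proved by
  elementary means: a quadratic extension of the field replaces the sum \<open>S\<close> by \<open>2 q - S\<^sup>2\<close>
  (\<open>quadratic_extension\<close>), so a sum that is too large would explode along a tower of such extensions,
  while a polynomial argument in the manner of Stepanov (\<open>stepanov_bound\<close>) gives a square root bound in
  the whole tower, with a worse constant.

  The fields of the theorem are algebraic structures that vary inside the statement. They are first
  embedded into one commutative ring, the product of all fields with elements in a fixed type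
  (\<open>ex_field_embedding\<close>), where all sums are ordinary sums and an algebraic closure is at hand.
\<close>

hide_const (open) Divisibility.prime

section \<open>Fields inside a commutative ring\<close>

text \<open>
  A field is carried by a subset of a type of class \<open>comm_ring_1\<close>, with a unit \<open>e\<close> that is an idempotent
  and need not be \<open>1\<close>. In this form one type can hold finite fields of all characteristics together
  with their extensions, and sums, powers and ring identities are those of the type class. The
  power \<open>x ^ 0\<close> is \<open>1\<close>, which lies outside the field in general, so powers appear with a positive exponent
  or with a coefficient from the field.
\<close>

locale fld =
  fixes K :: "'r::comm_ring_1 set" and e :: 'r
  assumes e_mem [simp]: "e \<in> K"
    and e_nz [simp]: "e \<noteq> 0"
    and add_mem [simp]: "\<And>x y. x \<in> K \<Longrightarrow> y \<in> K \<Longrightarrow> x + y \<in> K"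
    and mult_mem [simp]: "\<And>x y. x \<in> K \<Longrightarrow> y \<in> K \<Longrightarrow> x * y \<in> K"
    and minus_mem [simp]: "\<And>x. x \<in> K \<Longrightarrow> - x \<in> K"
    and e_left [simp]: "\<And>x. x \<in> K \<Longrightarrow> e * x = x"
    and ex_inverse: "\<And>x. x \<in> K \<Longrightarrow> x \<noteq> 0 \<Longrightarrow> \<exists>y\<in>K. x * y = e"
begin

lemma e_right [simp]: "x \<in> K \<Longrightarrow> x * e = x"
  using e_left[of x] by (simp add: mult.commute)

lemma diff_mem [simp]: "x \<in> K \<Longrightarrow> y \<in> K \<Longrightarrow> x - y \<in> K"
  using add_mem[of x "- y"] by simp

lemma zero_mem [simp]: "0 \<in> K"
  using diff_mem[of e e] by simp

lemma sum_mem [simp]: "(\<And>i. i \<in> I \<Longrightarrow> f i \<in> K) \<Longrightarrow> sum f I \<in> K"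
  by (induction I rule: infinite_finite_induct) auto

lemma mult_power_mem [simp]: "x \<in> K \<Longrightarrow> y \<in> K \<Longrightarrow> x * y ^ n \<in> K"
proof (induction n)
  case (Suc n)
  have "x * y ^ Suc n = y * (x * y ^ n)" by (simp add: mult_ac)
  then show ?case using Suc by (metis mult_mem)
qed auto

lemma power_mem [simp]: "x \<in> K \<Longrightarrow> n > 0 \<Longrightarrow> x ^ n \<in> K"
  using mult_power_mem[of x x "n - 1"] by (cases n) auto

lemma two_mult_mem [simp]: "x \<in> K \<Longrightarrow> 2 * x \<in> K"
  unfolding mult_2 by (rule add_mem)

lemma of_nat_mult_mem [simp]: "x \<in> K \<Longrightarrow> of_nat n * x \<in> K"
  by (induction n) (auto simp: algebra_simps)

lemma no_zero_divisors: "x * y = 0 \<Longrightarrow> x \<in> K \<Longrightarrow> y \<in> K \<Longrightarrow> x = 0 \<or> y = 0"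
proof (rule ccontr)
  assume a: "x * y = 0" "x \<in> K" "y \<in> K" "\<not> (x = 0 \<or> y = 0)"
  obtain z where z: "z \<in> K" "x * z = e" using ex_inverse a by blast
  have "y = e * y" using a by simp
  also have "\<dots> = z * (x * y)" by (simp add: z(2)[symmetric] mult_ac)
  finally show False using a by simp
qed

lemma mult_eq_0 [simp]: "x \<in> K \<Longrightarrow> y \<in> K \<Longrightarrow> x * y = 0 \<longleftrightarrow> x = 0 \<or> y = 0"
  using no_zero_divisors by auto

lemma mult_left_cancel_K: "x * y = x * z \<Longrightarrow> x \<in> K \<Longrightarrow> y \<in> K \<Longrightarrow> z \<in> K \<Longrightarrow> x \<noteq> 0 \<Longrightarrow> y = z"
  using mult_eq_0[of x "y - z"] by (simp add: right_diff_distrib)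

lemma mult_power_eq_0: "x \<in> K \<Longrightarrow> y \<in> K \<Longrightarrow> x * y ^ n = 0 \<Longrightarrow> x = 0 \<or> y = 0"
proof (induction n)
  case (Suc n)
  have "y * (x * y ^ n) = 0" using Suc.prems by (simp add: mult_ac)
  then show ?case using Suc by (metis mult_power_mem no_zero_divisors)
qed auto

lemma power_eq_0: "y \<in> K \<Longrightarrow> y ^ n = 0 \<Longrightarrow> y = 0"
  using mult_power_eq_0[of y y n] by simp

definition iv :: "'r \<Rightarrow> 'r" where "iv x = (SOME y. y \<in> K \<and> x * y = e)"

lemma iv: assumes "x \<in> K" "x \<noteq> 0" shows "iv x \<in> K" "x * iv x = e"
proof -
  have "iv x \<in> K \<and> x * iv x = e" unfolding iv_def
    by (rule someI_ex) (use ex_inverse assms in blast)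
  then show "iv x \<in> K" "x * iv x = e" by auto
qed

lemma iv_left: "x \<in> K \<Longrightarrow> x \<noteq> 0 \<Longrightarrow> iv x * x = e"
  using iv by (simp add: mult.commute)

lemma iv_nz: assumes "x \<in> K" "x \<noteq> 0" shows "iv x \<noteq> 0"
  using iv(2)[OF assms] by auto

lemma iv_unique: assumes "x \<in> K" "y \<in> K" "x * y = e" shows "y = iv x"
proof -
  have "x \<noteq> 0" using assms by auto
  then show ?thesis using mult_left_cancel_K[of x y "iv x"] assms iv by auto
qed

lemma cancel_iv: "x \<in> K \<Longrightarrow> x \<noteq> 0 \<Longrightarrow> y \<in> K \<Longrightarrow> x * (iv x * y) = y"
  using iv[of x] by (simp add: mult.assoc[symmetric])

lemma cancel_iv': "x \<in> K \<Longrightarrow> x \<noteq> 0 \<Longrightarrow> y \<in> K \<Longrightarrow> iv x * (x * y) = y"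
  using iv_left[of x] by (simp add: mult.assoc[symmetric])

lemma bij_mult: assumes "c \<in> K" "c \<noteq> 0" shows "bij_betw (\<lambda>x. c * x) K K"
  by (rule bij_betw_byWitness[where f' = "\<lambda>x. iv c * x"])
     (use assms cancel_iv cancel_iv' iv in auto)

lemma bij_mult_nz: assumes "c \<in> K" "c \<noteq> 0" shows "bij_betw (\<lambda>x. c * x) (K - {0}) (K - {0})"
  by (rule bij_betw_byWitness[where f' = "\<lambda>x. iv c * x"])
     (use assms cancel_iv cancel_iv' iv iv_nz in auto)

lemma bij_iv: "bij_betw iv (K - {0}) (K - {0})"
proof (rule bij_betw_byWitness[where f' = iv])
  show "\<forall>a\<in>K - {0}. iv (iv a) = a"
    using iv iv_nz iv_left iv_unique by (metis DiffE singletonI)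
  then show "\<forall>a\<in>K - {0}. iv (iv a) = a" .
qed (use iv iv_nz in auto)

lemma bij_add: assumes "c \<in> K" shows "bij_betw (\<lambda>x. c + x) K K"
  by (rule bij_betw_byWitness[where f' = "\<lambda>x. x - c"]) (use assms in auto)

text \<open>
  Synthetic division: with \<open>\<Sum> c\<^sub>i r\<^sup>i = 0\<close> the polynomial is \<open>\<Sum> c\<^sub>i (x\<^sup>i - r\<^sup>i)\<close>, and every summand has the
  factor \<open>x - r\<close>. The leading coefficient survives, which is what the induction on the degree in the
  bound for the number of roots needs.
\<close>

lemma poly_factor:
  assumes "\<And>i. i \<le> Suc n \<Longrightarrow> c i \<in> K" "r \<in> K" "(\<Sum>i\<le>Suc n. c i * r ^ i) = 0"
  obtains b where "\<And>i. i \<le> n \<Longrightarrow> b i \<in> K" "b n = c (Suc n)"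
    "\<And>x. (\<Sum>i\<le>Suc n. c i * x ^ i) = (x - r) * (\<Sum>i\<le>n. b i * x ^ i)"
proof -
  define b where "b i = (\<Sum>j\<in>{i<..Suc n}. c j * r ^ (j - Suc i))" for i
  have *: "(\<Sum>i\<le>Suc n. c i * x ^ i) = (x - r) * (\<Sum>i\<le>n. b i * x ^ i)" for x
  proof -
    have "(\<Sum>i\<le>Suc n. c i * x ^ i) = (\<Sum>i\<le>Suc n. c i * (x ^ i - r ^ i))"
      using assms(3) by (simp add: right_diff_distrib sum_subtractf)
    also have "\<dots> = (\<Sum>j\<le>Suc n. \<Sum>i<j. (x - r) * (c j * r ^ (j - Suc i) * x ^ i))"
      by (simp add: power_diff_sumr2 sum_distrib_left sum_distrib_right mult_ac)
    also have "\<dots> = (\<Sum>(j,i)\<in>(SIGMA j:{..Suc n}. {..<j}). (x - r) * (c j * r ^ (j - Suc i) * x ^ i))"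
      by (subst sum.Sigma) auto
    also have "\<dots> = (\<Sum>(i,j)\<in>(SIGMA i:{..n}. {i<..Suc n}). (x - r) * (c j * r ^ (j - Suc i) * x ^ i))"
      by (rule sum.reindex_bij_witness[where i = "\<lambda>(i,j). (j,i)" and j = "\<lambda>(i,j). (j,i)"]) auto
    also have "\<dots> = (x - r) * (\<Sum>i\<le>n. b i * x ^ i)"
      by (subst sum.Sigma[symmetric]) (auto simp: b_def sum_distrib_left sum_distrib_right)
    finally show ?thesis .
  qed
  show thesis
  proof (rule that)
    show "b i \<in> K" if "i \<le> n" for i
      unfolding b_def using assms by (intro sum_mem mult_power_mem) auto
    have "{n<..Suc n} = {Suc n}" by auto
    then show "b n = c (Suc n)" unfolding b_def by simp
    show "(\<Sum>i\<le>Suc n. c i * x ^ i) = (x - r) * (\<Sum>i\<le>n. b i * x ^ i)" for x by (rule *)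
  qed
qed

lemma card_roots:
  assumes "\<And>i. i \<le> n \<Longrightarrow> c i \<in> K" "c n \<noteq> 0"
  shows "finite {x\<in>K. (\<Sum>i\<le>n. c i * x ^ i) = 0} \<and> card {x\<in>K. (\<Sum>i\<le>n. c i * x ^ i) = 0} \<le> n"
  using assms
proof (induction n arbitrary: c)
  case 0 then show ?case by auto
next
  case (Suc n)
  show ?case
  proof (cases "\<exists>r\<in>K. (\<Sum>i\<le>Suc n. c i * r ^ i) = 0")
    case False
    then have "{x\<in>K. (\<Sum>i\<le>Suc n. c i * x ^ i) = 0} = {}" by blast
    then show ?thesis by (metis card.empty finite.emptyI zero_le)
  next
    case True
    then obtain r where r: "r \<in> K" "(\<Sum>i\<le>Suc n. c i * r ^ i) = 0" by blast
    obtain b where b: "\<And>i. i \<le> n \<Longrightarrow> b i \<in> K" "b n = c (Suc n)"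
      "\<And>x. (\<Sum>i\<le>Suc n. c i * x ^ i) = (x - r) * (\<Sum>i\<le>n. b i * x ^ i)"
      using poly_factor[OF Suc.prems(1) r] by blast
    have IH: "finite {x\<in>K. (\<Sum>i\<le>n. b i * x ^ i) = 0}" "card {x\<in>K. (\<Sum>i\<le>n. b i * x ^ i) = 0} \<le> n"
      using Suc.IH[of b] b Suc.prems(2) by auto
    have mem: "(\<Sum>i\<le>n. b i * x ^ i) \<in> K" if "x \<in> K" for x
      using b(1) that by (intro sum_mem mult_power_mem) auto
    have sub: "{x\<in>K. (\<Sum>i\<le>Suc n. c i * x ^ i) = 0} \<subseteq> insert r {x\<in>K. (\<Sum>i\<le>n. b i * x ^ i) = 0}"
    proof
      fix x assume x: "x \<in> {x\<in>K. (\<Sum>i\<le>Suc n. c i * x ^ i) = 0}"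
      then have "(x - r) * (\<Sum>i\<le>n. b i * x ^ i) = 0" using b(3) by simp
      then have "x - r = 0 \<or> (\<Sum>i\<le>n. b i * x ^ i) = 0" using x r mem
        by (metis (no_types, lifting) diff_mem mem_Collect_eq no_zero_divisors)
      then show "x \<in> insert r {x\<in>K. (\<Sum>i\<le>n. b i * x ^ i) = 0}" using x by auto
    qed
    have fin: "finite (insert r {x\<in>K. (\<Sum>i\<le>n. b i * x ^ i) = 0})" using IH by simp
    have "card {x\<in>K. (\<Sum>i\<le>Suc n. c i * x ^ i) = 0} \<le> card (insert r {x\<in>K. (\<Sum>i\<le>n. b i * x ^ i) = 0})"
      using card_mono[OF fin sub] .
    also have "\<dots> \<le> Suc n" using IH by (simp add: card_insert_if)
    finally show ?thesis using finite_subset[OF sub fin] by blast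
  qed
qed

end

section \<open>Finite fields of odd order and their squares\<close>

locale finite_fld = fld K e for K :: "'r::comm_ring_1 set" and e +
  assumes fin [simp]: "finite K" and odd_card: "odd (card K)"
begin

abbreviation "q \<equiv> card K"

lemma q_ge: "q \<ge> 3"
proof -
  have "card {0, e} \<le> q" by (intro card_mono) auto
  moreover have "card {0, e} = 2" using e_nz by (metis card_2_iff)
  ultimately have "q \<ge> 2" by simp
  then show ?thesis using odd_card by (cases "q = 2") auto
qed

lemma q_pos: "q > 0" using q_ge by simp

lemma of_nat_q: assumes "x \<in> K" shows "of_nat q * x = 0"
proof -
  have "(\<Sum>y\<in>K. x + y) = (\<Sum>y\<in>K. y)"
    using sum.reindex_bij_betw[OF bij_add[OF assms], of "\<lambda>y. y"] .
  then show ?thesis by (simp add: sum.distrib)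
qed

lemma two_nz: assumes "x \<in> K" "x + x = 0" shows "x = 0"
proof -
  obtain k where k: "q = 2 * k + 1" using odd_card by (metis oddE)
  have "0 = of_nat q * x" using of_nat_q assms by simp
  also have "\<dots> = of_nat k * (x + x) + x" unfolding k by (simp add: algebra_simps)
  finally show ?thesis using assms by simp
qed

lemma two_mult_nz [simp]: "x \<in> K \<Longrightarrow> 2 * x = 0 \<longleftrightarrow> x = 0"
  unfolding mult_2 using two_nz[of x] by auto

lemma minus_neq: "x \<in> K \<Longrightarrow> x \<noteq> 0 \<Longrightarrow> - x \<noteq> x"
  using two_nz[of x] by (metis add.right_inverse)

lemma two_e_nz: "e + e \<noteq> 0" using two_nz[of e] by auto

text \<open>
  Multiplication by \<open>x\<close> permutes the nonzero elements, so it does not change their product. The product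
  is taken with an extra factor \<open>e\<close>, because an empty product would be \<open>1\<close>.
\<close>

lemma pow_q_minus_1: assumes "x \<in> K" "x \<noteq> 0" shows "x ^ (q - 1) = e"
proof -
  define P where "P = (\<Prod>y\<in>K - {0}. y)"
  have P: "e * \<Prod>A \<in> K \<and> e * \<Prod>A \<noteq> 0" if "A \<subseteq> K - {0}" for A
  proof -
    have "finite A" using that fin finite_subset by blast
    then show ?thesis using that
    proof (induction A)
      case (insert a A)
      have "e * \<Prod>(insert a A) = a * (e * \<Prod>A)" using insert by (simp add: mult_ac)
      then show ?case using insert by (simp del: prod.insert)
    qed auto
  qed
  have "(\<Prod>y\<in>K - {0}. x * y) = P" unfolding P_def
    using prod.reindex_bij_betw[OF bij_mult_nz[OF assms], of "\<lambda>y. y"] .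
  then have "x ^ (q - 1) * P = P" unfolding P_def by (simp add: prod.distrib card_Diff_singleton)
  then have "x ^ (q - 1) * (e * P) = e * P" by (metis mult.left_commute)
  moreover have "x ^ (q - 1) \<in> K" using assms q_ge by simp
  ultimately have "(e * P) * (x ^ (q - 1)) = (e * P) * e"
    using P[of "K - {0}"] unfolding P_def by (simp add: mult.commute)
  then show ?thesis
    using mult_left_cancel_K[of "e * P" "x ^ (q - 1)" e] P[of "K - {0}"] \<open>x ^ (q - 1) \<in> K\<close>
    unfolding P_def by simp
qed

lemma pow_q: assumes "x \<in> K" shows "x ^ q = x"
proof (cases "x = 0")
  case False
  have "x ^ q = x * x ^ (q - 1)" using q_pos by (metis power_eq_if less_irrefl)
  then show ?thesis using pow_q_minus_1[OF assms False] assms by simp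
qed (use q_pos in \<open>simp add: zero_power\<close>)

lemma pow_q_pow: "x \<in> K \<Longrightarrow> x ^ (q ^ n) = x"
  by (induction n) (auto simp: power_mult pow_q mult.commute)

text \<open>
  The quadratic character is defined on nonzero squares rather than by Euler's criterion: the number
  of square roots of \<open>v\<close> is then \<open>1 + \<eta>(v)\<close> by a case distinction.
\<close>

definition nzsq :: "'r set" where "nzsq = (\<lambda>x. x * x) ` (K - {0})"

definition eta :: "'r \<Rightarrow> complex" where
  "eta v = (if v = 0 then 0 else if v \<in> nzsq then 1 else - 1)"

lemma eta_0 [simp]: "eta 0 = 0" by (simp add: eta_def)

lemma nzsq_sub: "nzsq \<subseteq> K - {0}" unfolding nzsq_def by auto

lemma sq_eq_iff: "x \<in> K \<Longrightarrow> y \<in> K \<Longrightarrow> x * x = y * y \<longleftrightarrow> x = y \<or> x = - y"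
proof -
  assume a: "x \<in> K" "y \<in> K"
  have "x * x = y * y \<longleftrightarrow> (x - y) * (x + y) = 0" by (simp add: algebra_simps)
  also have "\<dots> \<longleftrightarrow> x - y = 0 \<or> x + y = 0" using a by (intro mult_eq_0) auto
  finally show ?thesis by (metis add_eq_0_iff2 right_minus_eq)
qed

lemma card_sqrt: assumes "v \<in> K" shows "of_nat (card {x\<in>K. x * x = v}) = 1 + eta v"
proof -
  consider "v = 0" | "v \<noteq> 0" "v \<in> nzsq" | "v \<noteq> 0" "v \<notin> nzsq" by blast
  then show ?thesis
  proof cases
    case 1
    then have "{x\<in>K. x * x = v} = {0}" by auto
    then show ?thesis using 1 by simp
  next
    case 2
    then obtain y where y: "y \<in> K" "y \<noteq> 0" "v = y * y" unfolding nzsq_def by auto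
    have "{x\<in>K. x * x = v} = {y, - y}" using y sq_eq_iff by auto
    moreover have "card {y, - y} = 2" using minus_neq[of y] y by (metis card_2_iff)
    ultimately show ?thesis using 2 by (simp add: eta_def)
  next
    case 3
    then have "{x\<in>K. x * x = v} = {}" unfolding nzsq_def by auto
    then show ?thesis using 3 by (metis (no_types, lifting) add.right_inverse card.empty eta_def of_nat_0)
  qed
qed

lemma sum_square: "(\<Sum>x\<in>K. h (x * x)) = (\<Sum>v\<in>K. (1 + eta v) * h v)" for h :: "'r \<Rightarrow> complex"
proof -
  have "(\<Sum>x\<in>K. h (x * x)) = (\<Sum>v\<in>K. \<Sum>x\<in>{x\<in>K. x * x = v}. h (x * x))"
    by (rule sum.group[symmetric]) auto
  also have "\<dots> = (\<Sum>v\<in>K. of_nat (card {x\<in>K. x * x = v}) * h v)"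
    by (intro sum.cong) auto
  also have "\<dots> = (\<Sum>v\<in>K. (1 + eta v) * h v)"
    using card_sqrt by (intro sum.cong) simp_all
  finally show ?thesis .
qed

lemma sum_eta: "(\<Sum>v\<in>K. eta v) = 0"
  using sum_square[of "\<lambda>_. 1"] by (simp add: sum.distrib)

lemma card_nzsq: "2 * card nzsq = q - 1"
proof -
  have "(\<Sum>v\<in>K - {0}. eta v) = 0" using sum_eta by (simp add: sum_diff1)
  also have "(\<Sum>v\<in>K - {0}. eta v) = (\<Sum>v\<in>nzsq. 1) + (\<Sum>v\<in>(K - {0}) - nzsq. - 1)"
  proof -
    have "(\<Sum>v\<in>nzsq. eta v) = (\<Sum>v\<in>nzsq. 1)"
      using nzsq_sub by (intro sum.cong) (auto simp: eta_def)
    moreover have "(\<Sum>v\<in>(K - {0}) - nzsq. eta v) = (\<Sum>v\<in>(K - {0}) - nzsq. - 1)"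
      by (intro sum.cong) (auto simp: eta_def)
    moreover have "(\<Sum>v\<in>K - {0}. eta v) = (\<Sum>v\<in>(K - {0}) - nzsq. eta v) + (\<Sum>v\<in>nzsq. eta v)"
      by (rule sum.subset_diff[OF nzsq_sub]) simp
    ultimately show ?thesis by simp
  qed
  also have "\<dots> = of_nat (card nzsq) - of_nat (q - 1 - card nzsq)"
    using nzsq_sub by (simp add: card_Diff_subset finite_subset[OF nzsq_sub] card_Diff_singleton)
  finally have "card nzsq = q - 1 - card nzsq" by (metis eq_iff_diff_eq_0 of_nat_eq_iff)
  then show ?thesis by simp
qed

lemma nzsq_mult: "x \<in> nzsq \<Longrightarrow> y \<in> nzsq \<Longrightarrow> x * y \<in> nzsq"
proof -
  assume "x \<in> nzsq" "y \<in> nzsq"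
  then obtain a b where "a \<in> K - {0}" "b \<in> K - {0}" "x = a * a" "y = b * b" unfolding nzsq_def by auto
  then have "x * y = (a * b) * (a * b)" "a * b \<in> K - {0}" by (auto simp: mult_ac)
  then show ?thesis unfolding nzsq_def by auto
qed

lemma nzsq_mult_cancel: assumes "x \<in> nzsq" "y \<in> K" "x * y \<in> nzsq" shows "y \<in> nzsq"
proof -
  obtain a b where a: "a \<in> K - {0}" "b \<in> K - {0}" "x = a * a" "x * y = b * b"
    using assms unfolding nzsq_def by auto
  have "y = (iv a * b) * (iv a * b)"
  proof -
    have "(iv a * b) * (iv a * b) = iv a * (iv a * (b * b))" by (simp only: mult_ac)
    also have "\<dots> = iv a * (iv a * (a * a * y))" using a(3,4) by simp
    also have "\<dots> = iv a * (iv a * (a * (a * y)))" by (simp only: mult.assoc)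
    also have "\<dots> = y" using a(1) assms(2) cancel_iv'[of a "a * y"] cancel_iv'[of a y] by simp
    finally show ?thesis by simp
  qed
  moreover have "iv a * b \<in> K - {0}" using a iv iv_nz by auto
  ultimately show ?thesis unfolding nzsq_def by blast
qed

text \<open>
  Multiplication by a nonsquare maps the nonzero squares into the nonsquares. Both sets have
  \<open>(q - 1) / 2\<close> elements, so this map is onto, and every nonsquare is \<open>x z\<close> with a square \<open>z\<close>.
\<close>

lemma nonsq_mult: assumes "x \<in> K - {0}" "x \<notin> nzsq" "y \<in> K - {0}" "y \<notin> nzsq" shows "x * y \<in> nzsq"
proof -
  have im: "(\<lambda>z. x * z) ` nzsq \<subseteq> (K - {0}) - nzsq"
  proof
    fix w assume "w \<in> (\<lambda>z. x * z) ` nzsq"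
    then obtain z where z: "z \<in> nzsq" "w = z * x" by (auto simp: mult.commute)
    then show "w \<in> (K - {0}) - nzsq" using nzsq_mult_cancel[of z x] nzsq_sub assms by auto
  qed
  have inj: "inj_on (\<lambda>z. x * z) (K - {0})" using bij_mult_nz assms bij_betw_imp_inj_on by blast
  have "card ((\<lambda>z. x * z) ` nzsq) = card nzsq" using inj nzsq_sub by (metis card_image inj_on_subset)
  moreover have "card ((K - {0}) - nzsq) = card nzsq" using card_nzsq nzsq_sub
    by (simp add: card_Diff_subset finite_subset[OF nzsq_sub] card_Diff_singleton)
  ultimately have eq: "(\<lambda>z. x * z) ` nzsq = (K - {0}) - nzsq" using im
    by (intro card_subset_eq) auto
  then obtain z where z: "z \<in> nzsq" "y = x * z" using assms by (metis DiffI image_iff)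
  have "x * x \<in> nzsq" unfolding nzsq_def using assms by auto
  from nzsq_mult[OF this z(1)] show ?thesis unfolding z(2) by (simp add: mult.assoc)
qed

lemma eta_mult: assumes "x \<in> K" "y \<in> K" shows "eta (x * y) = eta x * eta y"
proof (cases "x = 0 \<or> y = 0")
  case False
  then have nz: "x * y \<noteq> 0" "x \<in> K - {0}" "y \<in> K - {0}" using assms by auto
  have yx: "y * x = x * y" by (rule mult.commute)
  have "x * y \<in> nzsq \<longleftrightarrow> (x \<in> nzsq \<longleftrightarrow> y \<in> nzsq)"
    using nonsq_mult[OF nz(2) _ nz(3)] nzsq_mult[of x y] nzsq_mult_cancel[of x y]
      nzsq_mult_cancel[of y x, unfolded yx] assms by blast
  then show ?thesis using nz by (simp add: eta_def)
qed auto

lemma ex_nonsq: obtains x where "x \<in> K - {0}" "x \<notin> nzsq"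
proof -
  have "nzsq \<noteq> K - {0}"
  proof
    assume "nzsq = K - {0}"
    then have "card nzsq = q - 1" by (simp only: card_Diff_singleton[OF zero_mem])
    then show False using card_nzsq q_ge by linarith
  qed
  then show ?thesis using nzsq_sub that by blast
qed

lemma eta_sq: "x \<in> K \<Longrightarrow> x \<noteq> 0 \<Longrightarrow> eta x * eta x = 1" by (simp add: eta_def)

text \<open>
  Together with \<open>sum_square\<close>: as \<open>x\<close> runs over the field, the values \<open>x\<^sup>2\<close> and \<open>c x\<^sup>2\<close> together cover every
  element exactly twice. The behaviour of Kloosterman sums in a quadratic extension rests on this.
\<close>

lemma sum_nonsquare: fixes h :: "'r \<Rightarrow> complex" assumes "c \<in> K - {0}" "c \<notin> nzsq"
  shows "(\<Sum>x\<in>K. h (c * (x * x))) = (\<Sum>v\<in>K. (1 - eta v) * h v)"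
proof -
  have "(\<Sum>x\<in>K. h (c * (x * x))) = (\<Sum>v\<in>K. (1 + eta v) * h (c * v))"
    using sum_square[of "\<lambda>v. h (c * v)"] by simp
  also have "\<dots> = (\<Sum>v\<in>K. (1 - eta (c * v)) * h (c * v))"
    using assms by (intro sum.cong) (auto simp: eta_mult eta_def[of c])
  also have "\<dots> = (\<Sum>v\<in>K. (1 - eta v) * h v)"
    using sum.reindex_bij_betw[OF bij_mult[of c], of "\<lambda>v. (1 - eta v) * h v"] assms by auto
  finally show ?thesis .
qed

end

section \<open>Additive characters\<close>

locale char_fld = finite_fld K e for K :: "'r::comm_ring_1 set" and e +
  fixes \<chi> :: "'r \<Rightarrow> complex"
  assumes chi_add: "\<And>x y. x \<in> K \<Longrightarrow> y \<in> K \<Longrightarrow> \<chi> (x + y) = \<chi> x * \<chi> y"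
    and chi_norm: "\<And>x. x \<in> K \<Longrightarrow> cmod (\<chi> x) = 1"
    and chi_nontriv: "\<exists>x\<in>K. \<chi> x \<noteq> 1"
begin

lemma chi_0 [simp]: "\<chi> 0 = 1"
  using chi_add[of 0 0] chi_norm[of 0] by auto

lemma chi_minus: "x \<in> K \<Longrightarrow> \<chi> (- x) = cnj (\<chi> x)"
proof -
  assume x: "x \<in> K"
  have a: "\<chi> x * \<chi> (- x) = 1" using chi_add[of x "- x"] x by simp
  have b: "\<chi> x * cnj (\<chi> x) = 1" using chi_norm[OF x] by (simp add: complex_norm_square[symmetric])
  have "\<chi> x \<noteq> 0" using a by auto
  then show ?thesis using a b by (metis mult_left_cancel)
qed

lemma chi_sum: "(\<And>i. i \<in> I \<Longrightarrow> f i \<in> K) \<Longrightarrow> \<chi> (sum f I) = (\<Prod>i\<in>I. \<chi> (f i))"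
  by (induction I rule: infinite_finite_induct) (auto simp: chi_add)

lemma sum_chi: "(\<Sum>x\<in>K. \<chi> x) = 0"
proof -
  obtain y where y: "y \<in> K" "\<chi> y \<noteq> 1" using chi_nontriv by blast
  have "(\<Sum>x\<in>K. \<chi> x) = (\<Sum>x\<in>K. \<chi> (y + x))"
    using sum.reindex_bij_betw[OF bij_add[OF y(1)], of \<chi>] by simp
  also have "\<dots> = \<chi> y * (\<Sum>x\<in>K. \<chi> x)" using y by (simp add: chi_add sum_distrib_left)
  finally show ?thesis using y by simp
qed

lemma sum_chi_mult: assumes "c \<in> K"
  shows "(\<Sum>x\<in>K. \<chi> (c * x)) = (if c = 0 then of_nat q else 0)"
  using sum.reindex_bij_betw[OF bij_mult[of c], of \<chi>] assms sum_chi by auto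

lemma sum_chi_nz: assumes "c \<in> K"
  shows "(\<Sum>x\<in>K - {0}. \<chi> (c * x)) = (if c = 0 then of_nat q - 1 else - 1)"
  using sum_chi_mult[OF assms] by (auto simp: sum_diff1)

end

section \<open>The Frobenius map and polynomial functions\<close>

context fld
begin

lemma frobenius_prime:
  assumes "prime p" "of_nat p * e = 0" "x \<in> K" "y \<in> K"
  shows "(x + y) ^ p = x ^ p + y ^ p"
proof -
  have p0: "of_nat p * z = 0" if "z \<in> K" for z
  proof -
    have "of_nat p * z = (of_nat p * e) * z" using that by (simp add: mult.assoc)
    then show ?thesis using assms(2) by simp
  qed
  have zero: "of_nat (p choose k) * x ^ k * y ^ (p - k) = 0" if k: "k \<in> {0<..<p}" for k
  proof -
    have "p dvd (p choose k)" using assms(1) k by (intro dvd_choose_prime) auto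
    then obtain t where t: "p choose k = p * t" by blast
    have "x ^ k \<in> K" "y ^ (p - k) \<in> K" using k assms by auto
    then have "of_nat p * (x ^ k * y ^ (p - k)) = 0" using p0 by simp
    moreover have "of_nat (p choose k) * x ^ k * y ^ (p - k) = of_nat t * (of_nat p * (x ^ k * y ^ (p - k)))"
      unfolding t by (simp add: mult_ac)
    ultimately show ?thesis by simp
  qed
  have p: "p > 1" using assms(1) prime_gt_1_nat by blast
  have "{..p} = {0, p} \<union> {0<..<p}" using p by auto
  then have "(x + y) ^ p = (\<Sum>k\<in>{0, p} \<union> {0<..<p}. of_nat (p choose k) * x ^ k * y ^ (p - k))"
    using binomial_ring[of x y p] by simp
  also have "\<dots> = (\<Sum>k\<in>{0, p}. of_nat (p choose k) * x ^ k * y ^ (p - k))"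
    by (rule sum.mono_neutral_right) (use zero in auto)
  also have "\<dots> = x ^ p + y ^ p" using p by (simp add: add.commute)
  finally show ?thesis .
qed

lemma frobenius_prime_power:
  assumes "prime p" "of_nat p * e = 0" "x \<in> K" "y \<in> K"
  shows "(x + y) ^ (p ^ n) = x ^ (p ^ n) + y ^ (p ^ n)"
proof (induction n)
  case (Suc n)
  have "p ^ n > 0" using assms(1) by (simp add: prime_gt_0_nat)
  then have "(x ^ (p ^ n) + y ^ (p ^ n)) ^ p = (x ^ (p ^ n)) ^ p + (y ^ (p ^ n)) ^ p"
    using assms by (intro frobenius_prime) auto
  moreover have "(x + y) ^ (p ^ Suc n) = ((x + y) ^ (p ^ n)) ^ p"
    by (simp add: power_mult[symmetric] mult.commute)
  ultimately show ?case using Suc by (simp add: power_mult[symmetric] mult.commute)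
qed simp

end

lemma (in finite_fld) prime_char:
  assumes "primepow q"
  obtains p k where "prime p" "k > 0" "q = p ^ k" "of_nat p * e = 0"
proof -
  obtain p k where pk: "prime p" "k > 0" "q = p ^ k" using assms unfolding primepow_def by blast
  have "(of_nat p * e) ^ k * e = of_nat q * e"
    unfolding pk(3)
  proof (induction k)
    case (Suc k)
    have "(of_nat p * e) ^ Suc k * e = of_nat p * (e * ((of_nat p * e) ^ k * e))" by (simp add: mult_ac)
    also have "\<dots> = of_nat p * (e * (of_nat (p ^ k) * e))" unfolding Suc ..
    also have "\<dots> = of_nat (p ^ Suc k) * e" by (simp add: mult.left_commute[of e])
    finally show ?case .
  qed simp
  also have "\<dots> = 0" by (rule of_nat_q) simp
  finally have "e * (of_nat p * e) ^ k = 0" by (simp add: mult.commute)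
  then have "of_nat p * e = 0" using mult_power_eq_0[of e "of_nat p * e" k] by simp
  then show thesis using that pk by blast
qed

text \<open>
  The field \<open>M\<close> is the large surrounding field, in the application an algebraic closure; \<open>K\<close> is a finite
  subfield of it. All intermediate finite fields are subsets of \<open>M\<close>, so no field ever changes its
  type.
\<close>

locale fld_ext = fld M e + K: finite_fld K e for M K :: "'r::comm_ring_1 set" and e +
  assumes sub: "K \<subseteq> M" and card_primepow: "primepow (card K)"
begin

lemma K_in_M [simp]: "x \<in> K \<Longrightarrow> x \<in> M" using sub by blast

lemma frob: assumes "x \<in> M" "y \<in> M" shows "(x + y) ^ (card K ^ n) = x ^ (card K ^ n) + y ^ (card K ^ n)"
proof -
  obtain p k where pk: "prime p" "card K = p ^ k" "of_nat p * e = 0" using K.prime_char[OF card_primepow] by metis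
  show ?thesis using frobenius_prime_power[OF pk(1,3) assms, of "k * n"] by (simp add: pk(2) power_mult)
qed

lemma frob_sum: assumes "finite I" "\<And>i. i \<in> I \<Longrightarrow> f i \<in> M"
  shows "(sum f I) ^ (card K ^ n) = (\<Sum>i\<in>I. f i ^ (card K ^ n))"
  using assms
proof (induction I)
  case empty then show ?case using K.q_pos by (simp add: zero_power)
next
  case (insert a I) then show ?case by (simp add: frob)
qed

lemma pow_K [simp]: "x \<in> K \<Longrightarrow> x ^ (card K ^ n) = x" by (rule K.pow_q_pow)

text \<open>
  The polynomial \<open>X\<^sup>q - X\<close> has at most \<open>q\<close> roots in \<open>M\<close>, and the \<open>q\<close> elements of \<open>K\<close> are roots.
\<close>

lemma fixed_in_K: assumes "x \<in> M" "x ^ card K = x" shows "x \<in> K"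
proof -
  define c where "c i = (if i = card K then e else if i = 1 then - e else 0)" for i
  have q1: "card K > 1" using K.q_ge by simp
  have c: "(\<Sum>i\<le>card K. c i * z ^ i) = z ^ card K - z" if "z \<in> M" for z
  proof -
    have "(\<Sum>i\<le>card K. c i * z ^ i) = (\<Sum>i\<in>{1, card K}. c i * z ^ i)"
      by (rule sum.mono_neutral_right) (use q1 in \<open>auto simp: c_def\<close>)
    also have "\<dots> = z ^ card K - z" using q1 that K.q_pos by (simp add: c_def)
    finally show ?thesis .
  qed
  have r: "finite {z\<in>M. (\<Sum>i\<le>card K. c i * z ^ i) = 0}" "card {z\<in>M. (\<Sum>i\<le>card K. c i * z ^ i) = 0} \<le> card K"
    using card_roots[of "card K" c] by (auto simp: c_def)
  have "K \<subseteq> {z\<in>M. (\<Sum>i\<le>card K. c i * z ^ i) = 0}" using c K.pow_q by auto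
  then have "K = {z\<in>M. (\<Sum>i\<le>card K. c i * z ^ i) = 0}" using r
    by (meson card_seteq)
  then show ?thesis using c assms by auto
qed

lemma iv_K: "x \<in> K \<Longrightarrow> x \<noteq> 0 \<Longrightarrow> iv x = K.iv x"
  using iv_unique[of x "K.iv x"] K.iv by auto

lemma iv_in_K [simp]: "x \<in> K \<Longrightarrow> x \<noteq> 0 \<Longrightarrow> iv x \<in> K"
  using iv_K K.iv by auto

text \<open>
  Functions on \<open>M\<close> that are given by a polynomial over \<open>K\<close> of degree less than \<open>n\<close>. Nothing is said
  about uniqueness of the coefficients: a vanishing linear combination only has to vanish as a
  function, and the number of roots only needs one representation with a nonzero leading
  coefficient, which \<open>exact_degree\<close> records.
\<close>

definition polyfun :: "nat \<Rightarrow> ('r \<Rightarrow> 'r) \<Rightarrow> bool" where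
  "polyfun n f \<longleftrightarrow> (\<exists>c. (\<forall>i<n. c i \<in> K) \<and> (\<forall>x\<in>M. f x = (\<Sum>i<n. c i * x ^ i)))"

lemma polyfun_monom: assumes "c \<in> K" "k < n" shows "polyfun n (\<lambda>x. c * x ^ k)"
  unfolding polyfun_def
proof (intro exI[of _ "\<lambda>i. if i = k then c else 0"] conjI ballI)
  fix x
  have "(\<Sum>i<n. (if i = k then c else 0) * x ^ i) = (\<Sum>i<n. if i = k then c * x ^ i else 0)"
    by (intro sum.cong) auto
  then show "c * x ^ k = (\<Sum>i<n. (if i = k then c else 0) * x ^ i)" using assms by simp
qed (use assms in auto)

lemma polyfun_0: "polyfun n (\<lambda>x. 0)"
  unfolding polyfun_def by (intro exI[of _ "\<lambda>i. 0"]) auto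

lemma polyfun_add: assumes "polyfun n f" "polyfun n g" shows "polyfun n (\<lambda>x. f x + g x)"
proof -
  obtain c d where "\<forall>i<n. c i \<in> K" "\<forall>x\<in>M. f x = (\<Sum>i<n. c i * x ^ i)"
    "\<forall>i<n. d i \<in> K" "\<forall>x\<in>M. g x = (\<Sum>i<n. d i * x ^ i)"
    using assms unfolding polyfun_def by blast
  then show ?thesis unfolding polyfun_def
    by (intro exI[of _ "\<lambda>i. c i + d i"]) (auto simp: distrib_right sum.distrib)
qed

lemma polyfun_sum: "(\<And>i. i \<in> I \<Longrightarrow> polyfun n (f i)) \<Longrightarrow> polyfun n (\<lambda>x. \<Sum>i\<in>I. f i x)"
  by (induction I rule: infinite_finite_induct) (auto simp: polyfun_0 polyfun_add)

lemma polyfun_cong: "polyfun n f \<Longrightarrow> (\<And>x. x \<in> M \<Longrightarrow> g x = f x) \<Longrightarrow> polyfun n g"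
  unfolding polyfun_def by auto

lemma polyfun_mult: assumes "polyfun (Suc n) f" "polyfun m g" shows "polyfun (n + m) (\<lambda>x. f x * g x)"
proof -
  obtain c d where c: "\<forall>i<Suc n. c i \<in> K" "\<forall>x\<in>M. f x = (\<Sum>i<Suc n. c i * x ^ i)"
    and d: "\<forall>i<m. d i \<in> K" "\<forall>x\<in>M. g x = (\<Sum>i<m. d i * x ^ i)"
    using assms unfolding polyfun_def by blast
  have "polyfun (n + m) (\<lambda>x. \<Sum>i<Suc n. \<Sum>j<m. (c i * d j) * x ^ (i + j))"
    using c d by (intro polyfun_sum polyfun_monom) auto
  moreover have "f x * g x = (\<Sum>i<Suc n. \<Sum>j<m. (c i * d j) * x ^ (i + j))" if "x \<in> M" for x
  proof -
    have "f x * g x = (\<Sum>i<Suc n. c i * x ^ i) * (\<Sum>j<m. d j * x ^ j)" using c d that by metis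
    also have "\<dots> = (\<Sum>i<Suc n. \<Sum>j<m. (c i * x ^ i) * (d j * x ^ j))" by (rule sum_product)
    finally show ?thesis by (simp only: power_add mult_ac)
  qed
  ultimately show ?thesis by (rule polyfun_cong)
qed

lemma polyfun_mono: assumes "polyfun n f" "n \<le> m" shows "polyfun m f"
proof -
  obtain c where c: "\<forall>i<n. c i \<in> K" "\<forall>x\<in>M. f x = (\<Sum>i<n. c i * x ^ i)"
    using assms unfolding polyfun_def by blast
  have "polyfun m (\<lambda>x. \<Sum>i<n. c i * x ^ i)"
    using c assms by (intro polyfun_sum polyfun_monom) auto
  then show ?thesis by (rule polyfun_cong) (use c in auto)
qed

lemma polyfun_power: assumes "polyfun (Suc n) f" "c \<in> K" shows "polyfun (Suc (j * n)) (\<lambda>x. c * f x ^ j)"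
proof (induction j)
  case 0 show ?case using polyfun_monom[of c 0 "Suc 0"] assms by simp
next
  case (Suc j)
  have "polyfun (n + Suc (j * n)) (\<lambda>x. f x * (c * f x ^ j))" by (rule polyfun_mult[OF assms(1) Suc.IH])
  then show ?case by (simp add: mult_ac)
qed

definition exact_degree :: "nat \<Rightarrow> ('r \<Rightarrow> 'r) \<Rightarrow> bool" where
  "exact_degree n f \<longleftrightarrow> (\<exists>l\<in>K - {0}. \<exists>g. polyfun n g \<and> (\<forall>x\<in>M. f x = l * x ^ n + g x))"

lemma exact_degree_polyfun: assumes "exact_degree n f" shows "polyfun (Suc n) f"
proof -
  obtain l g where l: "l \<in> K - {0}" "polyfun n g" "\<forall>x\<in>M. f x = l * x ^ n + g x"
    using assms unfolding exact_degree_def by blast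
  have "polyfun (Suc n) (\<lambda>x. l * x ^ n + g x)"
    using l polyfun_mono[OF l(2)] by (intro polyfun_add polyfun_monom) auto
  then show ?thesis by (rule polyfun_cong) (use l in auto)
qed

lemma exact_degree_monom: "l \<in> K - {0} \<Longrightarrow> exact_degree n (\<lambda>x. l * x ^ n)"
  unfolding exact_degree_def using polyfun_0 by force

lemma exact_degree_cong: "exact_degree n f \<Longrightarrow> (\<And>x. x \<in> M \<Longrightarrow> g x = f x) \<Longrightarrow> exact_degree n g"
  unfolding exact_degree_def by auto

lemma exact_degree_add: assumes "exact_degree n f" "polyfun n g" shows "exact_degree n (\<lambda>x. f x + g x)"
proof -
  obtain l h where l: "l \<in> K - {0}" "polyfun n h" "\<forall>x\<in>M. f x = l * x ^ n + h x"
    using assms unfolding exact_degree_def by blast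
  then have "polyfun n (\<lambda>x. h x + g x)" using assms polyfun_add by blast
  then show ?thesis unfolding exact_degree_def
    using l by (intro bexI[of _ l] exI[of _ "\<lambda>x. h x + g x"]) (auto simp: add.assoc)
qed

lemma exact_degree_mult: assumes "exact_degree n f" "exact_degree m g"
  shows "exact_degree (n + m) (\<lambda>x. f x * g x)"
proof -
  obtain l h where l: "l \<in> K - {0}" "polyfun n h" "\<forall>x\<in>M. f x = l * x ^ n + h x"
    using assms(1) unfolding exact_degree_def by blast
  obtain k u where k: "k \<in> K - {0}" "polyfun m u" "\<forall>x\<in>M. g x = k * x ^ m + u x"
    using assms(2) unfolding exact_degree_def by blast
  have 1: "polyfun (n + m) (\<lambda>x. f x * u x)"
    using polyfun_mult[OF exact_degree_polyfun[OF assms(1)] k(2)] .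
  have 2: "polyfun (m + n) (\<lambda>x. (k * x ^ m) * h x)"
    using polyfun_mult[OF _ l(2), of m "\<lambda>x. k * x ^ m"] polyfun_monom[of k m "Suc m"] k by simp
  have "polyfun (n + m) (\<lambda>x. f x * u x + (k * x ^ m) * h x)"
    using polyfun_add 1 2 by (simp add: add.commute)
  moreover have "l * k \<in> K - {0}" using l k by auto
  moreover have "f x * g x = (l * k) * x ^ (n + m) + (f x * u x + (k * x ^ m) * h x)" if "x \<in> M" for x
  proof -
    have "f x * g x = f x * u x + (l * x ^ n + h x) * (k * x ^ m)" using l k that by (simp add: algebra_simps)
    then show ?thesis by (simp add: algebra_simps power_add)
  qed
  ultimately show ?thesis unfolding exact_degree_def by blast
qed

lemma exact_degree_power: assumes "exact_degree n f" "c \<in> K - {0}"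
  shows "exact_degree (j * n) (\<lambda>x. c * f x ^ j)"
proof (induction j)
  case 0 show ?case using exact_degree_monom[of c 0] assms by simp
next
  case (Suc j)
  have "exact_degree (n + j * n) (\<lambda>x. f x * (c * f x ^ j))" by (rule exact_degree_mult[OF assms(1) Suc.IH])
  then show ?case by (simp add: mult_ac)
qed

lemma exact_degree_roots: assumes "exact_degree n f"
  shows "finite {x\<in>M. f x = 0} \<and> card {x\<in>M. f x = 0} \<le> n"
proof -
  obtain l g where l: "l \<in> K - {0}" "polyfun n g" "\<forall>x\<in>M. f x = l * x ^ n + g x"
    using assms unfolding exact_degree_def by blast
  obtain c where c: "\<forall>i<n. c i \<in> K" "\<forall>x\<in>M. g x = (\<Sum>i<n. c i * x ^ i)"
    using l(2) unfolding polyfun_def by blast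
  define d where "d = c(n := l)"
  have "f x = (\<Sum>i\<le>n. d i * x ^ i)" if "x \<in> M" for x
    using l c that unfolding d_def lessThan_Suc_atMost[symmetric] by (simp add: add.commute)
  then have "{x\<in>M. f x = 0} = {x\<in>M. (\<Sum>i\<le>n. d i * x ^ i) = 0}" by auto
  then show ?thesis using card_roots[of n d] c l by (auto simp: d_def)
qed

text \<open>
  Polynomials of distinct degrees: the nonzero term of largest index cannot be cancelled.
\<close>

lemma exact_degree_combination:
  assumes "\<And>i. i < N \<Longrightarrow> exact_degree (s + i) (f i)" "\<And>i. i < N \<Longrightarrow> c i \<in> K" "\<exists>i<N. c i \<noteq> 0"
  shows "\<exists>n<N. exact_degree (s + n) (\<lambda>x. \<Sum>i<N. c i * f i x)"
proof -
  define n where "n = Max {i. i < N \<and> c i \<noteq> 0}"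
  have "n \<in> {i. i < N \<and> c i \<noteq> 0}" unfolding n_def by (rule Max_in) (use assms in auto)
  then have n: "n < N" "c n \<noteq> 0" by auto
  have max: "i \<le> n" if "i < N" "c i \<noteq> 0" for i unfolding n_def by (rule Max_ge) (use that in auto)
  have one: "exact_degree (s + n) (\<lambda>x. c n * f n x)"
    using exact_degree_mult[OF exact_degree_monom[of "c n" 0] assms(1)[OF n(1)]] n assms(2) by simp
  have "polyfun (s + n) (\<lambda>x. c i * f i x)" if "i < n" for i
  proof -
    have "polyfun (Suc (s + i)) (\<lambda>x. (c i * x ^ 0) * f i x)"
      using polyfun_mult[OF polyfun_monom[of "c i" 0 "Suc 0"] exact_degree_polyfun[OF assms(1)[of i]]]
        that n assms(2)[of i] by simp
    then show ?thesis using polyfun_mono[of "Suc (s + i)" _ "s + n"] that by simp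
  qed
  then have two: "polyfun (s + n) (\<lambda>x. \<Sum>i<n. c i * f i x)" by (intro polyfun_sum) auto
  have "(\<Sum>i<N. c i * f i x) = c n * f n x + (\<Sum>i<n. c i * f i x)" for x
  proof -
    have "(\<Sum>i<N. c i * f i x) = (\<Sum>i<Suc n. c i * f i x)"
      by (rule sum.mono_neutral_right) (use n max in \<open>force simp: less_Suc_eq_le\<close>)+
    then show ?thesis by (simp add: add.commute)
  qed
  then have "exact_degree (s + n) (\<lambda>x. \<Sum>i<N. c i * f i x)" using exact_degree_add[OF one two] by simp
  then show ?thesis using n by blast
qed

text \<open>
  There are \<open>q ^ N\<close> coefficient vectors for the \<open>N\<close> given functions, but at most \<open>q ^ D\<close> polynomial functions of
  degree less than \<open>D\<close>. Two vectors give the same function, and their difference is the relation.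
\<close>

lemma polyfun_dependent:
  assumes "\<And>i. i < N \<Longrightarrow> polyfun D (f i)" "D < N"
  obtains c where "\<And>i. i < N \<Longrightarrow> c i \<in> K" "\<exists>i<N. c i \<noteq> 0" "\<And>x. x \<in> M \<Longrightarrow> (\<Sum>i<N. c i * f i x) = 0"
proof -
  let ?G = "{..<N} \<rightarrow>\<^sub>E K" and ?H = "{..<D} \<rightarrow>\<^sub>E K"
  have "\<forall>g\<in>?G. \<exists>b. b \<in> ?H \<and> (\<forall>x\<in>M. (\<Sum>i<N. g i * f i x) = (\<Sum>i<D. b i * x ^ i))"
  proof
    fix g assume g: "g \<in> ?G"
    have "polyfun D (\<lambda>x. \<Sum>i<N. g i * f i x)"
    proof (rule polyfun_sum)
      fix i assume "i \<in> {..<N}"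
      then have "polyfun (0 + D) (\<lambda>x. (g i * x ^ 0) * f i x)"
        using polyfun_mult[OF polyfun_monom[of "g i" 0 "Suc 0"] assms(1)[of i]] g \<open>i \<in> {..<N}\<close> by auto
      then show "polyfun D (\<lambda>x. g i * f i x)" by simp
    qed
    then obtain b where "\<forall>i<D. b i \<in> K" "\<forall>x\<in>M. (\<Sum>i<N. g i * f i x) = (\<Sum>i<D. b i * x ^ i)"
      unfolding polyfun_def by blast
    then show "\<exists>b. b \<in> ?H \<and> (\<forall>x\<in>M. (\<Sum>i<N. g i * f i x) = (\<Sum>i<D. b i * x ^ i))"
      by (intro exI[of _ "restrict b {..<D}"]) auto
  qed
  then obtain B where B: "\<forall>g\<in>?G. B g \<in> ?H \<and> (\<forall>x\<in>M. (\<Sum>i<N. g i * f i x) = (\<Sum>i<D. B g i * x ^ i))"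
    by metis
  have "card ?H < card ?G" using assms(2) K.q_ge by (simp add: card_PiE)
  moreover have "finite ?H" by (intro finite_PiE) auto
  then have "card (B ` ?G) \<le> card ?H" using B by (intro card_mono) auto
  ultimately have "\<not> inj_on B ?G" by (intro pigeonhole) linarith
  then obtain g h where gh: "g \<in> ?G" "h \<in> ?G" "g \<noteq> h" "B g = B h" unfolding inj_on_def by blast
  show thesis
  proof (rule that[of "\<lambda>i. g i - h i"])
    show "\<exists>i<N. g i - h i \<noteq> 0" using gh by (metis PiE_ext eq_iff_diff_eq_0 lessThan_iff)
    show "g i - h i \<in> K" if "i < N" for i using gh that by (intro K.diff_mem) auto
    show "(\<Sum>i<N. (g i - h i) * f i x) = 0" if "x \<in> M" for x
      using B gh that by (simp add: left_diff_distrib sum_subtractf)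
  qed
qed

end

section \<open>Stepanov's method for a trace equation\<close>

context fld_ext
begin

text \<open>
  An auxiliary function of low degree vanishes at all solutions. Put \<open>t = q ^ m\<close>, \<open>r = q ^ (m - 1)\<close> and
  let \<open>u\<close> be the sum of the first \<open>m\<close> conjugates of \<open>a x + b / x\<close>. The trace condition says \<open>u + u\<^sup>t = c\<close>. So on the solutions the map \<open>y \<mapsto> y\<^sup>t\<close> acts on the three functions
  \<open>x\<close>, \<open>x\<^sup>t\<close>, \<open>u\<close> by sending them to \<open>x\<^sup>t\<close>, \<open>x\<close>, \<open>c - u\<close>. An auxiliary function
  \<open>\<Phi> = \<Sum> \<gamma>\<^sub>i\<^sub>k\<^sub>j x\<^sup>i (x\<^sup>t)\<^sup>k u\<^sup>j\<close> with coefficients in \<open>K\<close> therefore satisfies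
  \<open>\<Phi>\<^sup>t = \<Sum> \<gamma>\<^sub>i\<^sub>k\<^sub>j (x\<^sup>t)\<^sup>i x\<^sup>k (c - u)\<^sup>j\<close> there. After clearing denominators, the right side has fewer coefficients
  as a polynomial than there are \<open>\<gamma>\<close>. Hence the \<open>\<gamma>\<close> can be chosen, not all zero, such that it vanishes identically, and
  \<open>\<Phi>\<close> vanishes at all solutions. With \<open>i < r\<close> and \<open>j < q\<close> the pole order of a term of \<open>\<Phi>\<close> at infinity is
  \<open>i + r j + t k\<close>; these are distinct, being the numbers with these digits, so \<open>\<Phi>\<close> is not zero and its
  degree bounds the number of solutions. The main term \<open>q ^ (2 m - 1)\<close> is the expected number, and the
  error is a multiple of the square root of the order of \<open>E\<close>.
\<close>

lemma stepanov_bound: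
  assumes E: "finite_fld E e" and EM: "E \<subseteq> M" and cardE: "card E = (card K ^ m) ^ 2" and m: "m > 0"
    and ab: "a \<in> K - {0}" "b \<in> K - {0}" and c: "c \<in> K"
  shows "card {x\<in>E - {0}. (\<Sum>i<2 * m. (a * x + b * iv x) ^ (card K ^ i)) = c}
           \<le> card K ^ (2 * m - 1) + 3 * card K ^ m"
proof -
  interpret E: finite_fld E e by (rule E)
  define q where "q = card K"
  define r where "r = q ^ (m - 1)"
  define t where "t = q ^ m"
  have q3: "q \<ge> 3" unfolding q_def by (rule K.q_ge)
  have r1: "r \<ge> 1" unfolding r_def using q3 by (simp add: Suc_le_eq)
  have tr: "t = q * r" unfolding t_def r_def using m by (cases m) auto
  have t_pos: "t > 0" using tr q3 r1 by simp
  have tr2: "q ^ (2 * m - 1) = t * r"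
    unfolding t_def r_def power_add[symmetric] using m by (intro arg_cong[where f = "\<lambda>n. q ^ n"]) simp
  have pow_le_r: "q ^ i \<le> r" if "i < m" for i
    unfolding r_def using that q3 by (intro power_increasing) auto
  have pow_less_r: "q ^ i < r" if "i < m - 1" for i
    unfolding r_def using that q3 by (intro power_strict_increasing) auto
  \<comment> \<open>The polynomial \<open>x\<^sup>r u\<close>; multiplication by \<open>x\<^sup>r\<close> clears the poles of \<open>u\<close> at zero.\<close>
  define U where "U x = (\<Sum>i<m. a * x ^ (r + q ^ i) + b * x ^ (r - q ^ i))" for x
  define W where "W x = c * x ^ r + - U x" for x
  \<comment> \<open>The index \<open>n\<close> encodes the digits \<open>i = n mod r\<close>, \<open>j = (n div r) mod q\<close> and \<open>k = n div t\<close>. The last factor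
     clears the denominators for all \<open>j\<close> at once.\<close>
  define Phi where "Phi n x = (e * x ^ (n mod r + t * (n div t))) * (e * U x ^ ((n div r) mod q))
     * (e * x ^ (r * (q - 1 - (n div r) mod q)))" for n x
  define Psi where "Psi n x = (e * x ^ (t * (n mod r) + n div t)) * (e * W x ^ ((n div r) mod q))
     * (e * x ^ (r * (q - 1 - (n div r) mod q)))" for n x
  \<comment> \<open>Enough coefficients to exceed the number \<open>D\<close> of conditions; the values of
     \<open>k\<close> run up to \<open>r + 1\<close>.\<close>
  define N where "N = t * (r + 2)"
  define D where "D = Suc ((r - 1) * t + (r + 1) + 2 * r * (q - 1))"
  have e': "e \<in> K - {0}" by simp

  have U_degree: "exact_degree (2 * r) U"
  proof -
    have "exact_degree (2 * r) (\<lambda>x. (a * x ^ (2 * r) + b * x ^ 0)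
        + (\<Sum>i<m - 1. a * x ^ (r + q ^ i) + b * x ^ (r - q ^ i)))"
      using ab r1 pow_less_r
      by (intro exact_degree_add[OF exact_degree_add[OF exact_degree_monom]] polyfun_sum polyfun_add polyfun_monom)
         (auto intro: order.strict_trans1[OF diff_le_self])
    moreover have "U x = (a * x ^ (2 * r) + b * x ^ 0)
        + (\<Sum>i<m - 1. a * x ^ (r + q ^ i) + b * x ^ (r - q ^ i))" for x
    proof -
      have "{..<m} = insert (m - 1) {..<m - 1}" using m by auto
      then show ?thesis unfolding U_def by (simp add: r_def mult_2 del: One_nat_def)
    qed
    ultimately show ?thesis by (simp add: exact_degree_cong)
  qed
  have U_mem: "U x \<in> M" if "x \<in> M" for x
    unfolding U_def using that ab by (intro sum_mem add_mem mult_power_mem) auto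
  have W_poly: "polyfun (Suc (2 * r)) W"
  proof -
    have "polyfun (Suc (2 * r)) (\<lambda>x. c * x ^ r + (- e * x ^ 0) * U x)"
      using polyfun_mult[OF polyfun_monom[of "- e" 0 "Suc 0"] exact_degree_polyfun[OF U_degree]] c
      by (intro polyfun_add polyfun_monom) auto
    then show ?thesis by (rule polyfun_cong) (use U_mem in \<open>auto simp: W_def\<close>)
  qed
  have W_mem: "W x \<in> M" if "x \<in> M" for x
    unfolding W_def using that U_mem[OF that] c by auto

  have Phi_degree: "exact_degree (r * (q - 1) + n) (Phi n)" if n: "n < N" for n
  proof -
    define j where "j = (n div r) mod q"
    have j: "j \<le> q - 1" using q3 unfolding j_def by (simp add: less_Suc_eq_le[symmetric])
    have "n div t = (n div r) div q" unfolding tr mult.commute[of q r] by (rule div_mult2_eq)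
    then have n_eq: "n mod r + r * j + t * (n div t) = n"
      unfolding j_def tr using mod_mult2_eq[of n r q] div_mult_mod_eq[of n "r * q"]
      by (simp add: algebra_simps div_mult2_eq)
    have deg: "(n mod r + t * (n div t)) + j * (2 * r) + r * (q - 1 - j) = r * (q - 1) + n"
    proof -
      have "r * (q - 1) = r * (q - 1 - j) + r * j" using j by (metis distrib_left le_add_diff_inverse2)
      then show ?thesis using n_eq by (simp add: algebra_simps)
    qed
    have "exact_degree ((n mod r + t * (n div t)) + j * (2 * r) + r * (q - 1 - j)) (Phi n)"
      unfolding Phi_def j_def[symmetric]
      by (intro exact_degree_mult exact_degree_monom exact_degree_power U_degree e')
    then show ?thesis unfolding deg .
  qed

  have Psi_poly: "polyfun D (Psi n)" if n: "n < N" for n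
  proof -
    define j where "j = (n div r) mod q"
    have j: "j \<le> q - 1" using q3 unfolding j_def by (simp add: less_Suc_eq_le[symmetric])
    have nr: "n mod r \<le> r - 1" using r1 by (simp add: less_Suc_eq_le[symmetric])
    have nt: "n div t \<le> r + 1"
      using n t_pos unfolding N_def by (simp add: div_less_iff_less_mult mult.commute less_Suc_eq_le[symmetric])
    have "polyfun (t * (n mod r) + n div t + Suc (j * (2 * r))) (\<lambda>x. (e * x ^ (t * (n mod r) + n div t)) * (e * W x ^ j))"
      by (intro polyfun_mult[OF polyfun_monom polyfun_power[OF W_poly]]) auto
    then have "polyfun (Suc (t * (n mod r) + n div t + j * (2 * r))) (\<lambda>x. (e * x ^ (t * (n mod r) + n div t)) * (e * W x ^ j))"
      by simp
    then have "polyfun ((t * (n mod r) + n div t + j * (2 * r)) + Suc (r * (q - 1 - j))) (Psi n)"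
      unfolding Psi_def j_def[symmetric] by (intro polyfun_mult[OF _ polyfun_monom]) auto
    moreover have "(t * (n mod r) + n div t + j * (2 * r)) + Suc (r * (q - 1 - j)) \<le> D"
    proof -
      have "r * (q - 1) = r * (q - 1 - j) + r * j" using j by (metis distrib_left le_add_diff_inverse2)
      moreover have "r * j \<le> r * (q - 1)" using j by simp
      moreover have "t * (n mod r) \<le> (r - 1) * t" using nr by (simp add: mult.commute)
      ultimately show ?thesis unfolding D_def using nt by (simp add: algebra_simps)
    qed
    ultimately show ?thesis by (rule polyfun_mono)
  qed
  have DN: "D < N"
  proof -
    obtain r' where r': "r = Suc r'" using r1 by (cases r) auto
    obtain q' where q': "q = Suc q'" using q3 by (cases q) auto
    have "D = r' * t + r + 2 + 2 * (r * q')" unfolding D_def r' q' by simp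
    moreover have "r * q' + r = t" unfolding tr q' by (simp add: algebra_simps)
    ultimately have "D + r = r' * t + 2 * t + 2" by linarith
    moreover have "N = r' * t + 3 * t" unfolding N_def r' by (simp add: algebra_simps)
    moreover have "t \<ge> 3" using tr q3 r1 by (metis mult_le_mono nat_mult_1_right)
    ultimately show ?thesis using r1 by linarith
  qed
  obtain g where g: "\<And>n. n < N \<Longrightarrow> g n \<in> K" "\<exists>n<N. g n \<noteq> 0"
    and rel: "\<And>x. x \<in> M \<Longrightarrow> (\<Sum>n<N. g n * Psi n x) = 0"
  proof (rule polyfun_dependent[of N D Psi, OF Psi_poly DN])
    fix c assume "\<And>i. i < N \<Longrightarrow> c i \<in> K" "\<exists>i<N. c i \<noteq> 0" "\<And>x. x \<in> M \<Longrightarrow> (\<Sum>i<N. c i * Psi i x) = 0"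
    then show thesis by (rule that)
  qed
  define F where "F x = (\<Sum>n<N. g n * Phi n x)" for x
  obtain n0 where n0: "n0 < N" "exact_degree (r * (q - 1) + n0) F"
    using exact_degree_combination[of N "r * (q - 1)" Phi g] Phi_degree g unfolding F_def by blast

  have F_zero: "F x = 0" if x: "x \<in> E" "x \<noteq> 0" and tra: "(\<Sum>i<2 * m. (a * x + b * iv x) ^ (q ^ i)) = c" for x
  proof -
    have xM: "x \<in> M" using x EM by auto
    have ivM: "iv x \<in> M" "x * iv x = e" using iv[of x] x xM by auto
    define y where "y = x ^ t"
    have yM: "y \<in> M" unfolding y_def using xM t_pos by simp
    have yt: "y ^ t = x" unfolding y_def t_def
      using E.pow_q[OF x(1)] by (simp add: cardE q_def power_mult[symmetric] power2_eq_square)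
    define u where "u = (\<Sum>i<m. (a * x + b * iv x) ^ (q ^ i))"
    have fM: "a * x + b * iv x \<in> M" using ab xM ivM by auto
    have uM: "u \<in> M" unfolding u_def using fM q3 by (intro sum_mem power_mem) auto
    have ut: "u + u ^ t = c"
    proof -
      have "u ^ t = (\<Sum>i<m. ((a * x + b * iv x) ^ (q ^ i)) ^ t)"
        unfolding u_def t_def q_def using fM K.q_pos by (intro frob_sum power_mem) auto
      also have "\<dots> = (\<Sum>i<m. (a * x + b * iv x) ^ (q ^ (m + i)))"
        unfolding t_def by (simp add: power_mult[symmetric] power_add mult.commute)
      also have "\<dots> = (\<Sum>i\<in>{m..<2*m}. (a * x + b * iv x) ^ (q ^ i))"
        by (rule sum.reindex_bij_witness[where i = "\<lambda>i. i - m" and j = "\<lambda>i. m + i"]) auto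
      finally have "u + u ^ t = (\<Sum>i\<in>{..<m} \<union> {m..<2*m}. (a * x + b * iv x) ^ (q ^ i))"
        unfolding u_def by (subst sum.union_disjoint) auto
      also have "{..<m} \<union> {m..<2*m} = {..<2*m}" by auto
      finally show ?thesis using tra by simp
    qed
    have Uu: "U x = x ^ r * u"
    proof -
      have "x ^ r * (a * x + b * iv x) ^ (q ^ i) = a * x ^ (r + q ^ i) + b * x ^ (r - q ^ i)" if "i < m" for i
      proof -
        have s: "x ^ s * iv x ^ s * b = b" for s
        proof (induction s)
          case (Suc s)
          have "x ^ Suc s * iv x ^ Suc s * b = (x * iv x) * (x ^ s * iv x ^ s * b)" by (simp add: mult_ac)
          then show ?case using Suc ivM ab by simp
        qed simp
        have "(a * x + b * iv x) ^ (q ^ i) = a ^ (q ^ i) * x ^ (q ^ i) + b ^ (q ^ i) * iv x ^ (q ^ i)"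
          using frob[of "a * x" "b * iv x" i] ab xM ivM unfolding q_def by (simp add: power_mult_distrib)
        also have "\<dots> = a * x ^ (q ^ i) + b * iv x ^ (q ^ i)" using ab unfolding q_def by simp
        finally have *: "(a * x + b * iv x) ^ (q ^ i) = a * x ^ (q ^ i) + b * iv x ^ (q ^ i)" .
        have "x ^ r * (b * iv x ^ (q ^ i)) = x ^ (r - q ^ i) * (x ^ (q ^ i) * iv x ^ (q ^ i) * b)"
          using pow_le_r[OF that] by (metis (no_types, opaque_lifting) le_add_diff_inverse2 mult.assoc mult.commute power_add)
        then show ?thesis unfolding * s by (simp add: distrib_left power_add mult_ac)
      qed
      then show ?thesis unfolding U_def u_def by (simp add: sum_distrib_left)
    qed
    have Ut: "x ^ r * U x ^ t = y ^ r * W x"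
    proof -
      have yr: "(x ^ r) ^ t = y ^ r" unfolding y_def by (simp add: power_mult[symmetric] mult.commute)
      have "U x ^ t = y ^ r * u ^ t" unfolding Uu power_mult_distrib yr ..
      also have "u ^ t = c - u" using ut by (simp add: eq_diff_eq add.commute)
      finally have Uxt: "U x ^ t = y ^ r * (c - u)" .
      have "x ^ r * U x ^ t = y ^ r * (c * x ^ r + - (x ^ r * u))" unfolding Uxt by (simp add: algebra_simps)
      then show ?thesis unfolding W_def Uu[symmetric] .
    qed
    have te: "e ^ t = e" unfolding t_def q_def by simp
    have PhiPsi: "x ^ (r * (q - 1)) * Phi n x ^ t = y ^ (r * (q - 1)) * Psi n x" for n
    proof -
      define i where "i = n mod r"
      define j where "j = (n div r) mod q"
      define l where "l = n div t"
      have j: "j \<le> q - 1" using q3 unfolding j_def by (simp add: less_Suc_eq_le[symmetric])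
      have split: "z ^ (r * (q - 1)) = z ^ (r * (q - 1 - j)) * (z ^ r) ^ j" for z :: 'r
        using j by (metis distrib_left le_add_diff_inverse2 power_add power_mult)
      have yt': "y ^ (t * l) = x ^ l" by (simp add: power_mult yt)
      have "Phi n x ^ t = (e * (y ^ i * x ^ l)) * (e * (U x ^ t) ^ j) * (e * y ^ (r * (q - 1 - j)))"
      proof -
        have "(x ^ k) ^ t = y ^ k" for k unfolding y_def by (simp flip: power_mult add: mult.commute)
        moreover have "(U x ^ j) ^ t = (U x ^ t) ^ j" by (simp flip: power_mult add: mult.commute)
        ultimately show ?thesis
          unfolding Phi_def i_def[symmetric] j_def[symmetric] l_def[symmetric]
          by (simp add: power_mult_distrib te power_add yt')
      qed
      then have "x ^ (r * (q - 1)) * Phi n x ^ t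
          = (e * e * e) * (y ^ i * x ^ l * y ^ (r * (q - 1 - j)) * x ^ (r * (q - 1 - j)) * (x ^ r * U x ^ t) ^ j)"
        unfolding split[of x] by (simp only: power_mult_distrib mult_ac)
      also have "\<dots> = (y ^ (r * (q - 1 - j)) * (y ^ r) ^ j) * ((e * (y ^ i * x ^ l)) * (e * W x ^ j) * (e * x ^ (r * (q - 1 - j))))"
        unfolding Ut by (simp only: power_mult_distrib mult_ac)
      also have "y ^ i = x ^ (t * i)" unfolding y_def by (simp add: power_mult)
      finally show ?thesis
        unfolding split[of y] Psi_def i_def[symmetric] j_def[symmetric] l_def[symmetric] power_add .
    qed
    have PhiM: "Phi n x \<in> M" for n unfolding Phi_def using xM U_mem[OF xM] by (intro mult_mem mult_power_mem) auto
    have FM: "F x \<in> M" unfolding F_def using PhiM g by (intro sum_mem mult_mem) auto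
    have "F x ^ t = (\<Sum>n<N. (g n * Phi n x) ^ t)"
      unfolding F_def t_def q_def using g PhiM by (intro frob_sum) auto
    also have "\<dots> = (\<Sum>n<N. g n * Phi n x ^ t)"
      using g by (intro sum.cong) (simp_all add: power_mult_distrib t_def q_def)
    finally have "x ^ (r * (q - 1)) * F x ^ t = (\<Sum>n<N. g n * (x ^ (r * (q - 1)) * Phi n x ^ t))"
      by (simp add: sum_distrib_left mult_ac)
    also have "\<dots> = y ^ (r * (q - 1)) * (\<Sum>n<N. g n * Psi n x)"
      unfolding PhiPsi by (simp add: sum_distrib_left mult_ac)
    also have "\<dots> = 0" using rel[OF xM] by simp
    finally have "F x ^ t * x ^ (r * (q - 1)) = 0" by (simp add: mult.commute)
    then have "F x ^ t = 0" using mult_power_eq_0[of "F x ^ t" x] FM xM x t_pos by auto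
    then show ?thesis using power_eq_0 FM by blast
  qed
  have "{x\<in>E - {0}. (\<Sum>i<2 * m. (a * x + b * iv x) ^ (card K ^ i)) = c} \<subseteq> {x\<in>M. F x = 0}"
    using F_zero EM unfolding q_def by auto
  then have "card {x\<in>E - {0}. (\<Sum>i<2 * m. (a * x + b * iv x) ^ (card K ^ i)) = c} \<le> r * (q - 1) + n0"
    using exact_degree_roots[OF n0(2)] by (meson card_mono le_trans)
  also have "\<dots> \<le> t * r + 3 * t"
  proof -
    have "r * (q - 1) \<le> t" unfolding tr by (simp add: mult.commute)
    moreover have "n0 < t * r + 2 * t" using n0(1) unfolding N_def by (simp add: algebra_simps)
    ultimately show ?thesis by linarith
  qed
  also have "\<dots> = card K ^ (2 * m - 1) + 3 * card K ^ m" using tr2 unfolding q_def t_def by simp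
  finally show ?thesis .
qed

end

section \<open>Kloosterman sums\<close>

context fld_ext
begin

lemma trace_in_K:
  assumes "x \<in> M" "x ^ (card K ^ n) = x"
  shows "(\<Sum>i<n. x ^ (card K ^ i)) \<in> K"
proof (rule fixed_in_K)
  show mem: "(\<Sum>i<n. x ^ (card K ^ i)) \<in> M" using assms K.q_pos by (intro sum_mem power_mem) auto
  have "(\<Sum>i<n. x ^ (card K ^ i)) ^ (card K ^ 1) = (\<Sum>i<n. (x ^ (card K ^ i)) ^ (card K ^ 1))"
    using assms K.q_pos by (intro frob_sum power_mem) auto
  also have "\<dots> = (\<Sum>i<n. x ^ (card K ^ Suc i))" by (simp add: power_mult[symmetric] mult.commute)
  finally have "(\<Sum>i<n. x ^ (card K ^ i)) ^ card K + x = (\<Sum>i<Suc n. x ^ (card K ^ i))"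
    unfolding sum.lessThan_Suc_shift by (simp add: add.commute)
  also have "\<dots> = (\<Sum>i<n. x ^ (card K ^ i)) + x" using assms by simp
  finally show "(\<Sum>i<n. x ^ (card K ^ i)) ^ card K = (\<Sum>i<n. x ^ (card K ^ i))" by simp
qed

text \<open>
  Sorting by the trace of \<open>a x + b / x\<close> writes the sum as \<open>\<Sum> n\<^sub>c \<psi>(c)\<close>, where \<open>n\<^sub>c\<close> counts the solutions in Stepanov's
  bound. That bound is one-sided, but the deviations \<open>n\<^sub>c - q ^ (2 m - 1)\<close> add up to \<open>-1\<close>, so their absolute
  values are under control as well. The factor \<open>6 q + 1\<close> is harmless: it does not grow with \<open>E\<close>.
\<close>

lemma kloosterman_crude:
  assumes E: "finite_fld E e" and EM: "E \<subseteq> M" "K \<subseteq> E" and cardE: "card E = (card K ^ m) ^ 2" and m: "m > 0"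
    and ab: "a \<in> K - {0}" "b \<in> K - {0}" and chi: "char_fld K e \<psi>"
  shows "cmod (\<Sum>x\<in>E - {0}. \<psi> (\<Sum>i<2 * m. (a * x + b * iv x) ^ (card K ^ i)))
           \<le> (6 * real (card K) + 1) * real (card K) ^ m"
proof -
  interpret E: finite_fld E e by (rule E)
  interpret char_fld K e \<psi> by (rule chi)
  have EMmem: "x \<in> E \<Longrightarrow> x \<in> M" for x using EM by auto
  define tr where "tr x = (\<Sum>i<2 * m. (a * x + b * iv x) ^ (card K ^ i))" for x
  define n where "n c = card {x\<in>E - {0}. tr x = c}" for c
  have ivE: "iv x \<in> E" if "x \<in> E" "x \<noteq> 0" for x
    using iv_unique[of x "E.iv x"] E.iv[OF that] that EM by (metis EMmem)
  have tr_mem: "tr x \<in> K" if "x \<in> E - {0}" for x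
  proof -
    have *: "a * x + b * iv x \<in> E" using that ab EM ivE by (intro E.add_mem E.mult_mem) auto
    have "(a * x + b * iv x) ^ (card K ^ (2 * m)) = a * x + b * iv x"
      using E.pow_q[OF *] unfolding cardE by (simp add: power_mult[symmetric] mult.commute)
    then show ?thesis unfolding tr_def using * EMmem by (intro trace_in_K) auto
  qed
  define A where "A = real (card K ^ (2 * m - 1))"
  have nA: "real (n c) - A \<le> 3 * real (card K ^ m)" if "c \<in> K" for c
  proof -
    have "n c \<le> card K ^ (2 * m - 1) + 3 * card K ^ m"
      unfolding n_def tr_def using stepanov_bound[OF E EM(1) cardE m ab that] .
    then have "real (n c) \<le> real (card K ^ (2 * m - 1) + 3 * card K ^ m)" by (simp only: of_nat_le_iff)
    then show ?thesis unfolding A_def by simp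
  qed
  have qA: "real (card K) * A = real (card E)"
    unfolding A_def cardE using m by (simp add: power_mult[symmetric] power_Suc[symmetric] mult.commute del: power_Suc)
  have "(\<Sum>c\<in>K. n c) = (\<Sum>c\<in>K. \<Sum>x\<in>{x\<in>E - {0}. tr x = c}. 1)" unfolding n_def by simp
  also have "\<dots> = (\<Sum>x\<in>E - {0}. 1)" by (rule sum.group) (use tr_mem in auto)
  also have "\<dots> = card E - 1" by (simp add: card_Diff_singleton)
  finally have "(\<Sum>c\<in>K. n c) + 1 = card E" using E.q_pos by simp
  then have sum_n: "(\<Sum>c\<in>K. real (n c)) + 1 = real (card E)" by (metis of_nat_1 of_nat_add of_nat_sum)
  have "(\<Sum>x\<in>E - {0}. \<psi> (tr x)) = (\<Sum>c\<in>K. \<Sum>x\<in>{x\<in>E - {0}. tr x = c}. \<psi> (tr x))"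
    by (rule sum.group[symmetric]) (use tr_mem in auto)
  also have "\<dots> = (\<Sum>c\<in>K. of_nat (n c) * \<psi> c)" unfolding n_def by (intro sum.cong) auto
  also have "\<dots> = (\<Sum>c\<in>K. of_real (real (n c) - A) * \<psi> c) + of_real A * (\<Sum>c\<in>K. \<psi> c)"
    by (simp add: left_diff_distrib sum_subtractf sum_distrib_left)
  also have "\<dots> = (\<Sum>c\<in>K. of_real (real (n c) - A) * \<psi> c)" by (simp add: sum_chi)
  finally have "cmod (\<Sum>x\<in>E - {0}. \<psi> (tr x)) \<le> (\<Sum>c\<in>K. cmod (of_real (real (n c) - A) * \<psi> c))"
    using norm_sum by metis
  also have "\<dots> = (\<Sum>c\<in>K. \<bar>real (n c) - A\<bar>)"
    by (intro sum.cong) (auto simp: norm_mult chi_norm simp del: of_real_diff)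
  \<comment> \<open>\<open>\<bar>z\<bar> \<le> 2 w - z\<close> whenever \<open>z \<le> w\<close> and \<open>w \<ge> 0\<close>.\<close>
  also have "\<dots> \<le> (\<Sum>c\<in>K. 6 * real (card K ^ m) - (real (n c) - A))"
  proof (rule sum_mono)
    fix c assume "c \<in> K"
    then have "real (n c) - A \<le> 3 * real (card K ^ m)" by (rule nA)
    moreover have "real (card K ^ m) \<ge> 0" by (rule of_nat_0_le_iff)
    ultimately show "\<bar>real (n c) - A\<bar> \<le> 6 * real (card K ^ m) - (real (n c) - A)" by linarith
  qed
  also have "\<dots> = 6 * real (card K ^ m) * real (card K) - ((\<Sum>c\<in>K. real (n c)) - real (card K) * A)"
    by (simp add: sum_subtractf)
  also have "\<dots> = 6 * real (card K ^ m) * real (card K) + 1" using sum_n qA by simp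
  also have "\<dots> \<le> (6 * real (card K) + 1) * real (card K) ^ m"
  proof -
    have "card K ^ m \<ge> 1" using K.q_pos by (simp add: Suc_le_eq)
    then have "real 1 \<le> real (card K ^ m)" by (rule of_nat_mono)
    then show ?thesis by (simp add: algebra_simps)
  qed
  finally show ?thesis unfolding tr_def .
qed

text \<open>
  Passing to the quadratic extension \<open>E = K(s)\<close>, \<open>s\<^sup>2 = d\<close> a nonsquare, turns the Kloosterman sum \<open>S\<close> into
  \<open>2 q - S\<^sup>2\<close>. An element \<open>u + v s\<close> has trace \<open>2 u\<close> and norm \<open>n = u\<^sup>2 - d v\<^sup>2\<close>, and its summand depends only on \<open>u\<close>
  and \<open>n\<close>. In \<open>S\<^sup>2\<close> the pairs are written as \<open>(u + v, u - v)\<close>; their sum is \<open>2 u\<close>, their product is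
  \<open>n = u\<^sup>2 - v\<^sup>2\<close>, and the summand is the same function of \<open>u\<close> and \<open>n\<close>. Since \<open>v\<^sup>2\<close> and \<open>d v\<^sup>2\<close> together cover
  \<open>K\<close> twice, the two sums together run twice over all \<open>u\<close> and all \<open>n \<noteq> 0\<close>, and the sum over \<open>u\<close> vanishes
  unless \<open>a + b / n = 0\<close>.
\<close>

lemma quadratic_extension:
  assumes sqrt: "\<And>x. x \<in> M \<Longrightarrow> \<exists>y\<in>M. y * y = x"
    and chi: "char_fld K e \<psi>" and ab: "a \<in> K - {0}" "b \<in> K - {0}"
  obtains E where "fld_ext M E e" "K \<subseteq> E" "card E = (card K)\<^sup>2" "\<And>x. x \<in> E \<Longrightarrow> x + x ^ card K \<in> K"
    "char_fld E e (\<lambda>x. \<psi> (x + x ^ card K))"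
    "(\<Sum>x\<in>E - {0}. \<psi> ((a * x + b * iv x) + (a * x + b * iv x) ^ card K))
       + (\<Sum>x\<in>K - {0}. \<psi> (a * x + b * iv x))\<^sup>2 = 2 * of_nat (card K)"
proof -
  interpret char_fld K e \<psi> by (rule chi)
  obtain d where d: "d \<in> K - {0}" "d \<notin> K.nzsq" by (rule K.ex_nonsq)
  obtain s where s: "s \<in> M" "s * s = d" using sqrt[of d] d by auto
  have sK: "s \<notin> K" using d s unfolding K.nzsq_def by force
  have frob1: "(x + y) ^ card K = x ^ card K + y ^ card K" if "x \<in> M" "y \<in> M" for x y
    using frob[OF that, of 1] by simp
  have powM: "x ^ card K \<in> M" if "x \<in> M" for x using that K.q_pos by simp
  \<comment> \<open>The power squares to \<open>s\<^sup>2\<close>, and it is not \<open>s\<close> because \<open>s\<close> is not in \<open>K\<close>.\<close>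
  have s_pow: "s ^ card K = - s"
  proof -
    have "s ^ card K * s ^ card K = s * s" using K.pow_q[of d] d by (simp add: s(2) flip: power_mult_distrib)
    then have "(s ^ card K - s) * (s ^ card K + s) = 0" by (simp add: algebra_simps)
    moreover have "s ^ card K - s \<noteq> 0" using fixed_in_K[of s] s sK by auto
    ultimately have "s ^ card K + s = 0" using powM[OF s(1)] s(1)
      no_zero_divisors[of "s ^ card K - s" "s ^ card K + s"] by auto
    then show ?thesis by (simp add: eq_neg_iff_add_eq_0)
  qed
  define E where "E = (\<lambda>(x, y). x + y * s) ` (K \<times> K)"
  have E_iff: "x \<in> E \<longleftrightarrow> (\<exists>u\<in>K. \<exists>v\<in>K. x = u + v * s)" for x unfolding E_def by auto
  have E_I: "x \<in> E" if "u \<in> K" "v \<in> K" "x = u + v * s" for x u v unfolding E_iff using that by blast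
  have EM: "E \<subseteq> M" using E_iff s by auto
  have inj: "inj_on (\<lambda>(x, y). x + y * s) (K \<times> K)"
  proof (rule inj_onI, clarify)
    fix u v u' v' assume uv: "u \<in> K" "v \<in> K" "u' \<in> K" "v' \<in> K" "u + v * s = u' + v' * s"
    then have eq: "u - u' = (v' - v) * s" by (simp add: algebra_simps)
    have "v' - v = 0"
    proof (rule ccontr)
      assume nz: "v' - v \<noteq> 0"
      have "s = K.iv (v' - v) * ((v' - v) * s)"
        using K.iv_left[OF _ nz] uv s by (simp add: mult.assoc[symmetric])
      also have "\<dots> = K.iv (v' - v) * (u - u')" using eq by simp
      also have "\<dots> \<in> K" using K.iv(1)[OF _ nz] uv by auto
      finally show False using sK by simp
    qed
    then show "u = u' \<and> v = v'" using eq by auto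
  qed
  have card_E: "card E = (card K)\<^sup>2" unfolding E_def
    by (simp add: card_image[OF inj] card_cartesian_product power2_eq_square)
  have conj: "(u + v * s) ^ card K = u - v * s" if "u \<in> K" "v \<in> K" for u v
    using frob1[of u "v * s"] that s K.pow_q by (simp add: power_mult_distrib s_pow)
  have zero_iff: "u + v * s = 0 \<longleftrightarrow> u = 0 \<and> v = 0" if "u \<in> K" "v \<in> K" for u v
    using inj_onD[OF inj, of "(u, v)" "(0, 0)"] that by auto
  have norm: "(u + v * s) * (u - v * s) = u * u - d * (v * v)" for u v
    by (simp add: algebra_simps flip: s(2))
  have norm_nz: "u * u - d * (v * v) \<noteq> 0" if "u \<in> K" "v \<in> K" "u \<noteq> 0 \<or> v \<noteq> 0" for u v
  proof -
    have "u + v * s \<noteq> 0" "u - v * s \<noteq> 0" using zero_iff[of u v] zero_iff[of u "- v"] that by auto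
    then show ?thesis using norm[of u v] that s mult_eq_0 by (metis K_in_M add_mem diff_mem mult_mem)
  qed
  have iv_E: "iv (u + v * s) = u * K.iv (u * u - d * (v * v)) + (- v * K.iv (u * u - d * (v * v))) * s"
    if "u \<in> K" "v \<in> K" "u \<noteq> 0 \<or> v \<noteq> 0" for u v
  proof (rule sym, rule iv_unique)
    let ?n = "u * u - d * (v * v)"
    have n: "?n \<in> K" "?n \<noteq> 0" using norm_nz[OF that] that d by auto
    show "u + v * s \<in> M" using that s by auto
    show "u * K.iv ?n + (- v * K.iv ?n) * s \<in> M" using that s K.iv(1)[OF n] by auto
    have "(u + v * s) * (u * K.iv ?n + (- v * K.iv ?n) * s) = ((u + v * s) * (u - v * s)) * K.iv ?n"
      by (simp add: algebra_simps)
    also have "\<dots> = e" unfolding norm using K.iv[OF n] by simp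
    finally show "(u + v * s) * (u * K.iv ?n + (- v * K.iv ?n) * s) = e" .
  qed
  have KE: "K \<subseteq> E"
  proof
    fix x assume "x \<in> K"
    then show "x \<in> E" by (intro E_I[of x 0]) auto
  qed
  have finE: "finite_fld E e"
  proof
    show "e \<in> E" "e \<noteq> 0" using KE by auto
    show "finite E" unfolding E_def by simp
    show "odd (card E)" unfolding card_E using K.odd_card by simp
    fix x assume x: "x \<in> E"
    then obtain u v where uv: "u \<in> K" "v \<in> K" "x = u + v * s" using E_iff by blast
    show "- x \<in> E" using uv by (intro E_I[of "- u" "- v"]) auto
    show "e * x = x" using uv s by auto
    show "\<exists>y\<in>E. x * y = e" if "x \<noteq> 0"
    proof (intro bexI[of _ "iv x"])
      show "x * iv x = e" using that x EM iv by auto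
      have nz: "u \<noteq> 0 \<or> v \<noteq> 0" using that uv by auto
      show "iv x \<in> E" unfolding uv(3) iv_E[OF uv(1,2) nz]
        using uv K.iv(1)[of "u * u - d * (v * v)"] norm_nz[OF uv(1,2) nz] d
        by (intro E_I[OF _ _ refl] K.mult_mem) auto
    qed
    fix y assume y: "y \<in> E"
    then obtain u' v' where uv': "u' \<in> K" "v' \<in> K" "y = u' + v' * s" using E_iff by blast
    show "x + y \<in> E" using uv uv'
      by (intro E_I[of "u + u'" "v + v'"]) (auto simp: algebra_simps)
    show "x * y \<in> E"
    proof (rule E_I)
      show "u * u' + d * (v * v') \<in> K" "u * v' + v * u' \<in> K" using uv uv' d by auto
      show "x * y = u * u' + d * (v * v') + (u * v' + v * u') * s"
        unfolding uv uv' s(2)[symmetric] by (simp add: algebra_simps)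
    qed
  qed
  have extE: "fld_ext M E e"
  proof -
    obtain p k where pk: "prime p" "k > 0" "card K = p ^ k" using card_primepow unfolding primepow_def by blast
    have "card E = p ^ (k * 2)" unfolding card_E pk(3) by (simp add: power_mult)
    then have "primepow (card E)" unfolding primepow_def using pk by (intro exI[of _ p] exI[of _ "k * 2"]) auto
    then show ?thesis using finE EM fld_axioms unfolding fld_ext_def fld_ext_axioms_def by blast
  qed
  have trace: "(u + v * s) + (u + v * s) ^ card K = u + u" if "u \<in> K" "v \<in> K" for u v
    using conj[OF that] by simp
  have traceK: "x + x ^ card K \<in> K" if "x \<in> E" for x
  proof -
    obtain u v where uv: "u \<in> K" "v \<in> K" "x = u + v * s" using \<open>x \<in> E\<close> E_iff by blast
    show ?thesis unfolding uv(3) trace[OF uv(1,2)] using uv by (intro K.add_mem)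
  qed
  define h where "h = K.iv (2 * e)"
  have h0: "h \<in> K" "(2 * e) * h = e" unfolding h_def using K.iv[of "2 * e"] by auto
  then have h: "h \<in> K" "2 * h = e" by (simp_all add: mult.assoc)
  have half: "2 * (x * h) = x" if "x \<in> K" for x
  proof -
    have "2 * (x * h) = x * (2 * h)" by (simp only: mult_ac)
    then show ?thesis using h(2) that by simp
  qed
  have charE: "char_fld E e (\<lambda>x. \<psi> (x + x ^ card K))"
  proof (intro char_fld.intro char_fld_axioms.intro finE)
    show "\<psi> (x + y + (x + y) ^ card K) = \<psi> (x + x ^ card K) * \<psi> (y + y ^ card K)" if "x \<in> E" "y \<in> E" for x y
    proof -
      have "x + y + (x + y) ^ card K = (x + x ^ card K) + (y + y ^ card K)"
        using frob1[of x y] that EM by auto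
      then show ?thesis using chi_add[OF traceK traceK] that by metis
    qed
    show "cmod (\<psi> (x + x ^ card K)) = 1" if "x \<in> E" for x using chi_norm traceK that by simp
    obtain z where z: "z \<in> K" "\<psi> z \<noteq> 1" using chi_nontriv by blast
    have zh: "(z * h) ^ card K = z * h" using z h by (intro K.pow_q) auto
    have "(z * h) + (z * h) ^ card K = z" unfolding zh mult_2[symmetric] using z by (intro half)
    moreover have "z * h \<in> E" using KE z h by auto
    ultimately show "\<exists>x\<in>E. \<psi> (x + x ^ card K) \<noteq> 1" using z by metis
  qed
  \<comment> \<open>The common summand of both sums as a function of half the trace and of the norm.\<close>
  define G where "G u n = (if n = 0 then 0 else \<psi> ((a + b * K.iv n) * (u + u)))" for u n
  have sumE: "(\<Sum>x\<in>E - {0}. \<psi> ((a * x + b * iv x) + (a * x + b * iv x) ^ card K))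
     = (\<Sum>u\<in>K. \<Sum>v\<in>K. G u (u * u - d * (v * v)))"
  proof -
    have im: "E - {0} = (\<lambda>(x, y). x + y * s) ` (K \<times> K - {(0, 0)})"
      unfolding E_def using zero_iff by auto
    have inj': "inj_on (\<lambda>(x, y). x + y * s) (K \<times> K - {(0, 0)})" using inj by (rule inj_on_subset) auto
    have "(\<Sum>x\<in>E - {0}. \<psi> ((a * x + b * iv x) + (a * x + b * iv x) ^ card K))
      = (\<Sum>(u, v)\<in>K \<times> K - {(0, 0)}. G u (u * u - d * (v * v)))"
      unfolding im
    proof (subst sum.reindex[OF inj'], rule sum.cong[OF refl])
      fix p assume "p \<in> K \<times> K - {(0, 0)}"
      then obtain u v where p: "p = (u, v)" and uv: "u \<in> K" "v \<in> K" and nz: "u \<noteq> 0 \<or> v \<noteq> 0" by auto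
      define n where "n = u * u - d * (v * v)"
      have n: "n \<noteq> 0" "n \<in> K" using norm_nz[OF uv(1,2) nz] uv d unfolding n_def by auto
      have "a * (u + v * s) + b * iv (u + v * s) = (a + b * K.iv n) * u + (a * v - b * (v * K.iv n)) * s"
        unfolding iv_E[OF uv(1,2) nz] n_def[symmetric] by (simp add: algebra_simps)
      then have "a * (u + v * s) + b * iv (u + v * s) + (a * (u + v * s) + b * iv (u + v * s)) ^ card K
        = (a + b * K.iv n) * u + (a + b * K.iv n) * u"
        using trace[of "(a + b * K.iv n) * u" "a * v - b * (v * K.iv n)"] uv ab n K.iv by auto
      also have "\<dots> = (a + b * K.iv n) * (u + u)" by (simp only: distrib_left)
      finally have tr: "a * (u + v * s) + b * iv (u + v * s) + (a * (u + v * s) + b * iv (u + v * s)) ^ card K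
        = (a + b * K.iv n) * (u + u)" .
      show "((\<lambda>x. \<psi> (a * x + b * iv x + (a * x + b * iv x) ^ card K)) \<circ> (\<lambda>(x, y). x + y * s)) p
        = (case p of (u, v) \<Rightarrow> G u (u * u - d * (v * v)))"
        unfolding p o_def prod.case tr n_def[symmetric] G_def using n by simp
    qed
    also have "\<dots> = (\<Sum>(u, v)\<in>K \<times> K. G u (u * u - d * (v * v)))"
      by (rule sum.mono_neutral_left) (auto simp: G_def)
    also have "\<dots> = (\<Sum>u\<in>K. \<Sum>v\<in>K. G u (u * u - d * (v * v)))" by (simp add: sum.cartesian_product)
    finally show ?thesis .
  qed
  have sumK: "(\<Sum>x\<in>K - {0}. \<psi> (a * x + b * iv x))\<^sup>2 = (\<Sum>u\<in>K. \<Sum>v\<in>K. G u (u * u - v * v))"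
  proof -
    have fac: "u * u - v * v = (u + v) * (u - v)" for u v :: 'r by (simp add: algebra_simps)
    have "(\<Sum>x\<in>K - {0}. \<psi> (a * x + b * iv x))\<^sup>2
      = (\<Sum>(x, y)\<in>(K - {0}) \<times> (K - {0}). \<psi> (a * x + b * iv x) * \<psi> (a * y + b * iv y))"
      unfolding power2_eq_square sum_product by (simp add: sum.cartesian_product)
    also have "\<dots> = (\<Sum>(u, v)\<in>{(u, v) \<in> K \<times> K. u * u - v * v \<noteq> 0}. G u (u * u - v * v))"
    proof (rule sum.reindex_bij_witness[where i = "\<lambda>(u, v). (u + v, u - v)"
          and j = "\<lambda>(x, y). ((x + y) * h, (x - y) * h)"], goal_cases)
      case (1 p)
      obtain x y where p: "p = (x, y)" "x \<in> K" "y \<in> K" "x \<noteq> 0" "y \<noteq> 0" using 1 by auto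
      have "(x + y) * h + (x - y) * h = x" "(x + y) * h - (x - y) * h = y"
        using half[of x] half[of y] p by (simp_all add: algebra_simps)
      then show ?case unfolding p by simp
    next
      case (2 p)
      obtain x y where p: "p = (x, y)" "x \<in> K" "y \<in> K" "x \<noteq> 0" "y \<noteq> 0" using 2 by auto
      have "(x + y) * h + (x - y) * h = x" "(x + y) * h - (x - y) * h = y"
        using half[of x] half[of y] p by (simp_all add: algebra_simps)
      then show ?case unfolding p using p h by (simp add: fac)
    next
      case (3 p)
      obtain u v where p: "p = (u, v)" "u \<in> K" "v \<in> K" using 3 by auto
      have "((u + v) + (u - v)) * h = u" "((u + v) - (u - v)) * h = v"
        using half[of u] half[of v] p by (simp_all add: algebra_simps)
      then show ?case unfolding p by simp
    next
      case (4 p) then show ?case by (auto simp: fac)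
    next
      case (5 p)
      obtain x y where p: "p = (x, y)" "x \<in> K" "y \<in> K" "x \<noteq> 0" "y \<noteq> 0" using 5 by auto
      define u v where "u = (x + y) * h" and "v = (x - y) * h"
      have uv: "x = u + v" "y = u - v"
        using half[of x] half[of y] p by (simp_all add: u_def v_def algebra_simps)
      have uvK: "u \<in> K" "v \<in> K" unfolding u_def v_def using p h by auto
      define n where "n = u * u - v * v"
      have nxy: "n = x * y" unfolding n_def fac uv ..
      have n: "n \<in> K" "n \<noteq> 0" unfolding nxy using p by auto
      have ivx: "iv x = y * K.iv n"
        using iv_unique[of x "y * K.iv n"] K.iv[OF n] p unfolding nxy by (simp add: mult.assoc)
      have ivy: "iv y = x * K.iv n"
        using iv_unique[of y "x * K.iv n"] K.iv[OF n] p unfolding nxy by (simp add: mult_ac)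
      have "\<psi> (a * x + b * iv x) * \<psi> (a * y + b * iv y) = \<psi> ((a * x + b * iv x) + (a * y + b * iv y))"
        using p ab by (intro chi_add[symmetric]) auto
      also have "(a * x + b * iv x) + (a * y + b * iv y) = (a + b * K.iv n) * (x + y)"
        unfolding ivx ivy by (simp add: algebra_simps)
      also have "x + y = u + u" unfolding uv by simp
      finally show ?case unfolding p u_def[symmetric] v_def[symmetric] using n
        unfolding G_def n_def by (simp add: u_def[symmetric] v_def[symmetric])
    qed
    also have "\<dots> = (\<Sum>(u, v)\<in>K \<times> K. G u (u * u - v * v))"
      by (rule sum.mono_neutral_left) (auto simp: G_def)
    also have "\<dots> = (\<Sum>u\<in>K. \<Sum>v\<in>K. G u (u * u - v * v))" by (simp add: sum.cartesian_product)
    finally show ?thesis .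
  qed
  have "(\<Sum>v\<in>K. G u (u * u - d * (v * v))) + (\<Sum>v\<in>K. G u (u * u - v * v)) = 2 * (\<Sum>n\<in>K. G u n)"
    if u: "u \<in> K" for u
  proof -
    have "(\<Sum>v\<in>K. G u (u * u - d * (v * v))) + (\<Sum>v\<in>K. G u (u * u - v * v)) = (\<Sum>v\<in>K. 2 * G u (u * u - v))"
      using K.sum_nonsquare[OF d, of "\<lambda>v. G u (u * u - v)"] K.sum_square[of "\<lambda>v. G u (u * u - v)"]
      by (simp add: sum.distrib[symmetric] algebra_simps)
    also have "\<dots> = (\<Sum>n\<in>K. 2 * G u n)"
      by (rule sum.reindex_bij_witness[where i = "\<lambda>n. u * u - n" and j = "\<lambda>n. u * u - n"]) (use u in auto)
    finally show ?thesis by (simp add: sum_distrib_left)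
  qed
  then have "(\<Sum>u\<in>K. \<Sum>v\<in>K. G u (u * u - d * (v * v))) + (\<Sum>u\<in>K. \<Sum>v\<in>K. G u (u * u - v * v))
     = (\<Sum>u\<in>K. 2 * (\<Sum>n\<in>K. G u n))"
    by (simp add: sum.distrib[symmetric])
  also have "\<dots> = 2 * (\<Sum>n\<in>K. \<Sum>u\<in>K. G u n)"
    by (subst sum.swap) (simp add: sum_distrib_left)
  also have "(\<Sum>n\<in>K. \<Sum>u\<in>K. G u n) = (\<Sum>n\<in>K. if n = - (b * K.iv a) then of_nat (card K) else 0)"
  proof (rule sum.cong[OF refl])
    fix n assume n: "n \<in> K"
    have nz: "- (b * K.iv a) \<noteq> 0" using ab K.iv K.iv_nz by auto
    show "(\<Sum>u\<in>K. G u n) = (if n = - (b * K.iv a) then of_nat (card K) else 0)"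
    proof (cases "n = 0")
      case True then show ?thesis using nz by (auto simp: G_def)
    next
      case False
      have ivn: "K.iv n \<in> K" "n * K.iv n = e" using K.iv n False by auto
      have iva: "K.iv a \<in> K" "a * K.iv a = e" using K.iv ab by auto
      have "(\<Sum>u\<in>K. G u n) = (\<Sum>u\<in>K. \<psi> (((a + b * K.iv n) * (e + e)) * u))"
      proof (rule sum.cong[OF refl])
        fix u assume "u \<in> K"
        then have eu: "u + u = (e + e) * u" by (simp only: distrib_right K.e_left)
        show "G u n = \<psi> (((a + b * K.iv n) * (e + e)) * u)"
          unfolding G_def eu if_not_P[OF False] by (simp only: mult.assoc)
      qed
      also have "\<dots> = (if (a + b * K.iv n) * (e + e) = 0 then of_nat (card K) else 0)"
        using ab ivn by (intro sum_chi_mult) auto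
      also have "(a + b * K.iv n) * (e + e) = 0 \<longleftrightarrow> a + b * K.iv n = 0"
        using K.mult_eq_0[of "a + b * K.iv n" "e + e"] K.two_e_nz ab ivn by auto
      also have "\<dots> \<longleftrightarrow> n = - (b * K.iv a)"
      proof
        assume z: "a + b * K.iv n = 0"
        have "n + b * K.iv a = (n * K.iv a) * (a + b * K.iv n)"
        proof -
          have "(n * K.iv a) * (a + b * K.iv n) = n * (a * K.iv a) + (n * K.iv n) * (b * K.iv a)" by (simp add: algebra_simps)
          then show ?thesis using ivn iva n ab by auto
        qed
        then show "n = - (b * K.iv a)" using z by (simp add: eq_neg_iff_add_eq_0)
      next
        assume z: "n = - (b * K.iv a)"
        have "a + b * K.iv n = (a * K.iv n) * (n + b * K.iv a)"
        proof -
          have "(a * K.iv n) * (n + b * K.iv a) = a * (n * K.iv n) + (a * K.iv a) * (b * K.iv n)" by (simp add: algebra_simps)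
          then show ?thesis using ivn iva n ab by auto
        qed
        then show "a + b * K.iv n = 0" using z by simp
      qed
      finally show ?thesis .
    qed
  qed
  also have "\<dots> = of_nat (card K)" using ab K.iv by (subst sum.delta) auto
  finally have "(\<Sum>x\<in>E - {0}. \<psi> ((a * x + b * iv x) + (a * x + b * iv x) ^ card K))
       + (\<Sum>x\<in>K - {0}. \<psi> (a * x + b * iv x))\<^sup>2 = 2 * of_nat (card K)"
    unfolding sumE sumK .
  then show thesis using that extE KE card_E traceK charE by blast
qed

end

lemma (in char_fld) char_cong:
  assumes "\<And>x. x \<in> K \<Longrightarrow> \<psi> x = \<chi> x"
  shows "char_fld K e \<psi>"
proof (intro char_fld.intro char_fld_axioms.intro finite_fld_axioms)
  show "\<psi> (x + y) = \<psi> x * \<psi> y" if "x \<in> K" "y \<in> K" for x y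
    using that assms chi_add by simp
  show "cmod (\<psi> x) = 1" if "x \<in> K" for x using that assms chi_norm by simp
  show "\<exists>x\<in>K. \<psi> x \<noteq> 1" using assms chi_nontriv by force
qed

context fld_ext
begin

text \<open>
  Transitivity of the trace in a tower whose upper step is quadratic: the character used after
  \<open>j + 1\<close> quadratic extensions is the one after \<open>j\<close> extensions composed with \<open>x \<mapsto> x + x\<^sup>Q\<close>.
\<close>

lemma trace_double:
  assumes "x \<in> M"
  shows "(\<Sum>i<n. (x + x ^ (card K ^ n)) ^ (card K ^ i)) = (\<Sum>i<2 * n. x ^ (card K ^ i))"
proof -
  have "(\<Sum>i<n. (x + x ^ (card K ^ n)) ^ (card K ^ i)) = (\<Sum>i<n. x ^ (card K ^ i) + x ^ (card K ^ (n + i)))"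
  proof (rule sum.cong[OF refl])
    fix i
    have "x ^ (card K ^ n) \<in> M" using assms K.q_pos by (intro power_mem) auto
    then show "(x + x ^ (card K ^ n)) ^ (card K ^ i) = x ^ (card K ^ i) + x ^ (card K ^ (n + i))"
      using frob[OF assms, of "x ^ (card K ^ n)" i] by (simp add: power_mult[symmetric] power_add)
  qed
  also have "\<dots> = (\<Sum>i<n. x ^ (card K ^ i)) + (\<Sum>i<n. x ^ (card K ^ (n + i)))" by (rule sum.distrib)
  also have "(\<Sum>i<n. x ^ (card K ^ (n + i))) = (\<Sum>i\<in>{n..<2*n}. x ^ (card K ^ i))"
    by (rule sum.reindex_bij_witness[where i = "\<lambda>i. i - n" and j = "\<lambda>i. n + i"]) auto
  also have "(\<Sum>i<n. x ^ (card K ^ i)) + \<dots> = (\<Sum>i\<in>{..<n} \<union> {n..<2*n}. x ^ (card K ^ i))"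
    by (subst sum.union_disjoint) auto
  also have "{..<n} \<union> {n..<2*n} = {..<2*n}" by auto
  finally show ?thesis .
qed

text \<open>
  In the scale of the square root of the order of the field, the recursion \<open>S' = 2 Q - S\<^sup>2\<close> reads
  \<open>\<kappa>' \<ge> \<kappa>\<^sup>2 - 2\<close> for the absolute values. A value \<open>\<kappa> = 2 + \<theta>\<close> above \<open>2\<close> grows: \<open>\<kappa>\<^sup>2 - 2 \<ge> 2 + 4 \<theta>\<close>.
\<close>

lemma kloosterman_tower:
  assumes sqrt: "\<And>x. x \<in> M \<Longrightarrow> \<exists>y\<in>M. y * y = x"
    and chi: "char_fld K e \<psi>" and ab: "a \<in> K - {0}" "b \<in> K - {0}"
    and big: "cmod (\<Sum>x\<in>K - {0}. \<psi> (a * x + b * iv x)) \<ge> (2 + \<theta>) * sqrt (real (card K))" and th: "\<theta> \<ge> 0"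
  shows "\<exists>E. fld_ext M E e \<and> K \<subseteq> E \<and> card E = card K ^ (2 ^ j)
    \<and> char_fld E e (\<lambda>x. \<psi> (\<Sum>i<2 ^ j. x ^ (card K ^ i)))
    \<and> cmod (\<Sum>x\<in>E - {0}. \<psi> (\<Sum>i<2 ^ j. (a * x + b * iv x) ^ (card K ^ i)))
        \<ge> (2 + 4 ^ j * \<theta>) * sqrt (real (card E))"
proof (induction j)
  case 0
  have "fld_ext M K e" by unfold_locales
  then show ?case using chi big by (intro exI[of _ K]) simp
next
  case (Suc j)
  define tr where "tr x = (\<Sum>i<2 ^ j. x ^ (card K ^ i))" for x :: 'r
  define tr' where "tr' x = (\<Sum>i<2 ^ Suc j. x ^ (card K ^ i))" for x :: 'r
  obtain E where E: "fld_ext M E e" "K \<subseteq> E" "card E = card K ^ (2 ^ j)" "char_fld E e (\<lambda>x. \<psi> (tr x))"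
    "cmod (\<Sum>x\<in>E - {0}. \<psi> (tr (a * x + b * iv x))) \<ge> (2 + 4 ^ j * \<theta>) * sqrt (real (card E))"
    using Suc.IH unfolding tr_def by blast
  interpret E: fld_ext M E e by (rule E(1))
  have ab': "a \<in> E - {0}" "b \<in> E - {0}" using ab E(2) by auto
  obtain E' where E': "fld_ext M E' e" "E \<subseteq> E'" "card E' = (card E)\<^sup>2"
    "char_fld E' e (\<lambda>x. \<psi> (tr (x + x ^ card E)))"
    "(\<Sum>x\<in>E' - {0}. \<psi> (tr ((a * x + b * iv x) + (a * x + b * iv x) ^ card E)))
       + (\<Sum>x\<in>E - {0}. \<psi> (tr (a * x + b * iv x)))\<^sup>2 = 2 * of_nat (card E)"
    by (rule E.quadratic_extension[OF sqrt E(4) ab']) blast+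
  interpret E': fld_ext M E' e by (rule E'(1))
  have tr': "tr (x + x ^ card E) = tr' x" if "x \<in> M" for x
    using trace_double[OF that, of "2 ^ j"] unfolding tr_def tr'_def E(3) by simp
  have "char_fld E' e (\<lambda>x. \<psi> (tr' x))"
    by (rule char_fld.char_cong[OF E'(4)]) (use tr' in simp)
  moreover have "(2 + 4 ^ Suc j * \<theta>) * sqrt (real (card E'))
      \<le> cmod (\<Sum>x\<in>E' - {0}. \<psi> (tr' (a * x + b * iv x)))"
  proof -
    define S where "S = (\<Sum>x\<in>E - {0}. \<psi> (tr (a * x + b * iv x)))"
    define S' where "S' = (\<Sum>x\<in>E' - {0}. \<psi> (tr' (a * x + b * iv x)))"
    have "S' = (\<Sum>x\<in>E' - {0}. \<psi> (tr ((a * x + b * iv x) + (a * x + b * iv x) ^ card E)))"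
    proof (unfold S'_def, rule sum.cong[OF refl])
      fix x assume "x \<in> E' - {0}"
      then have "a * x + b * iv x \<in> M" using ab iv by auto
      then show "\<psi> (tr' (a * x + b * iv x)) = \<psi> (tr ((a * x + b * iv x) + (a * x + b * iv x) ^ card E))"
        using tr' by simp
    qed
    then have rec: "S\<^sup>2 = 2 * of_nat (card E) - S'" using E'(5) unfolding S_def by (simp add: eq_diff_eq add.commute)
    have "(cmod S)\<^sup>2 = cmod (S\<^sup>2)" by (simp add: norm_power)
    also have "\<dots> \<le> 2 * real (card E) + cmod S'"
      unfolding rec using norm_triangle_ineq4[of "2 * of_nat (card E) :: complex" S'] by (simp add: norm_mult)
    finally have 1: "cmod S' \<ge> (cmod S)\<^sup>2 - 2 * real (card E)" by simp
    have "((2 + 4 ^ j * \<theta>) * sqrt (real (card E)))\<^sup>2 \<le> (cmod S)\<^sup>2"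
      using E(5) th unfolding S_def by (intro power_mono) auto
    then have 2: "(2 + 4 ^ j * \<theta>)\<^sup>2 * real (card E) \<le> (cmod S)\<^sup>2" by (simp add: power_mult_distrib)
    have "2 + 4 ^ Suc j * \<theta> \<le> (2 + 4 ^ j * \<theta>)\<^sup>2 - 2"
      using th by (simp add: power2_eq_square algebra_simps)
    then have "(2 + 4 ^ Suc j * \<theta>) * real (card E) \<le> ((2 + 4 ^ j * \<theta>)\<^sup>2 - 2) * real (card E)"
      by (intro mult_right_mono) auto
    also have "\<dots> = (2 + 4 ^ j * \<theta>)\<^sup>2 * real (card E) - 2 * real (card E)" by (simp add: left_diff_distrib)
    finally show ?thesis using 1 2 unfolding S'_def[symmetric] E'(3) by (simp add: real_sqrt_power)
  qed
  moreover have "card E' = card K ^ (2 ^ Suc j)" unfolding E'(3) E(3) by (simp add: power_mult[symmetric] mult.commute)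
  ultimately show ?case using E' E(2) unfolding tr'_def by blast
qed

text \<open>
  Weil's bound. A sum beyond \<open>2 \<surd>q\<close> would become arbitrarily large, in the scale of the square root of the
  order, along the tower of quadratic extensions; \<open>kloosterman_crude\<close> bounds it by \<open>6 q + 1\<close> in all of
  them. At least one extension is made, as the crude bound needs a field whose order is an even
  power of \<open>q\<close>.
\<close>

theorem kloosterman_weil:
  assumes sqrt: "\<And>x. x \<in> M \<Longrightarrow> \<exists>y\<in>M. y * y = x"
    and chi: "char_fld K e \<psi>" and ab: "a \<in> K - {0}" "b \<in> K - {0}"
  shows "cmod (\<Sum>x\<in>K - {0}. \<psi> (a * x + b * iv x)) \<le> 2 * sqrt (real (card K))"
proof (rule ccontr)
  define S where "S = cmod (\<Sum>x\<in>K - {0}. \<psi> (a * x + b * iv x))"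
  assume "\<not> ?thesis"
  then have S: "S > 2 * sqrt (real (card K))" unfolding S_def by simp
  have sq: "sqrt (real (card K)) > 0" using K.q_pos by simp
  define \<theta> where "\<theta> = S / sqrt (real (card K)) - 2"
  have th: "\<theta> > 0" unfolding \<theta>_def using S sq by (simp add: field_simps)
  have "(2 + (S / w - 2)) * w = S" if "w > 0" for w using that by simp
  from this[OF sq] have "(2 + \<theta>) * sqrt (real (card K)) = S" unfolding \<theta>_def .
  then have big: "S \<ge> (2 + \<theta>) * sqrt (real (card K))" by simp
  obtain n :: nat where n: "(6 * real (card K) + 1) / \<theta> < real n" using reals_Archimedean2 by blast
  define j where "j = Suc n"
  have "real n < 4 ^ j"
  proof -
    have "n < 2 ^ n" by (rule less_exp)
    also have "\<dots> \<le> (4::nat) ^ j" unfolding j_def by (simp add: order_trans[OF power_mono[of 2 4 n]])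
    finally show ?thesis by (metis of_nat_less_iff of_nat_numeral of_nat_power)
  qed
  then have "(6 * real (card K) + 1) / \<theta> < 4 ^ j" using n by linarith
  then have n4: "6 * real (card K) + 1 < 4 ^ j * \<theta>" using th by (simp add: pos_divide_less_eq)
  obtain E where E: "fld_ext M E e" "K \<subseteq> E" "card E = card K ^ (2 ^ j)"
    "cmod (\<Sum>x\<in>E - {0}. \<psi> (\<Sum>i<2 ^ j. (a * x + b * iv x) ^ (card K ^ i)))
        \<ge> (2 + 4 ^ j * \<theta>) * sqrt (real (card E))"
    using kloosterman_tower[OF sqrt chi ab big[unfolded S_def] less_imp_le[OF th], of j] by blast
  interpret E: fld_ext M E e by (rule E(1))
  define m :: nat where "m = 2 ^ n"
  have m2: "2 ^ j = 2 * m" unfolding j_def m_def by simp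
  have cE: "card E = (card K ^ m)\<^sup>2" unfolding E(3) m2 by (simp add: power_mult[symmetric] mult.commute)
  have up: "cmod (\<Sum>x\<in>E - {0}. \<psi> (\<Sum>i<2 * m. (a * x + b * iv x) ^ (card K ^ i)))
     \<le> (6 * real (card K) + 1) * real (card K) ^ m"
    by (rule kloosterman_crude[OF E.K.finite_fld_axioms E.sub E(2) cE _ ab chi]) (simp add: m_def)
  have sE: "sqrt (real (card E)) = real (card K) ^ m" unfolding cE by simp
  have "(2 + 4 ^ j * \<theta>) * real (card K) ^ m \<le> (6 * real (card K) + 1) * real (card K) ^ m"
    using E(4)[unfolded sE] up[folded m2] by (rule order_trans)
  then have "2 + 4 ^ j * \<theta> \<le> 6 * real (card K) + 1" using K.q_pos by (simp add: mult_le_cancel_right)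
  then show False using n4 by simp
qed

end

text \<open>
  The prime field consists of the \<open>p\<close> multiples of \<open>e\<close>, on which \<open>n e \<mapsto> exp (2 \<pi> i n / p)\<close> is a character.
  It is composed with the trace, which is not identically zero since it is a polynomial of degree
  \<open>p ^ (k - 1) < q\<close>.
\<close>

lemma (in finite_fld) ex_character:
  assumes "primepow q"
  obtains \<chi> where "char_fld K e \<chi>"
proof -
  obtain p k where pk: "prime p" "k > 0" "q = p ^ k" "of_nat p * e = 0" by (rule prime_char[OF assms])
  define nm where "nm n = of_nat n * e" for n
  have nm_add: "nm (m + n) = nm m + nm n" for m n unfolding nm_def by (simp add: distrib_right)
  have nm_mult: "nm (m * n) = nm m * nm n" for m n
    unfolding nm_def by (simp add: mult_ac flip: mult.assoc[of e e])
  have nm_p: "nm (p * n) = 0" for n 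
  proof -
    have "nm (p * n) = of_nat n * (of_nat p * e)" unfolding nm_def by (simp only: of_nat_mult mult_ac)
    then show ?thesis using pk(4) by simp
  qed
  have nm_mod: "nm (n mod p) = nm n" for n
  proof -
    have "nm n = nm (p * (n div p) + n mod p)" by simp
    then show ?thesis unfolding nm_add nm_p by simp
  qed
  have p2: "p > 1" using pk(1) prime_gt_1_nat by blast
  have nm_nz: "nm t \<noteq> 0" if "0 < t" "t < p" for t
  proof
    assume z: "nm t = 0"
    have "coprime t p" using pk(1) that by (metis coprime_commute nat_dvd_not_less prime_imp_coprime)
    then obtain s where s: "[t * s = 1] (mod p)" using cong_solve_coprime_nat by (metis One_nat_def)
    have "nm (t * s) = nm 1" using nm_mod[of "t * s"] nm_mod[of 1] s unfolding cong_def by simp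
    then show False using z nm_mult[of t s] by (simp add: nm_def)
  qed
  define P where "P = nm ` {..<p}"
  have P_I: "nm n \<in> P" for n
    unfolding P_def using nm_mod[of n] p2 by (metis image_eqI lessThan_iff mod_less_divisor order.strict_trans zero_less_one)
  have PK: "P \<subseteq> K" unfolding P_def nm_def by auto
  have inj: "inj_on nm {..<p}"
  proof (rule linorder_inj_onI)
    fix x y assume "x < y" "x \<in> {..<p}" "y \<in> {..<p}"
    then have "nm (y - x) \<noteq> 0" "nm y = nm x + nm (y - x)" using nm_nz[of "y - x"] nm_add[of x "y - x"] by auto
    then show "nm x \<noteq> nm y" by auto
  qed auto
  have card_P: "card P = p" unfolding P_def by (simp add: card_image[OF inj])
  have P_mult: "x * y \<in> P" if "x \<in> P" "y \<in> P" for x y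
    using that P_I nm_mult unfolding P_def by (metis (no_types, lifting) imageE)
  have P_pow: "x * x ^ n \<in> P" if "x \<in> P" for x n
    by (induction n) (use that P_mult[OF that] in \<open>simp_all\<close>)
  have finP: "finite_fld P e"
  proof
    have "nm 1 = e" unfolding nm_def by simp
    then show "e \<in> P" using P_I by metis
    show "e \<noteq> 0" by simp
    show "finite P" unfolding P_def by simp
    show "odd (card P)" unfolding card_P using odd_card pk by simp
    fix x assume x: "x \<in> P"
    then obtain m where m: "x = nm m" unfolding P_def by auto
    have "nm m + nm ((p - 1) * m) = nm (p * m)" unfolding nm_add[symmetric] using p2
      by (metis Suc_diff_1 mult_Suc order.strict_trans zero_less_one)
    then have "- x = nm ((p - 1) * m)" unfolding m nm_p by (simp add: add_eq_0_iff)
    then show "- x \<in> P" using P_I by simp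
    show "e * x = x" using x PK by auto
    show "\<exists>y\<in>P. x * y = e" if "x \<noteq> 0"
    proof (intro bexI)
      have "x * (x * x ^ (q - 3)) = x ^ (q - 1)" using q_ge
        by (simp add: Suc_diff_Suc numeral_3_eq_3 flip: power_Suc)
      then show "x * (x * x ^ (q - 3)) = e" using pow_q_minus_1[of x] x PK that by auto
      show "x * x ^ (q - 3) \<in> P" by (rule P_pow[OF x])
    qed
    show "x * y \<in> P" if "y \<in> P" for y using P_mult x that by blast
    show "x + y \<in> P" if "y \<in> P" for y using P_I nm_add x that unfolding P_def by (metis (no_types, lifting) imageE)
  qed
  have "primepow (card P)" unfolding card_P using pk(1) by simp
  then have "fld_ext K P e" using finP PK fld_axioms unfolding fld_ext_def fld_ext_axioms_def by blast
  then interpret P: fld_ext K P e .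
  define tr where "tr x = (\<Sum>i<k. x ^ (card P ^ i))" for x :: 'r
  have tr_mem: "tr x \<in> P" if "x \<in> K" for x
    unfolding tr_def using that pow_q[OF that] pk(3) by (intro P.trace_in_K) (simp_all add: card_P)
  have tr_add: "tr (x + y) = tr x + tr y" if "x \<in> K" "y \<in> K" for x y
    unfolding tr_def using P.frob[OF that] by (simp add: sum.distrib)
  have tr_mult: "tr (c * x) = c * tr x" if "c \<in> P" "x \<in> K" for c x
    unfolding tr_def using that by (simp add: power_mult_distrib sum_distrib_left)
  obtain x0 where x0: "x0 \<in> K" "tr x0 = e"
  proof -
    have "P.exact_degree (p ^ (k - 1)) (\<lambda>x. e * x ^ (p ^ (k - 1)) + (\<Sum>i<k - 1. e * x ^ (p ^ i)))"
      using p2 by (intro P.exact_degree_add P.exact_degree_monom P.polyfun_sum P.polyfun_monom)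
        (auto intro: power_strict_increasing)
    moreover have "tr x = e * x ^ (p ^ (k - 1)) + (\<Sum>i<k - 1. e * x ^ (p ^ i))" if "x \<in> K" for x
    proof -
      have "{..<k} = insert (k - 1) {..<k - 1}" using pk(2) by auto
      moreover have "x ^ (p ^ i) \<in> K" for i using that p2 by (intro power_mem) auto
      ultimately show ?thesis unfolding tr_def card_P by (simp add: add.commute)
    qed
    ultimately have "P.exact_degree (p ^ (k - 1)) tr" using P.exact_degree_cong by blast
    then have "card {x\<in>K. tr x = 0} \<le> p ^ (k - 1)" using P.exact_degree_roots by blast
    also have "\<dots> < card K" unfolding pk(3) using p2 pk(2) by (intro power_strict_increasing) auto
    finally have "{x\<in>K. tr x = 0} \<noteq> K" by auto
    then obtain x where x: "x \<in> K" "tr x \<noteq> 0" by blast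
    have "tr (P.K.iv (tr x) * x) = e"
      using tr_mult[OF P.K.iv(1) x(1)] P.K.iv_left tr_mem x by metis
    moreover have "P.K.iv (tr x) * x \<in> K" using P.K.iv(1) tr_mem x PK by auto
    ultimately show thesis using that by blast
  qed
  define z where "z = cis (2 * pi / real p)"
  have zp: "z ^ p = 1" unfolding z_def using p2 by (simp add: DeMoivre)
  have z1: "z \<noteq> 1"
  proof -
    have "p \<noteq> 2" using odd_card pk by auto
    then have "real p > 2" using p2 by simp
    then have "sin (2 * pi / real p) > 0" by (intro sin_gt_zero) (auto simp: field_simps)
    then show ?thesis unfolding z_def by (metis cis.sel(2) less_irrefl one_complex.sel(2))
  qed
  have z_mod: "z ^ (n mod p) = z ^ n" for n
  proof -
    have "z ^ n = z ^ (p * (n div p) + n mod p)" by simp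
    then show ?thesis unfolding power_add power_mult zp by simp
  qed
  define w where "w y = z ^ (the_inv_into {..<p} nm y)" for y
  have w: "w (nm n) = z ^ n" for n
  proof -
    have "the_inv_into {..<p} nm (nm (n mod p)) = n mod p"
      using p2 by (intro the_inv_into_f_f[OF inj]) auto
    then show ?thesis unfolding w_def nm_mod by (simp add: z_mod)
  qed
  have "char_fld K e (\<lambda>x. w (tr x))"
  proof (intro char_fld.intro char_fld_axioms.intro finite_fld_axioms)
    fix x assume x: "x \<in> K"
    then obtain m where m: "tr x = nm m" using tr_mem unfolding P_def by blast
    show "cmod (w (tr x)) = 1" unfolding m w by (simp add: z_def norm_power)
    fix y assume y: "y \<in> K"
    then obtain n where n: "tr y = nm n" using tr_mem unfolding P_def by blast
    show "w (tr (x + y)) = w (tr x) * w (tr y)"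
      unfolding tr_add[OF x y] m n nm_add[symmetric] w by (rule power_add)
  next
    have "e = nm 1" unfolding nm_def by simp
    then have "w (tr x0) = z" using w[of 1] x0 by simp
    then show "\<exists>x\<in>K. w (tr x) \<noteq> 1" using z1 x0 by metis
  qed
  then show thesis by (rule that)
qed

section \<open>Gauss sums and the Fourier transform of spheres\<close>

context finite_fld
begin

definition vec :: "nat \<Rightarrow> (nat \<Rightarrow> 'r) set" where "vec n = {..<n} \<rightarrow>\<^sub>E K"

definition dot :: "nat \<Rightarrow> (nat \<Rightarrow> 'r) \<Rightarrow> (nat \<Rightarrow> 'r) \<Rightarrow> 'r" where "dot n x y = (\<Sum>i<n. x i * y i)"

definition sphere :: "nat \<Rightarrow> 'r \<Rightarrow> (nat \<Rightarrow> 'r) set" where "sphere n t = {x\<in>vec n. dot n x x = t}"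

definition vzero :: "nat \<Rightarrow> nat \<Rightarrow> 'r" where "vzero n = (\<lambda>i\<in>{..<n}. 0)"

lemma finite_vec [simp]: "finite (vec n)" unfolding vec_def by (intro finite_PiE) auto

lemma card_vec: "card (vec n) = q ^ n" unfolding vec_def by (simp add: card_PiE)

lemma vec_nth [simp]: "x \<in> vec n \<Longrightarrow> i < n \<Longrightarrow> x i \<in> K" unfolding vec_def by auto

lemma dot_mem [simp]: "x \<in> vec n \<Longrightarrow> y \<in> vec n \<Longrightarrow> dot n x y \<in> K"
  unfolding dot_def by (intro sum_mem mult_mem) auto

lemma vzero_mem [simp]: "vzero n \<in> vec n" unfolding vzero_def vec_def by auto

lemma vec_eqI: "x \<in> vec n \<Longrightarrow> y \<in> vec n \<Longrightarrow> (\<And>i. i < n \<Longrightarrow> x i = y i) \<Longrightarrow> x = y"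
  unfolding vec_def by (intro PiE_ext) auto

lemma vec_eq_zero_iff: "x \<in> vec n \<Longrightarrow> x = vzero n \<longleftrightarrow> (\<forall>i<n. x i = 0)"
  using vec_eqI[of x n "vzero n"] vzero_mem[of n] by (auto simp: vzero_def)

lemma dot_commute: "dot n x y = dot n y x" unfolding dot_def by (simp add: mult.commute)

definition vadd :: "nat \<Rightarrow> (nat \<Rightarrow> 'r) \<Rightarrow> (nat \<Rightarrow> 'r) \<Rightarrow> nat \<Rightarrow> 'r" where
  "vadd n x y = (\<lambda>i\<in>{..<n}. x i + y i)"

lemma vadd_mem [simp]: "x \<in> vec n \<Longrightarrow> y \<in> vec n \<Longrightarrow> vadd n x y \<in> vec n"
  by (subst vec_def) (simp add: vadd_def)

definition vsub :: "nat \<Rightarrow> (nat \<Rightarrow> 'r) \<Rightarrow> (nat \<Rightarrow> 'r) \<Rightarrow> nat \<Rightarrow> 'r" where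
  "vsub n x y = (\<lambda>i\<in>{..<n}. x i - y i)"

lemma vsub_mem [simp]: "x \<in> vec n \<Longrightarrow> y \<in> vec n \<Longrightarrow> vsub n x y \<in> vec n"
  by (subst vec_def) (simp add: vsub_def)

lemma vsub_eq_0: "x \<in> vec n \<Longrightarrow> y \<in> vec n \<Longrightarrow> vsub n x y = vzero n \<longleftrightarrow> x = y"
  using vec_eq_zero_iff[of "vsub n x y" n] vec_eqI[of x n y] vsub_mem[of x n y] by (auto simp: vsub_def)

lemma dot_vsub: "dot n m (vsub n x y) = dot n m x - dot n m y"
  unfolding dot_def vsub_def by (simp add: right_diff_distrib sum_subtractf)

end

context char_fld
begin

definition gauss :: complex where "gauss = (\<Sum>x\<in>K. \<chi> (x * x))"

lemma gauss_eta: "gauss = (\<Sum>v\<in>K. eta v * \<chi> v)"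
  unfolding gauss_def sum_square by (simp add: distrib_right sum.distrib sum_chi)

lemma gauss_twist: assumes "s \<in> K - {0}" shows "(\<Sum>x\<in>K. \<chi> (s * (x * x))) = eta s * gauss"
proof -
  have "(\<Sum>x\<in>K. \<chi> (s * (x * x))) = (\<Sum>v\<in>K. (1 + eta v) * \<chi> (s * v))"
    using sum_square[of "\<lambda>v. \<chi> (s * v)"] .
  also have "\<dots> = (\<Sum>v\<in>K. eta v * \<chi> (s * v))"
    using assms by (simp add: distrib_right sum.distrib sum_chi_mult)
  also have "\<dots> = (\<Sum>v\<in>K. eta s * (eta (s * v) * \<chi> (s * v)))"
  proof (rule sum.cong[OF refl])
    fix v assume "v \<in> K"
    then have sv: "eta (s * v) = eta s * eta v" using assms by (intro eta_mult) auto
    have "eta s * eta (s * v) = (eta s * eta s) * eta v" unfolding sv by (simp only: mult.assoc)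
    also have "\<dots> = eta v" using assms eta_sq[of s] by simp
    finally have "eta s * eta (s * v) = eta v" .
    then show "eta v * \<chi> (s * v) = eta s * (eta (s * v) * \<chi> (s * v))" by (simp add: mult.assoc[symmetric])
  qed
  also have "\<dots> = eta s * (\<Sum>v\<in>K. eta (s * v) * \<chi> (s * v))" by (simp add: sum_distrib_left)
  also have "(\<Sum>v\<in>K. eta (s * v) * \<chi> (s * v)) = gauss"
    unfolding gauss_eta using sum.reindex_bij_betw[OF bij_mult[of s], of "\<lambda>v. eta v * \<chi> v"] assms by simp
  finally show ?thesis .
qed

lemma gauss_linear: assumes "s \<in> K - {0}" "m \<in> K"
  shows "(\<Sum>x\<in>K. \<chi> (s * (x * x) + m * x)) = \<chi> (- (m * m * iv (4 * s))) * (eta s * gauss)"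
proof -
  have s2: "2 * s \<in> K" "2 * s \<noteq> 0" using assms by auto
  have "4 * s = 2 * (2 * s)" by simp
  then have s4: "4 * s \<in> K" "4 * s \<noteq> 0" using s2 two_mult_mem two_mult_nz by metis+
  define k where "k = iv (2 * s)"
  have k: "k \<in> K" "2 * s * k = e" unfolding k_def using iv[OF s2] by auto
  define t where "t = m * k"
  have t: "t \<in> K" unfolding t_def using assms k by simp
  have st: "2 * (s * t) = m"
  proof -
    have "2 * (s * t) = m * (2 * s * k)" unfolding t_def by (simp only: mult_ac)
    then show ?thesis using k assms by simp
  qed
  have "iv (4 * s) = s * (k * k)"
  proof (rule iv_unique[symmetric])
    have "4 * s * (s * (k * k)) = (2 * s * k) * (2 * s * k)" by (simp add: mult_ac)
    then show "4 * s * (s * (k * k)) = e" using k by simp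
  qed (use s4 assms k in auto)
  then have k4: "m * m * iv (4 * s) = s * (t * t)" unfolding t_def by (simp only: mult_ac)
  have "(\<Sum>x\<in>K. \<chi> (s * (x * x) + m * x)) = (\<Sum>x\<in>K. \<chi> (- (s * (t * t))) * \<chi> (s * ((t + x) * (t + x))))"
  proof (rule sum.cong[OF refl])
    fix x assume x: "x \<in> K"
    have "s * (x * x) + m * x = - (s * (t * t)) + s * ((t + x) * (t + x))"
      unfolding st[symmetric] by (simp add: algebra_simps)
    moreover have "\<chi> (- (s * (t * t)) + s * ((t + x) * (t + x))) = \<chi> (- (s * (t * t))) * \<chi> (s * ((t + x) * (t + x)))"
      using x t assms by (intro chi_add) auto
    ultimately show "\<chi> (s * (x * x) + m * x) = \<chi> (- (s * (t * t))) * \<chi> (s * ((t + x) * (t + x)))"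
      by simp
  qed
  also have "\<dots> = \<chi> (- (s * (t * t))) * (\<Sum>x\<in>K. \<chi> (s * (x * x)))"
    using sum.reindex_bij_betw[OF bij_add[OF t], of "\<lambda>x. \<chi> (s * (x * x))"] by (simp only: sum_distrib_left[symmetric])
  finally show ?thesis unfolding gauss_twist[OF assms(1)] k4 .
qed

lemma gauss_norm: "gauss * cnj gauss = of_nat q"
proof -
  have "gauss * cnj gauss = (\<Sum>y\<in>K. \<Sum>x\<in>K. \<chi> (x * x) * \<chi> (- (y * y)))"
    unfolding gauss_def cnj_sum sum_product by (subst sum.swap) (simp add: chi_minus)
  also have "\<dots> = (\<Sum>y\<in>K. \<Sum>t\<in>K. \<chi> (t * t) * \<chi> (2 * t * y))"
  proof (rule sum.cong[OF refl])
    fix y assume y: "y \<in> K"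
    have "(\<Sum>x\<in>K. \<chi> (x * x) * \<chi> (- (y * y))) = (\<Sum>t\<in>K. \<chi> ((y + t) * (y + t)) * \<chi> (- (y * y)))"
      using sum.reindex_bij_betw[OF bij_add[OF y], of "\<lambda>x. \<chi> (x * x) * \<chi> (- (y * y))"] by simp
    also have "\<dots> = (\<Sum>t\<in>K. \<chi> (t * t) * \<chi> (2 * t * y))"
    proof (rule sum.cong[OF refl])
      fix t assume t: "t \<in> K"
      have "\<chi> ((y + t) * (y + t)) * \<chi> (- (y * y)) = \<chi> ((y + t) * (y + t) + - (y * y))"
        using y t by (intro chi_add[symmetric]) auto
      also have "(y + t) * (y + t) + - (y * y) = t * t + 2 * t * y" by (simp add: algebra_simps)
      finally show "\<chi> ((y + t) * (y + t)) * \<chi> (- (y * y)) = \<chi> (t * t) * \<chi> (2 * t * y)"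
        using y t by (simp add: chi_add)
    qed
    finally show "(\<Sum>x\<in>K. \<chi> (x * x) * \<chi> (- (y * y))) = (\<Sum>t\<in>K. \<chi> (t * t) * \<chi> (2 * t * y))" .
  qed
  also have "\<dots> = (\<Sum>t\<in>K. \<chi> (t * t) * (\<Sum>y\<in>K. \<chi> (2 * t * y)))"
    by (subst sum.swap) (simp add: sum_distrib_left)
  also have "\<dots> = (\<Sum>t\<in>K. if t = 0 then of_nat q else 0)"
    using sum_chi_mult by (intro sum.cong) auto
  also have "\<dots> = of_nat q" by simp
  finally show ?thesis .
qed

lemma gauss_cmod: "cmod gauss = sqrt (real q)"
proof -
  have "of_real ((cmod gauss)\<^sup>2) = (of_real (real q) :: complex)"
    using gauss_norm unfolding complex_norm_square by simp
  then have "(cmod gauss)\<^sup>2 = real q" by (simp only: of_real_eq_iff)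
  then show ?thesis by (metis norm_ge_zero real_sqrt_unique)
qed

text \<open>
  By completing the square, \<open>\<eta>(s) G \<chi>(-1/s)\<close> is the sum of \<open>\<chi>(s x\<^sup>2 + 2 x)\<close> over \<open>x\<close>. After this substitution the
  sum over \<open>s\<close> is a complete one and forces \<open>x\<^sup>2 = - a\<close>, which leaves at most two terms. So the twisted sums
  are elementary, in contrast to Kloosterman sums.
\<close>

lemma salie_normalised: assumes "a \<in> K"
  shows "cmod (\<Sum>s\<in>K - {0}. eta s * \<chi> (a * s - iv s)) \<le> 2 * sqrt (real q)"
proof -
  define T where "T = (\<Sum>s\<in>K - {0}. eta s * \<chi> (a * s - iv s))"
  have iv4: "2 * e * (2 * e) * iv (4 * s) = iv s" if s: "s \<in> K - {0}" for s
  proof (rule iv_unique)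
    have "4 * s = 2 * (2 * s)" by simp
    then have s4: "4 * s \<in> K" "4 * s \<noteq> 0" using s two_mult_mem two_mult_nz by (metis DiffD1 DiffD2 insertCI)+
    show "s \<in> K" using s by simp
    show "2 * e * (2 * e) * iv (4 * s) \<in> K" using iv(1)[OF s4] by (intro mult_mem two_mult_mem) auto
    have "s * (2 * e * (2 * e) * iv (4 * s)) = (e * e) * (2 * 2 * s * iv (4 * s))" by (simp only: mult_ac)
    then show "s * (2 * e * (2 * e) * iv (4 * s)) = e" using iv(2)[OF s4] by simp
  qed
  have "gauss * T = (\<Sum>s\<in>K - {0}. \<chi> (a * s) * (\<chi> (- (2 * e * (2 * e) * iv (4 * s))) * (eta s * gauss)))"
    unfolding T_def sum_distrib_left
  proof (rule sum.cong[OF refl])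
    fix s assume s: "s \<in> K - {0}"
    then have "\<chi> (a * s - iv s) = \<chi> (a * s) * \<chi> (- iv s)" using chi_add[of "a * s" "- iv s"] assms iv by auto
    then show "gauss * (eta s * \<chi> (a * s - iv s)) = \<chi> (a * s) * (\<chi> (- (2 * e * (2 * e) * iv (4 * s))) * (eta s * gauss))"
      unfolding iv4[OF s] by simp
  qed
  also have "\<dots> = (\<Sum>s\<in>K - {0}. \<Sum>x\<in>K. \<chi> (a * s) * \<chi> (s * (x * x) + 2 * e * x))"
  proof (rule sum.cong[OF refl])
    fix s assume s: "s \<in> K - {0}"
    have "2 * e \<in> K" by simp
    from gauss_linear[OF s this, symmetric]
    show "\<chi> (a * s) * (\<chi> (- (2 * e * (2 * e) * iv (4 * s))) * (eta s * gauss))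
      = (\<Sum>x\<in>K. \<chi> (a * s) * \<chi> (s * (x * x) + 2 * e * x))" by (simp only: sum_distrib_left)
  qed
  also have "\<dots> = (\<Sum>x\<in>K. \<chi> (2 * e * x) * (\<Sum>s\<in>K - {0}. \<chi> ((a + x * x) * s)))"
    unfolding sum_distrib_left
  proof (subst sum.swap, intro sum.cong refl)
    fix x s assume x: "x \<in> K" "s \<in> K - {0}"
    have "\<chi> (a * s) * \<chi> (s * (x * x) + 2 * e * x) = \<chi> (a * s + (s * (x * x) + 2 * e * x))"
      using x assms by (intro chi_add[symmetric]) auto
    also have "a * s + (s * (x * x) + 2 * e * x) = 2 * e * x + (a + x * x) * s" by (simp add: algebra_simps)
    also have "\<chi> \<dots> = \<chi> (2 * e * x) * \<chi> ((a + x * x) * s)" using x assms by (intro chi_add) auto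
    finally show "\<chi> (a * s) * \<chi> (s * (x * x) + 2 * e * x) = \<chi> (2 * e * x) * \<chi> ((a + x * x) * s)" .
  qed
  also have "\<dots> = (\<Sum>x\<in>K. (if a + x * x = 0 then \<chi> (2 * e * x) * of_nat q else 0) - \<chi> (2 * e * x))"
  proof (rule sum.cong[OF refl])
    fix x assume "x \<in> K"
    then have "a + x * x \<in> K" using assms by simp
    from sum_chi_nz[OF this]
    show "\<chi> (2 * e * x) * (\<Sum>s\<in>K - {0}. \<chi> ((a + x * x) * s))
      = (if a + x * x = 0 then \<chi> (2 * e * x) * of_nat q else 0) - \<chi> (2 * e * x)"
      by (simp add: right_diff_distrib)
  qed
  \<comment> \<open>The sum over \<open>s\<close> omits \<open>s = 0\<close>; its contribution \<open>- \<chi>(2 x)\<close> adds up to zero over \<open>x\<close>.\<close>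
  also have "\<dots> = (\<Sum>x\<in>K. if a + x * x = 0 then \<chi> (2 * e * x) * of_nat q else 0)"
    by (simp add: sum_subtractf sum_chi_mult)
  also have "\<dots> = (\<Sum>x\<in>{x\<in>K. x * x = - a}. \<chi> (2 * e * x) * of_nat q)"
    by (simp add: sum.inter_filter[symmetric] add_eq_0_iff)
  finally have eq: "gauss * T = (\<Sum>x\<in>{x\<in>K. x * x = - a}. \<chi> (2 * e * x) * of_nat q)" .
  have "cmod (gauss * T) \<le> (\<Sum>x\<in>{x\<in>K. x * x = - a}. cmod (\<chi> (2 * e * x) * of_nat q))"
    unfolding eq by (rule norm_sum)
  also have "\<dots> = (\<Sum>x\<in>{x\<in>K. x * x = - a}. real q)"
    by (intro sum.cong refl) (simp add: norm_mult chi_norm)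
  also have "\<dots> = real (card {x\<in>K. x * x = - a}) * real q" by simp
  also have "\<dots> \<le> 2 * real q"
  proof -
    have "cmod (of_nat (card {x\<in>K. x * x = - a})) \<le> 2"
      unfolding card_sqrt[OF minus_mem[OF assms]] by (auto simp: eta_def)
    then show ?thesis by (intro mult_right_mono) auto
  qed
  also have "\<dots> = sqrt (real q) * (2 * sqrt (real q))" by simp
  finally have "sqrt (real q) * cmod T \<le> sqrt (real q) * (2 * sqrt (real q))"
    unfolding norm_mult gauss_cmod .
  moreover have "sqrt (real q) > 0" using q_pos by simp
  ultimately show ?thesis unfolding T_def using mult_le_cancel_left_pos by blast
qed

lemma salie_bound: assumes "a \<in> K" "b \<in> K"
  shows "cmod (\<Sum>s\<in>K - {0}. eta s * \<chi> (a * s + b * iv s)) \<le> 2 * sqrt (real q)"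
proof (cases "b = 0")
  case False
  have nb: "- b \<in> K - {0}" using False assms by auto
  have "(\<Sum>s\<in>K - {0}. eta s * \<chi> (a * s + b * iv s))
      = (\<Sum>s\<in>K - {0}. eta (- b * s) * \<chi> (a * (- b * s) + b * iv (- b * s)))"
    using sum.reindex_bij_betw[OF bij_mult_nz[of "- b"], of "\<lambda>s. eta s * \<chi> (a * s + b * iv s)"] nb by auto
  also have "\<dots> = (\<Sum>s\<in>K - {0}. eta (- b) * (eta s * \<chi> ((- (a * b)) * s - iv s)))"
  proof (rule sum.cong[OF refl])
    fix s assume s: "s \<in> K - {0}"
    have bs: "- b * s \<in> K" "- b * s \<noteq> 0" using s nb mult_eq_0[of "- b" s] mult_mem[of "- b" s] by auto
    have "- (b * iv (- b * s)) = iv s"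
    proof (rule iv_unique)
      have "s * - (b * iv (- b * s)) = (- b * s) * iv (- b * s)" by (simp only: mult_ac mult_minus_left mult_minus_right)
      then show "s * - (b * iv (- b * s)) = e" unfolding iv(2)[OF bs] .
    qed (use s nb assms iv(1)[OF bs] in auto)
    then have "b * iv (- b * s) = - iv s" by (metis minus_minus)
    then have "a * (- b * s) + b * iv (- b * s) = a * (- b * s) - iv s" by simp
    moreover have "a * (- b * s) = (- (a * b)) * s" by (simp only: mult.assoc mult_minus_left mult_minus_right)
    ultimately have arg: "a * (- b * s) + b * iv (- b * s) = (- (a * b)) * s - iv s" by simp
    have et: "eta (- b * s) = eta (- b) * eta s" using nb s by (intro eta_mult) auto
    show "eta (- b * s) * \<chi> (a * (- b * s) + b * iv (- b * s)) = eta (- b) * (eta s * \<chi> ((- (a * b)) * s - iv s))"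
      unfolding arg et by (simp only: mult.assoc)
  qed
  also have "\<dots> = eta (- b) * (\<Sum>s\<in>K - {0}. eta s * \<chi> ((- (a * b)) * s - iv s))" by (simp add: sum_distrib_left)
  finally have "cmod (\<Sum>s\<in>K - {0}. eta s * \<chi> (a * s + b * iv s))
    = cmod (eta (- b)) * cmod (\<Sum>s\<in>K - {0}. eta s * \<chi> ((- (a * b)) * s - iv s))" by (simp add: norm_mult)
  also have "cmod (eta (- b)) = 1" using nb by (auto simp: eta_def)
  finally show ?thesis using salie_normalised[of "- (a * b)"] assms by simp
next
  case b: True
  have "(\<Sum>s\<in>K - {0}. eta s * \<chi> (a * s + b * iv s)) = (\<Sum>s\<in>K - {0}. eta s * \<chi> (a * s))"
    unfolding b by simp
  also have "\<dots> = (\<Sum>s\<in>K. eta s * \<chi> (a * s))" by (simp add: sum_diff1)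
  finally have eq: "(\<Sum>s\<in>K - {0}. eta s * \<chi> (a * s + b * iv s)) = (\<Sum>s\<in>K. eta s * \<chi> (a * s))" .
  show ?thesis
  proof (cases "a = 0")
    case True then show ?thesis unfolding eq by (simp add: sum_eta)
  next
    case False
    have "(\<Sum>s\<in>K. eta s * \<chi> (a * s)) = (\<Sum>x\<in>K. \<chi> (a * (x * x)))"
      using sum_square[of "\<lambda>v. \<chi> (a * v)"] False assms by (simp add: distrib_right sum.distrib sum_chi_mult)
    also have "\<dots> = eta a * gauss" using False assms by (intro gauss_twist) auto
    finally have "cmod (\<Sum>s\<in>K. eta s * \<chi> (a * s)) = cmod (eta a) * sqrt (real q)" by (simp add: norm_mult gauss_cmod)
    also have "cmod (eta a) = 1" using False by (auto simp: eta_def)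
    finally show ?thesis unfolding eq by simp
  qed
qed

lemma chi_dot: "x \<in> vec n \<Longrightarrow> y \<in> vec n \<Longrightarrow> \<chi> (dot n x y) = (\<Prod>i<n. \<chi> (x i * y i))"
  unfolding dot_def by (intro chi_sum) auto

lemma sum_chi_dot: assumes "x \<in> vec n"
  shows "(\<Sum>m\<in>vec n. \<chi> (dot n m x)) = (if x = vzero n then of_nat (q ^ n) else 0)"
proof -
  have "(\<Sum>m\<in>vec n. \<chi> (dot n m x)) = (\<Sum>m\<in>vec n. \<Prod>i<n. \<chi> (x i * m i))"
    using assms by (intro sum.cong refl) (simp add: chi_dot mult.commute)
  also have "\<dots> = (\<Prod>i<n. \<Sum>y\<in>K. \<chi> (x i * y))"
    unfolding vec_def by (rule prod_sum_PiE[symmetric]) auto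
  also have "\<dots> = (\<Prod>i<n. if x i = 0 then of_nat q else 0)"
    using assms by (intro prod.cong refl) (simp add: sum_chi_mult)
  also have "\<dots> = (if x = vzero n then of_nat (q ^ n) else 0)"
    using assms by (auto simp: vec_eq_zero_iff)
  finally show ?thesis .
qed

text \<open>
  The condition \<open>m \<bullet> m = t\<close> is expanded in characters \<open>\<chi>(s (m \<bullet> m - t))\<close>. For \<open>s \<noteq> 0\<close> the sum over the vectors
  \<open>m\<close> is a product of \<open>n\<close> one-dimensional Gauss sums. What remains is a Kloosterman sum if \<open>n\<close> is even and
  a twisted one, with the quadratic character, if \<open>n\<close> is odd.
\<close>

lemma sphere_transform:
  assumes t: "t \<in> K" and x: "x \<in> vec n"
  shows "of_nat q * (\<Sum>m\<in>sphere n t. \<chi> (dot n m x))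
    = (if x = vzero n then of_nat (q ^ n) else 0)
      + gauss ^ n * (\<Sum>s\<in>K - {0}. eta s ^ n * \<chi> (- t * s + - (dot n x x * iv (4 * e)) * iv s))"
proof -
  have "4 * e = 2 * (2 * e)" by simp
  then have e4: "4 * e \<in> K" "4 * e \<noteq> 0" using two_mult_mem[of e] two_mult_nz[of e] two_mult_mem[of "2 * e"] two_mult_nz[of "2 * e"] by auto
  have iv4: "iv (4 * s) = iv (4 * e) * iv s" if s: "s \<in> K - {0}" for s
  proof (rule iv_unique[symmetric])
    have "4 * s = (4 * e) * s" using s by (simp add: mult.assoc)
    then show "4 * s \<in> K" using e4 s mult_mem by auto
    show "iv (4 * e) * iv s \<in> K" using e4 s iv by auto
    have "4 * s * (iv (4 * e) * iv s) = (4 * e * iv (4 * e)) * (s * iv s)"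
      unfolding \<open>4 * s = (4 * e) * s\<close> by (simp only: mult_ac)
    then show "4 * s * (iv (4 * e) * iv s) = e" using iv[OF e4] iv[of s] s by simp
  qed
  have "of_nat q * (\<Sum>m\<in>sphere n t. \<chi> (dot n m x))
     = (\<Sum>m\<in>vec n. if dot n m m - t = 0 then of_nat q * \<chi> (dot n m x) else 0)"
    unfolding sphere_def sum_distrib_left by (simp add: sum.inter_filter)
  also have "\<dots> = (\<Sum>m\<in>vec n. \<Sum>s\<in>K. \<chi> ((dot n m m - t) * s) * \<chi> (dot n m x))"
    using t by (intro sum.cong refl) (simp add: sum_distrib_right[symmetric] sum_chi_mult)
  also have "\<dots> = (\<Sum>s\<in>K. \<Sum>m\<in>vec n. \<chi> (- t * s) * (\<Prod>i<n. \<chi> (s * (m i * m i) + x i * m i)))"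
  proof (subst sum.swap, intro sum.cong refl)
    fix s m assume sm: "s \<in> K" "m \<in> vec n"
    have "\<chi> ((dot n m m - t) * s) * \<chi> (dot n m x) = \<chi> ((dot n m m - t) * s + dot n m x)"
      using sm t x by (intro chi_add[symmetric]) auto
    also have "(dot n m m - t) * s + dot n m x = - t * s + (\<Sum>i<n. s * (m i * m i) + x i * m i)"
      unfolding dot_def by (simp add: sum.distrib sum_distrib_left algebra_simps)
    also have "\<chi> \<dots> = \<chi> (- t * s) * \<chi> (\<Sum>i<n. s * (m i * m i) + x i * m i)"
      using sm t x by (intro chi_add sum_mem add_mem) auto
    also have "\<chi> (\<Sum>i<n. s * (m i * m i) + x i * m i) = (\<Prod>i<n. \<chi> (s * (m i * m i) + x i * m i))"
      using sm x by (intro chi_sum) auto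
    finally show "\<chi> ((dot n m m - t) * s) * \<chi> (dot n m x) = \<chi> (- t * s) * (\<Prod>i<n. \<chi> (s * (m i * m i) + x i * m i))" .
  qed
  also have "\<dots> = (\<Sum>s\<in>K. \<chi> (- t * s) * (\<Prod>i<n. \<Sum>y\<in>K. \<chi> (s * (y * y) + x i * y)))"
    unfolding vec_def by (intro sum.cong refl) (simp add: sum_distrib_left[symmetric] prod_sum_PiE)
  also have "\<dots> = \<chi> (- t * 0) * (\<Prod>i<n. \<Sum>y\<in>K. \<chi> (0 * (y * y) + x i * y))
     + (\<Sum>s\<in>K - {0}. \<chi> (- t * s) * (\<Prod>i<n. \<Sum>y\<in>K. \<chi> (s * (y * y) + x i * y)))"
    by (rule sum.remove) auto
  also have "\<chi> (- t * 0) * (\<Prod>i<n. \<Sum>y\<in>K. \<chi> (0 * (y * y) + x i * y)) = (if x = vzero n then of_nat (q ^ n) else 0)"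
  proof -
    have "(\<Prod>i<n. \<Sum>y\<in>K. \<chi> (x i * y)) = (\<Prod>i<n. if x i = 0 then of_nat q else 0)"
      using x by (intro prod.cong refl) (simp add: sum_chi_mult)
    then show ?thesis using x by (auto simp: vec_eq_zero_iff)
  qed
  also have "(\<Sum>s\<in>K - {0}. \<chi> (- t * s) * (\<Prod>i<n. \<Sum>y\<in>K. \<chi> (s * (y * y) + x i * y)))
     = (\<Sum>s\<in>K - {0}. gauss ^ n * (eta s ^ n * \<chi> (- t * s + - (dot n x x * iv (4 * e)) * iv s)))"
  proof (rule sum.cong[OF refl])
    fix s assume s: "s \<in> K - {0}"
    have ivm: "iv (4 * s) \<in> K" unfolding iv4[OF s] using s iv e4 by auto
    have "(\<Prod>i<n. \<Sum>y\<in>K. \<chi> (s * (y * y) + x i * y)) = (\<Prod>i<n. \<chi> (- (x i * x i * iv (4 * s))) * (eta s * gauss))"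
      using s x by (intro prod.cong refl gauss_linear) auto
    also have "\<dots> = (\<Prod>i<n. \<chi> (- (x i * x i * iv (4 * s)))) * (eta s * gauss) ^ n"
      by (simp add: prod.distrib)
    also have "(\<Prod>i<n. \<chi> (- (x i * x i * iv (4 * s)))) = \<chi> (\<Sum>i<n. - (x i * x i * iv (4 * s)))"
      using x ivm by (intro chi_sum[symmetric]) auto
    also have "(\<Sum>i<n. - (x i * x i * iv (4 * s))) = - (dot n x x * iv (4 * e)) * iv s"
      unfolding dot_def iv4[OF s] by (simp add: sum_negf sum_distrib_right mult.assoc)
    finally have P: "(\<Prod>i<n. \<Sum>y\<in>K. \<chi> (s * (y * y) + x i * y))
       = \<chi> (- (dot n x x * iv (4 * e)) * iv s) * (eta s * gauss) ^ n" .
    have "\<chi> (- t * s + - (dot n x x * iv (4 * e)) * iv s) = \<chi> (- t * s) * \<chi> (- (dot n x x * iv (4 * e)) * iv s)"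
      using s t x iv e4 by (intro chi_add mult_mem minus_mem) auto
    then show "\<chi> (- t * s) * (\<Prod>i<n. \<Sum>y\<in>K. \<chi> (s * (y * y) + x i * y))
      = gauss ^ n * (eta s ^ n * \<chi> (- t * s + - (dot n x x * iv (4 * e)) * iv s))"
      unfolding P by (simp add: power_mult_distrib mult_ac)
  qed
  finally show ?thesis by (simp add: sum_distrib_left)
qed

end

section \<open>Decay and energy on spheres\<close>

lemma (in finite_fld) eta_minus_one: assumes "[q = 3] (mod 4)" shows "eta (- e) = - 1"
proof -
  have "- e \<notin> nzsq"
  proof
    assume "- e \<in> nzsq"
    then obtain y where y: "y \<in> K" "y \<noteq> 0" "y * y = - e" unfolding nzsq_def by force
    have "q mod 4 = 3" using assms unfolding cong_def by simp
    then obtain k where k: "q = 4 * k + 3" by (metis mult_div_mod_eq)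
    have pe: "e ^ Suc j = e" for j by (induction j) auto
    have "e = y ^ (q - 1)" using pow_q_minus_1 y by simp
    also have "q - 1 = 2 * Suc (2 * k)" using k by simp
    also have "y ^ (2 * Suc (2 * k)) = (- e) ^ Suc (2 * k)" unfolding power_mult power2_eq_square y(3) ..
    also have "\<dots> = - (e ^ Suc (2 * k))" by (rule power_minus_odd) simp
    finally have "- e = e" unfolding pe by simp
    then show False using minus_neq[of e] by simp
  qed
  then show ?thesis by (simp add: eta_def)
qed

context char_fld
begin

lemma gauss_square: assumes "[q = 3] (mod 4)" shows "gauss\<^sup>2 = - of_nat q"
proof -
  have "cnj gauss = (\<Sum>x\<in>K. \<chi> (- e * (x * x)))" unfolding gauss_def cnj_sum
    by (intro sum.cong refl) (simp add: chi_minus)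
  also have "\<dots> = - gauss" using gauss_twist[of "- e"] eta_minus_one[OF assms] by simp
  finally show ?thesis using gauss_norm by (simp add: power2_eq_square minus_equation_iff)
qed

text \<open>
  Square root cancellation on all spheres, including the one of radius zero. For odd \<open>n\<close> the twisted
  sums are always small. For even \<open>n\<close> the only large case is \<open>t = 0\<close> and \<open>x \<bullet> x = 0\<close>, where the remaining
  sum is \<open>q - 1\<close>. Here \<open>n \<equiv> 2 (mod 4)\<close> and \<open>q \<equiv> 3 (mod 4)\<close> help: the square of the Gauss sum is \<open>- q\<close>, its \<open>n\<close>-th
  power is negative, and the large term has the harmless sign. This is why the bound is for the real
  part only and not for the absolute value.
\<close>

lemma sphere_decay:
  assumes n: "n \<ge> 1" and t: "t \<in> K" and x: "x \<in> vec n"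
    and cases: "odd n \<or> ([n = 2] (mod 4) \<and> [q = 3] (mod 4))"
    and weil: "\<And>a b. a \<in> K - {0} \<Longrightarrow> b \<in> K - {0} \<Longrightarrow> cmod (\<Sum>s\<in>K - {0}. \<chi> (a * s + b * iv s)) \<le> 2 * sqrt (real q)"
  shows "Re (\<Sum>m\<in>sphere n t. \<chi> (dot n m x)) \<le> (if x = vzero n then real q ^ (n - 1) else 0) + 2 * sqrt (real q) ^ (n - 1)"
proof -
  define S where "S = (\<Sum>m\<in>sphere n t. \<chi> (dot n m x))"
  define b where "b = - (dot n x x * iv (4 * e))"
  define T where "T = (\<Sum>s\<in>K - {0}. eta s ^ n * \<chi> (- t * s + b * iv s))"
  have "4 * e = 2 * (2 * e)" by simp
  then have e4: "4 * e \<in> K" "4 * e \<noteq> 0" using two_mult_mem[of e] two_mult_nz[of e] two_mult_mem[of "2 * e"] two_mult_nz[of "2 * e"] by auto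
  have b: "b \<in> K" unfolding b_def using x iv[OF e4] by simp
  have tK: "- t \<in> K" using t by simp
  have sq: "real q = sqrt (real q) * sqrt (real q)" by simp
  have q1: "sqrt (real q) \<ge> 1" using q_pos by simp
  have "of_nat q * S = (if x = vzero n then of_nat (q ^ n) else 0) + gauss ^ n * T"
    using sphere_transform[OF t x] unfolding S_def T_def b_def .
  then have "Re (of_nat q * S) = Re ((if x = vzero n then of_nat (q ^ n) else 0) + gauss ^ n * T)" by simp
  then have main: "real q * Re S = (if x = vzero n then real q ^ n else 0) + Re (gauss ^ n * T)" by (auto split: if_splits)
  have small: "Re (gauss ^ n * T) \<le> 2 * sqrt (real q) ^ (n + 1)" if "cmod T \<le> 2 * sqrt (real q)"
  proof -
    have "Re (gauss ^ n * T) \<le> cmod (gauss ^ n * T)" by (rule complex_Re_le_cmod)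
    also have "\<dots> = sqrt (real q) ^ n * cmod T" by (simp add: norm_mult norm_power gauss_cmod)
    also have "\<dots> \<le> sqrt (real q) ^ n * (2 * sqrt (real q))" using that by (intro mult_left_mono) auto
    also have "\<dots> = 2 * sqrt (real q) ^ (n + 1)" by simp
    finally show ?thesis .
  qed
  have "Re (gauss ^ n * T) \<le> 2 * sqrt (real q) ^ (n + 1)"
  proof (cases "odd n")
    case True
    have "eta s ^ n = eta s" if "s \<in> K - {0}" for s using True that by (auto simp: eta_def)
    then have "T = (\<Sum>s\<in>K - {0}. eta s * \<chi> (- t * s + b * iv s))" unfolding T_def by simp
    then show ?thesis using salie_bound[OF tK b] by (intro small) simp
  next
    case False
    then have n2: "[n = 2] (mod 4)" and q3: "[q = 3] (mod 4)" using cases by auto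
    have "eta s ^ n = 1" if "s \<in> K - {0}" for s using False that by (auto simp: eta_def)
    then have T: "T = (\<Sum>s\<in>K - {0}. \<chi> (- t * s + b * iv s))" unfolding T_def by simp
    have m1: "cmod T \<le> 2 * sqrt (real q)" if "T = - 1"
    proof -
      have "cmod T = 1" unfolding that by simp
      then show ?thesis using q1 by linarith
    qed
    consider "t \<noteq> 0" "b \<noteq> 0" | "t \<noteq> 0" "b = 0" | "t = 0" "b \<noteq> 0" | "t = 0" "b = 0" by blast
    then show ?thesis
    proof cases
      case 1 then show ?thesis using weil[of "- t" b] tK b by (intro small) (simp add: T)
    next
      case 2
      then have "T = - 1" using sum_chi_nz[OF tK] unfolding T by simp
      then show ?thesis using m1 small by blast
    next
      case 3
      then have "T = (\<Sum>s\<in>K - {0}. \<chi> (b * iv s))" unfolding T by simp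
      also have "\<dots> = (\<Sum>s\<in>K - {0}. \<chi> (b * s))"
        using sum.reindex_bij_betw[OF bij_iv, of "\<lambda>s. \<chi> (b * s)"] .
      finally have "T = - 1" using sum_chi_nz[OF b] 3 by simp
      then show ?thesis using m1 small by blast
    next
      case 4
      have "T = of_nat (card (K - {0}))" unfolding T using 4 by simp
      moreover have "gauss ^ n = - of_nat (q ^ (n div 2))"
      proof -
        have "n mod 4 = 2" using n2 unfolding cong_def by simp
        then have "odd (n div 2)" by presburger
        moreover have "n = 2 * (n div 2)" using False by simp
        ultimately have "gauss ^ n = - (of_nat q ^ (n div 2))"
          using gauss_square[OF q3] by (metis power_minus_odd power_mult)
        then show ?thesis by simp
      qed
      ultimately have "gauss ^ n * T = - of_nat (q ^ (n div 2) * card (K - {0}))" by simp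
      then have "Re (gauss ^ n * T) = - real (q ^ (n div 2) * card (K - {0}))" by simp
      also have "\<dots> \<le> 0" by (simp only: neg_le_0_iff_le of_nat_0_le_iff)
      also have "\<dots> \<le> 2 * sqrt (real q) ^ (n + 1)" by simp
      finally show ?thesis .
    qed
  qed
  then have "real q * Re S \<le> (if x = vzero n then real q ^ n else 0) + 2 * sqrt (real q) ^ (n + 1)"
    unfolding main by simp
  also have "\<dots> = real q * ((if x = vzero n then real q ^ (n - 1) else 0) + 2 * sqrt (real q) ^ (n - 1))"
  proof -
    have "n = Suc (n - 1)" using n by simp
    then have "real q ^ n = real q * real q ^ (n - 1)" "sqrt (real q) ^ (n + 1) = (sqrt (real q) * sqrt (real q)) * sqrt (real q) ^ (n - 1)"
      by (metis power_Suc, metis Suc_eq_plus1 mult.assoc power_Suc)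
    then show ?thesis by (simp add: distrib_left)
  qed
  finally show ?thesis unfolding S_def using q_pos by (simp add: mult_le_cancel_left)
qed

lemma chi_dot_vsub: "m \<in> vec n \<Longrightarrow> x \<in> vec n \<Longrightarrow> y \<in> vec n \<Longrightarrow>
    \<chi> (dot n m (vsub n x y)) = \<chi> (dot n m x) * cnj (\<chi> (dot n m y))"
  unfolding dot_vsub using chi_add[of "dot n m x" "- dot n m y"] chi_minus[of "dot n m y"] by simp

lemma norm_square_expand:
  assumes A: "A \<subseteq> vec n" "finite A" and m: "m \<in> vec n"
  shows "of_real ((cmod (\<Sum>a\<in>A. f a * \<chi> (dot n m a)))\<^sup>2)
     = (\<Sum>a\<in>A. \<Sum>b\<in>A. f a * cnj (f b) * \<chi> (dot n m (vsub n a b)))"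
  unfolding complex_norm_square cnj_sum sum_product
proof (intro sum.cong refl)
  fix a b assume "a \<in> A" "b \<in> A"
  then have "a \<in> vec n" "b \<in> vec n" using A by auto
  then show "f a * \<chi> (dot n m a) * cnj (f b * \<chi> (dot n m b)) = f a * cnj (f b) * \<chi> (dot n m (vsub n a b))"
    using chi_dot_vsub[OF m] by simp
qed

lemma parseval:
  assumes A: "A \<subseteq> vec n"
  shows "(\<Sum>m\<in>vec n. (cmod (\<Sum>a\<in>A. f a * \<chi> (dot n m a)))\<^sup>2) = real q ^ n * (\<Sum>a\<in>A. (cmod (f a))\<^sup>2)"
proof -
  have finA: "finite A" using A finite_subset finite_vec by blast
  have "of_real (\<Sum>m\<in>vec n. (cmod (\<Sum>a\<in>A. f a * \<chi> (dot n m a)))\<^sup>2)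
     = (\<Sum>m\<in>vec n. \<Sum>a\<in>A. \<Sum>b\<in>A. f a * cnj (f b) * \<chi> (dot n m (vsub n a b)))"
    unfolding of_real_sum using norm_square_expand[OF A finA] by (intro sum.cong refl) simp
  also have "\<dots> = (\<Sum>a\<in>A. \<Sum>b\<in>A. \<Sum>m\<in>vec n. f a * cnj (f b) * \<chi> (dot n m (vsub n a b)))"
    by (subst sum.swap, rule sum.cong[OF refl], rule sum.swap)
  also have "\<dots> = (\<Sum>a\<in>A. \<Sum>b\<in>A. if a = b then f a * cnj (f a) * of_nat (q ^ n) else 0)"
  proof (intro sum.cong refl)
    fix a b assume "a \<in> A" "b \<in> A"
    then have ab: "a \<in> vec n" "b \<in> vec n" using A by auto
    show "(\<Sum>m\<in>vec n. f a * cnj (f b) * \<chi> (dot n m (vsub n a b))) = (if a = b then f a * cnj (f a) * of_nat (q ^ n) else 0)"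
      using sum_chi_dot[OF vsub_mem[OF ab]] vsub_eq_0[OF ab] by (simp add: sum_distrib_left[symmetric])
  qed
  also have "\<dots> = (\<Sum>a\<in>A. f a * cnj (f a) * of_nat (q ^ n))" using finA by simp
  also have "\<dots> = of_real (real q ^ n * (\<Sum>a\<in>A. (cmod (f a))\<^sup>2))"
    by (simp add: complex_norm_square[symmetric] sum_distrib_left mult.commute)
  finally show ?thesis by (simp only: of_real_eq_iff)
qed

text \<open>
  Expanding the square gives the transform of the sphere at all differences of elements of \<open>A\<close>. The
  diagonal produces the first term and the decay off the diagonal the second one.
\<close>

lemma sphere_energy:
  assumes n: "n \<ge> 1" and t: "t \<in> K" and A: "A \<subseteq> vec n"
    and cases: "odd n \<or> ([n = 2] (mod 4) \<and> [q = 3] (mod 4))"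
    and weil: "\<And>a b. a \<in> K - {0} \<Longrightarrow> b \<in> K - {0} \<Longrightarrow> cmod (\<Sum>s\<in>K - {0}. \<chi> (a * s + b * iv s)) \<le> 2 * sqrt (real q)"
  shows "(\<Sum>m\<in>sphere n t. (cmod (\<Sum>a\<in>A. \<chi> (dot n m a)))\<^sup>2)
    \<le> real q ^ (n - 1) * real (card A) + 2 * sqrt (real q) ^ (n - 1) * (real (card A))\<^sup>2"
proof -
  have finA: "finite A" using A finite_subset finite_vec by blast
  have "of_real (\<Sum>m\<in>sphere n t. (cmod (\<Sum>a\<in>A. \<chi> (dot n m a)))\<^sup>2)
     = (\<Sum>m\<in>sphere n t. \<Sum>a\<in>A. \<Sum>b\<in>A. \<chi> (dot n m (vsub n a b)))"
    unfolding of_real_sum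
  proof (rule sum.cong[OF refl])
    fix m assume "m \<in> sphere n t"
    then have "m \<in> vec n" unfolding sphere_def by simp
    from norm_square_expand[OF A finA this, of "\<lambda>_. 1"]
    show "of_real ((cmod (\<Sum>a\<in>A. \<chi> (dot n m a)))\<^sup>2) = (\<Sum>a\<in>A. \<Sum>b\<in>A. \<chi> (dot n m (vsub n a b)))" by simp
  qed
  also have "\<dots> = (\<Sum>a\<in>A. \<Sum>b\<in>A. \<Sum>m\<in>sphere n t. \<chi> (dot n m (vsub n a b)))"
    by (subst sum.swap, rule sum.cong[OF refl], rule sum.swap)
  finally have "(\<Sum>m\<in>sphere n t. (cmod (\<Sum>a\<in>A. \<chi> (dot n m a)))\<^sup>2)
     = (\<Sum>a\<in>A. \<Sum>b\<in>A. Re (\<Sum>m\<in>sphere n t. \<chi> (dot n m (vsub n a b))))"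
    by (metis (no_types, lifting) Re_complex_of_real Re_sum sum.cong)
  also have "\<dots> \<le> (\<Sum>a\<in>A. \<Sum>b\<in>A. (if a = b then real q ^ (n - 1) else 0) + 2 * sqrt (real q) ^ (n - 1))"
  proof (intro sum_mono)
    fix a b assume "a \<in> A" "b \<in> A"
    then have ab: "a \<in> vec n" "b \<in> vec n" using A by auto
    from sphere_decay[OF n t vsub_mem[OF ab] cases weil]
    show "Re (\<Sum>m\<in>sphere n t. \<chi> (dot n m (vsub n a b))) \<le> (if a = b then real q ^ (n - 1) else 0) + 2 * sqrt (real q) ^ (n - 1)"
      unfolding vsub_eq_0[OF ab] by simp
  qed
  also have "\<dots> = real q ^ (n - 1) * real (card A) + 2 * sqrt (real q) ^ (n - 1) * (real (card A))\<^sup>2"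
    using finA by (simp add: sum.distrib power2_eq_square algebra_simps)
  finally show ?thesis .
qed

end

section \<open>The orthogonal group\<close>

context finite_fld
begin

definition orth :: "nat \<Rightarrow> (nat \<Rightarrow> nat \<Rightarrow> 'r) set" where
  "orth n = {g \<in> {..<n} \<rightarrow>\<^sub>E ({..<n} \<rightarrow>\<^sub>E K). \<forall>j<n. \<forall>k<n. (\<Sum>i<n. g i j * g i k) = (if j = k then e else 0)}"

definition act :: "nat \<Rightarrow> (nat \<Rightarrow> nat \<Rightarrow> 'r) \<Rightarrow> (nat \<Rightarrow> 'r) \<Rightarrow> nat \<Rightarrow> 'r" where
  "act n g x = (\<lambda>i\<in>{..<n}. \<Sum>j<n. g i j * x j)"

definition unit_vec :: "nat \<Rightarrow> nat \<Rightarrow> nat \<Rightarrow> 'r" where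
  "unit_vec n k = (\<lambda>i\<in>{..<n}. if i = k then e else 0)"

definition transporter :: "nat \<Rightarrow> (nat \<Rightarrow> 'r) \<Rightarrow> (nat \<Rightarrow> 'r) \<Rightarrow> (nat \<Rightarrow> nat \<Rightarrow> 'r) set" where
  "transporter n x y = {g \<in> orth n. act n g x = y}"

lemma orth_nth [simp]: "g \<in> orth n \<Longrightarrow> i < n \<Longrightarrow> j < n \<Longrightarrow> g i j \<in> K"
  unfolding orth_def by (auto simp: PiE_def Pi_def)

lemma orth_columns: "g \<in> orth n \<Longrightarrow> j < n \<Longrightarrow> k < n \<Longrightarrow> (\<Sum>i<n. g i j * g i k) = (if j = k then e else 0)"
  unfolding orth_def by blast

lemma orth_I:
  assumes "\<And>i j. i < n \<Longrightarrow> j < n \<Longrightarrow> f i j \<in> K"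
    and "\<And>j k. j < n \<Longrightarrow> k < n \<Longrightarrow> (\<Sum>i<n. f i j * f i k) = (if j = k then e else 0)"
  shows "(\<lambda>i\<in>{..<n}. \<lambda>j\<in>{..<n}. f i j) \<in> orth n"
  unfolding orth_def using assms by auto

lemma orth_eqI: assumes "g \<in> orth n" "h \<in> orth n" "\<And>i j. i < n \<Longrightarrow> j < n \<Longrightarrow> g i j = h i j" shows "g = h"
proof (rule PiE_ext)
  show "g \<in> {..<n} \<rightarrow>\<^sub>E ({..<n} \<rightarrow>\<^sub>E K)" "h \<in> {..<n} \<rightarrow>\<^sub>E ({..<n} \<rightarrow>\<^sub>E K)"
    using assms by (auto simp: orth_def)
  fix i assume i: "i \<in> {..<n}"
  have "g i \<in> {..<n} \<rightarrow>\<^sub>E K" "h i \<in> {..<n} \<rightarrow>\<^sub>E K" using assms i unfolding orth_def by auto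
  then show "g i = h i" by (rule PiE_ext) (use assms i in auto)
qed

lemma finite_orth [simp]: "finite (orth n)"
  by (rule finite_subset[of _ "{..<n} \<rightarrow>\<^sub>E ({..<n} \<rightarrow>\<^sub>E K)"]) (auto simp: orth_def intro!: finite_PiE)

lemma finite_transporter [simp]: "finite (transporter n x y)" unfolding transporter_def by simp

lemma act_mem [simp]: "g \<in> orth n \<Longrightarrow> x \<in> vec n \<Longrightarrow> act n g x \<in> vec n"
  by (subst vec_def) (auto simp: act_def intro!: sum_mem mult_mem)

lemma unit_vec_mem [simp]: "unit_vec n k \<in> vec n" by (subst vec_def) (simp add: unit_vec_def)

lemma dot_unit_vec: assumes "x \<in> vec n" "k < n" shows "dot n x (unit_vec n k) = x k"
proof -
  have "dot n x (unit_vec n k) = (\<Sum>i<n. if i = k then x i else 0)"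
    unfolding dot_def unit_vec_def using assms by (intro sum.cong refl) auto
  then show ?thesis using assms by simp
qed

lemma dot_eqI: assumes "x \<in> vec n" "y \<in> vec n" "\<And>z. z \<in> vec n \<Longrightarrow> dot n x z = dot n y z" shows "x = y"
proof (rule vec_eqI[OF assms(1,2)])
  fix i assume "i < n"
  then show "x i = y i" using assms dot_unit_vec[of x n i] dot_unit_vec[of y n i] by simp
qed

lemma dot_act: assumes g: "g \<in> orth n" and x: "x \<in> vec n" "y \<in> vec n"
  shows "dot n (act n g x) (act n g y) = dot n x y"
proof -
  have "dot n (act n g x) (act n g y) = (\<Sum>i<n. \<Sum>j<n. \<Sum>k<n. (x j * y k) * (g i j * g i k))"
    unfolding dot_def act_def by (simp add: sum_product mult_ac)
  also have "\<dots> = (\<Sum>j<n. \<Sum>k<n. \<Sum>i<n. (x j * y k) * (g i j * g i k))"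
    by (subst sum.swap, rule sum.cong[OF refl], rule sum.swap)
  also have "\<dots> = (\<Sum>j<n. \<Sum>k<n. if j = k then x j * y k else 0)"
  proof (intro sum.cong refl)
    fix j k assume jk: "j \<in> {..<n}" "k \<in> {..<n}"
    have "(\<Sum>i<n. (x j * y k) * (g i j * g i k)) = (x j * y k) * (\<Sum>i<n. g i j * g i k)"
      by (rule sum_distrib_left[symmetric])
    also have "\<dots> = (if j = k then x j * y k else 0)"
      using orth_columns[OF g, of j k] jk x by auto
    finally show "(\<Sum>i<n. (x j * y k) * (g i j * g i k)) = (if j = k then x j * y k else 0)" .
  qed
  also have "\<dots> = dot n x y" unfolding dot_def by simp
  finally show ?thesis .
qed

lemma act_inj: assumes g: "g \<in> orth n" and x: "x \<in> vec n" "y \<in> vec n" and eq: "act n g x = act n g y"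
  shows "x = y"
proof (rule dot_eqI[OF x])
  fix z assume z: "z \<in> vec n"
  have "dot n x z = dot n (act n g x) (act n g z)" using dot_act[OF g x(1) z] ..
  also have "\<dots> = dot n y z" unfolding eq using dot_act[OF g x(2) z] .
  finally show "dot n x z = dot n y z" .
qed

lemma bij_act: assumes "g \<in> orth n" shows "bij_betw (act n g) (vec n) (vec n)"
proof -
  have inj: "inj_on (act n g) (vec n)" using act_inj[OF assms] by (auto intro: inj_onI)
  moreover have "act n g ` vec n \<subseteq> vec n" using assms by auto
  ultimately show ?thesis by (simp add: bij_betw_def endo_inj_surj)
qed

lemma act_zero: "g \<in> orth n \<Longrightarrow> act n g (vzero n) = vzero n"
  unfolding act_def vzero_def by auto

lemma bij_act_nz: assumes "g \<in> orth n" shows "bij_betw (act n g) (vec n - {vzero n}) (vec n - {vzero n})"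
proof -
  have "bij_betw (act n g) (vec n - {vzero n}) (vec n - {act n g (vzero n)})"
    using bij_act[OF assms] assms by (intro bij_betw_DiffI bij_betw_singletonI) auto
  then show ?thesis using act_zero[OF assms] by simp
qed

definition mmul :: "nat \<Rightarrow> (nat \<Rightarrow> nat \<Rightarrow> 'r) \<Rightarrow> (nat \<Rightarrow> nat \<Rightarrow> 'r) \<Rightarrow> nat \<Rightarrow> nat \<Rightarrow> 'r" where
  "mmul n h g = (\<lambda>i\<in>{..<n}. \<lambda>j\<in>{..<n}. \<Sum>k<n. h i k * g k j)"

definition col :: "nat \<Rightarrow> (nat \<Rightarrow> nat \<Rightarrow> 'r) \<Rightarrow> nat \<Rightarrow> nat \<Rightarrow> 'r" where
  "col n g j = (\<lambda>i\<in>{..<n}. g i j)"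

lemma col_mem [simp]: "g \<in> orth n \<Longrightarrow> j < n \<Longrightarrow> col n g j \<in> vec n"
  by (subst vec_def) (simp add: col_def)

lemma mmul_col: "i < n \<Longrightarrow> j < n \<Longrightarrow> mmul n h g i j = act n h (col n g j) i"
  unfolding mmul_def act_def col_def by (auto intro!: sum.cong)

lemma mmul_orth: assumes "h \<in> orth n" "g \<in> orth n" shows "mmul n h g \<in> orth n"
  unfolding mmul_def
proof (rule orth_I)
  show "(\<Sum>k<n. h i k * g k j) \<in> K" if "i < n" "j < n" for i j using assms that by (intro sum_mem mult_mem) auto
  fix j k assume jk: "j < n" "k < n"
  have "(\<Sum>i<n. (\<Sum>l<n. h i l * g l j) * (\<Sum>l<n. h i l * g l k)) = dot n (act n h (col n g j)) (act n h (col n g k))"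
    unfolding dot_def using mmul_col[of _ n] jk by (auto simp: act_def col_def intro!: sum.cong arg_cong2[where f = "(*)"])
  also have "\<dots> = dot n (col n g j) (col n g k)" using assms jk by (intro dot_act) auto
  also have "\<dots> = (\<Sum>i<n. g i j * g i k)" unfolding dot_def col_def by (intro sum.cong) auto
  finally show "(\<Sum>i<n. (\<Sum>l<n. h i l * g l j) * (\<Sum>l<n. h i l * g l k)) = (if j = k then e else 0)"
    using orth_columns[OF assms(2) jk] by simp
qed

lemma act_mmul: "act n (mmul n h g) x = act n h (act n g x)"
proof -
  have "(\<Sum>j<n. (\<Sum>k<n. h i k * g k j) * x j) = (\<Sum>k<n. h i k * (\<Sum>j<n. g k j * x j))" for i
  proof -
    have "(\<Sum>j<n. (\<Sum>k<n. h i k * g k j) * x j) = (\<Sum>j<n. \<Sum>k<n. h i k * (g k j * x j))"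
      by (simp add: sum_distrib_right mult.assoc)
    also have "\<dots> = (\<Sum>k<n. \<Sum>j<n. h i k * (g k j * x j))" by (rule sum.swap)
    finally show ?thesis by (simp add: sum_distrib_left)
  qed
  then show ?thesis unfolding act_def mmul_def by (auto intro!: restrict_ext)
qed

lemma mmul_inj: assumes "h \<in> orth n" shows "inj_on (mmul n h) (orth n)"
proof (rule inj_onI)
  fix g g' assume g: "g \<in> orth n" "g' \<in> orth n" "mmul n h g = mmul n h g'"
  show "g = g'"
  proof (rule orth_eqI[OF g(1,2)])
    fix i j assume ij: "i < n" "j < n"
    have "act n h (col n g j) = act n h (col n g' j)"
    proof (rule vec_eqI)
      show "act n h (col n g j) \<in> vec n" "act n h (col n g' j) \<in> vec n" using assms g ij by auto
      show "act n h (col n g j) l = act n h (col n g' j) l" if "l < n" for l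
        using mmul_col[OF that ij(2)] g(3) by metis
    qed
    then have "col n g j = col n g' j" using act_inj[OF assms] g ij by auto
    then show "g i j = g' i j" using ij unfolding col_def by (metis lessThan_iff restrict_apply')
  qed
qed

lemma card_transporter_act: assumes "h \<in> orth n" shows "card (transporter n x y) \<le> card (transporter n x (act n h y))"
proof (rule card_inj_on_le)
  show "inj_on (mmul n h) (transporter n x y)" using mmul_inj[OF assms] by (rule inj_on_subset) (auto simp: transporter_def)
  show "mmul n h ` transporter n x y \<subseteq> transporter n x (act n h y)" unfolding transporter_def using mmul_orth[OF assms] act_mmul by auto
qed simp

definition refl :: "nat \<Rightarrow> (nat \<Rightarrow> 'r) \<Rightarrow> nat \<Rightarrow> nat \<Rightarrow> 'r" where
  "refl n u = (\<lambda>i\<in>{..<n}. \<lambda>j\<in>{..<n}. (if i = j then e else 0) - 2 * iv (dot n u u) * (u i * u j))"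

lemma refl_orth: assumes u: "u \<in> vec n" "dot n u u \<noteq> 0" shows "refl n u \<in> orth n"
  unfolding refl_def
proof (rule orth_I)
  define c where "c = 2 * iv (dot n u u)"
  have ivu: "iv (dot n u u) \<in> K" "dot n u u * iv (dot n u u) = e" using u iv by auto
  have c: "c \<in> K" "c * dot n u u = 2 * e" unfolding c_def using ivu by (auto simp: mult_ac)
  show "(if i = j then e else 0) - 2 * iv (dot n u u) * (u i * u j) \<in> K" if "i < n" "j < n" for i j
    using u c that unfolding c_def[symmetric] by auto
  fix j k assume jk: "j < n" "k < n"
  have uK: "u j \<in> K" "u k \<in> K" using u jk by auto
  have "(\<Sum>i<n. ((if i = j then e else 0) - c * (u i * u j)) * ((if i = k then e else 0) - c * (u i * u k)))
      = (\<Sum>i<n. (if i = j then (if i = k then e else 0) else 0) - (if i = j then c * (u i * u k) else 0)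
          - (if i = k then c * (u i * u j) else 0) + (c * c * u j * u k) * (u i * u i))"
  proof (rule sum.cong[OF refl])
    fix i assume "i \<in> {..<n}"
    then have "u i \<in> K" using u by auto
    then have "c * (u i * u j) \<in> K" "c * (u i * u k) \<in> K" using c uK by auto
    moreover have "((if i = j then e else 0) - c1) * ((if i = k then e else 0) - c2)
      = (if i = j then (if i = k then e else 0) else 0) - (if i = j then c2 else 0)
          - (if i = k then c1 else 0) + c1 * c2" if "c1 \<in> K" "c2 \<in> K" for c1 c2
      using that by (simp add: left_diff_distrib right_diff_distrib)
    moreover have "(c * (u i * u j)) * (c * (u i * u k)) = (c * c * u j * u k) * (u i * u i)" by (simp only: mult_ac)
    ultimately show "((if i = j then e else 0) - c * (u i * u j)) * ((if i = k then e else 0) - c * (u i * u k))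
      = (if i = j then (if i = k then e else 0) else 0) - (if i = j then c * (u i * u k) else 0)
          - (if i = k then c * (u i * u j) else 0) + (c * c * u j * u k) * (u i * u i)"
      by metis
  qed
  also have "\<dots> = (if j = k then e else 0) - c * (u j * u k) - c * (u k * u j) + (c * c * u j * u k) * dot n u u"
    unfolding dot_def sum.distrib sum_subtractf sum_distrib_left[symmetric] using jk by simp
  also have "(c * c * u j * u k) * dot n u u = c * (u j * u k) * (c * dot n u u)" by (simp only: mult_ac)
  also have "\<dots> = 2 * (c * (u j * u k))" unfolding c(2) using c uK by (simp add: mult.assoc[symmetric] mult.commute[of _ 2] mult.left_commute[of _ 2])
  finally show "(\<Sum>i<n. ((if i = j then e else 0) - 2 * iv (dot n u u) * (u i * u j)) * ((if i = k then e else 0) - 2 * iv (dot n u u) * (u i * u k)))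
      = (if j = k then e else 0)" unfolding c_def[symmetric] by (simp add: mult.commute[of "u k"])
qed

lemma act_refl: assumes u: "u \<in> vec n" "dot n u u \<noteq> 0" and x: "x \<in> vec n" and i: "i < n"
  shows "act n (refl n u) x i = x i - 2 * iv (dot n u u) * dot n u x * u i"
proof -
  define c where "c = 2 * iv (dot n u u)"
  have "act n (refl n u) x i = (\<Sum>j<n. ((if i = j then e else 0) - c * (u i * u j)) * x j)"
    unfolding act_def refl_def c_def using i by simp
  also have "\<dots> = (\<Sum>j<n. (if j = i then x j else 0) - c * u i * (u j * x j))"
  proof (rule sum.cong[OF refl])
    fix j assume "j \<in> {..<n}"
    then show "((if i = j then e else 0) - c * (u i * u j)) * x j = (if j = i then x j else 0) - c * u i * (u j * x j)"
      using x by (simp add: left_diff_distrib right_diff_distrib mult_ac)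
  qed
  also have "\<dots> = x i - c * u i * dot n u x"
    unfolding dot_def sum_subtractf sum_distrib_left[symmetric] using i by simp
  finally show ?thesis unfolding c_def by (simp add: mult_ac)
qed

text \<open>
  A point of \<open>S\<close> is determined by its projection to the coordinate hyperplane and one of at most \<open>k\<close>
  choices on the line above. This serves for quadrics and for hyperplanes alike.
\<close>

lemma card_line_bound:
  assumes S: "S \<subseteq> vec n" and i: "i < n" and line: "\<And>x. x \<in> vec n \<Longrightarrow> card {s\<in>K. x(i := s) \<in> S} \<le> k"
  shows "card S \<le> k * q ^ (n - 1)"
proof -
  have "card (PiE {..<n} (\<lambda>j. if j = i then {0} else K)) = (\<Prod>j<n. if j = i then 1 else q)"
    by (subst card_PiE) (auto intro!: prod.cong)
  also have "\<dots> = (\<Prod>j\<in>{..<n} - {i}. q)"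
    using i by (subst prod.remove[of _ i]) auto
  also have "\<dots> = q ^ (n - 1)" using i by simp
  finally have cT: "card (PiE {..<n} (\<lambda>j. if j = i then {0} else K)) = q ^ (n - 1)" .
  let ?T = "PiE {..<n} (\<lambda>j. if j = i then {0} else K)"
  have finT: "finite ?T" by (intro finite_PiE) auto
  have finS: "finite S" using S finite_subset finite_vec by blast
  have "card S = (\<Sum>x\<in>S. 1)" by simp
  also have "\<dots> = (\<Sum>t\<in>?T. \<Sum>x\<in>{x\<in>S. x(i := 0) = t}. 1)"
  proof (rule sum.group[symmetric, OF finS finT])
    show "(\<lambda>x. x(i := 0)) ` S \<subseteq> ?T"
    proof (rule image_subsetI, rule PiE_I)
      fix x j assume x: "x \<in> S"
      then have xv: "x \<in> vec n" using S by blast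
      show "(x(i := 0)) j \<in> (if j = i then {0} else K)" if "j \<in> {..<n}" using vec_nth[OF xv] that by simp
      show "(x(i := 0)) j = undefined" if "j \<notin> {..<n}" using xv that i unfolding vec_def by (auto dest: PiE_arb)
    qed
  qed
  also have "\<dots> \<le> (\<Sum>t\<in>?T. k)"
  proof (rule sum_mono)
    fix t assume t: "t \<in> ?T"
    have "?T \<subseteq> {..<n} \<rightarrow>\<^sub>E K" by (rule PiE_mono) simp
    then have tv: "t \<in> vec n" using t unfolding vec_def by blast
    have "{x\<in>S. x(i := 0) = t} \<subseteq> (\<lambda>s. t(i := s)) ` {s\<in>K. t(i := s) \<in> S}"
    proof
      fix x assume x: "x \<in> {x\<in>S. x(i := 0) = t}"
      then have "x = t(i := x i)" by auto
      moreover have "x i \<in> K" using x S i by auto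
      ultimately show "x \<in> (\<lambda>s. t(i := s)) ` {s\<in>K. t(i := s) \<in> S}" using x by (metis (mono_tags, lifting) image_eqI mem_Collect_eq)
    qed
    then have "card {x\<in>S. x(i := 0) = t} \<le> card {s\<in>K. t(i := s) \<in> S}"
      by (intro surj_card_le[of "{s\<in>K. t(i := s) \<in> S}"]) simp
    also have "\<dots> \<le> k" by (rule line[OF tv])
    finally show "(\<Sum>x\<in>{x\<in>S. x(i := 0) = t}. 1) \<le> k" by simp
  qed
  also have "\<dots> = k * q ^ (n - 1)" by (simp add: cT)
  finally show ?thesis .
qed

lemma card_sqrt_le: assumes "v \<in> K" shows "card {x\<in>K. x * x = v} \<le> 2"
proof -
  have "cmod (of_nat (card {x\<in>K. x * x = v})) \<le> 2" unfolding card_sqrt[OF assms] by (auto simp: eta_def)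
  then show ?thesis by simp
qed

lemma card_sphere_le: assumes n: "n \<ge> 1" and t: "t \<in> K" shows "card (sphere n t) \<le> 2 * q ^ (n - 1)"
proof (rule card_line_bound[where i = 0])
  show "sphere n t \<subseteq> vec n" unfolding sphere_def by auto
  show "0 < n" using n by simp
  fix x assume x: "x \<in> vec n"
  define r where "r = (\<Sum>j\<in>{..<n} - {0}. x j * x j)"
  have r: "r \<in> K" unfolding r_def by (intro sum_mem mult_mem vec_nth[OF x]) auto
  have "dot n (x(0 := s)) (x(0 := s)) = s * s + r" for s
    unfolding dot_def r_def using n by (subst sum.remove[of _ 0]) (auto intro!: sum.cong)
  then have "{s\<in>K. x(0 := s) \<in> sphere n t} \<subseteq> {s\<in>K. s * s = t - r}" unfolding sphere_def by (auto simp: eq_diff_eq)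
  then have "card {s\<in>K. x(0 := s) \<in> sphere n t} \<le> card {s\<in>K. s * s = t - r}" by (intro card_mono) auto
  also have "\<dots> \<le> 2" using r t by (intro card_sqrt_le) auto
  finally show "card {s\<in>K. x(0 := s) \<in> sphere n t} \<le> 2" .
qed

lemma card_hyperplane_le: assumes y: "y \<in> vec n" "y \<noteq> vzero n"
  shows "card {u\<in>vec n. dot n u y = 0} \<le> 1 * q ^ (n - 1)"
proof -
  obtain i where i: "i < n" "y i \<noteq> 0" using y vec_eq_zero_iff by blast
  show ?thesis
  proof (rule card_line_bound[OF _ i(1)])
    fix x assume x: "x \<in> vec n"
    define r where "r = (\<Sum>j\<in>{..<n} - {i}. x j * y j)"
    have d: "dot n (x(i := s)) y = s * y i + r" for s
      unfolding dot_def r_def using i by (subst sum.remove[of _ i]) (auto intro!: sum.cong)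
    have uniq: "s = s'" if "s \<in> K" "s' \<in> K" "s * y i + r = 0" "s' * y i + r = 0" for s s'
    proof -
      have "(s - s') * y i = 0" using that by (simp add: left_diff_distrib add_eq_0_iff2)
      then show ?thesis using i y that no_zero_divisors[of "s - s'" "y i"] by auto
    qed
    have zero: "s \<in> K \<and> s * y i + r = 0" if "s \<in> {s\<in>K. x(i := s) \<in> {u\<in>vec n. dot n u y = 0}}" for s
      using that d[of s] by simp
    have "\<forall>s\<in>{s\<in>K. x(i := s) \<in> {u\<in>vec n. dot n u y = 0}}.
        \<forall>s'\<in>{s\<in>K. x(i := s) \<in> {u\<in>vec n. dot n u y = 0}}. s = s'"
    proof (intro ballI)
      fix s s' assume "s \<in> {s\<in>K. x(i := s) \<in> {u\<in>vec n. dot n u y = 0}}" "s' \<in> {s\<in>K. x(i := s) \<in> {u\<in>vec n. dot n u y = 0}}"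
      from zero[OF this(1)] zero[OF this(2)] show "s = s'" using uniq[of s s'] by simp
    qed
    moreover have "finite {s\<in>K. x(i := s) \<in> {u\<in>vec n. dot n u y = 0}}" by simp
    ultimately show "card {s\<in>K. x(i := s) \<in> {u\<in>vec n. dot n u y = 0}} \<le> 1"
      unfolding One_nat_def using card_le_Suc0_iff_eq by blast
  qed auto
qed

text \<open>
  For large \<open>q\<close> the orbit of a nonzero vector is almost as large as a sphere. The reflection in \<open>u\<close> moves \<open>y\<close> by a nonzero
  multiple of \<open>u\<close> unless \<open>u \<bullet> y = 0\<close>, so each image of \<open>y\<close> comes from at most \<open>q\<close> vectors \<open>u\<close>; and all but
  \<open>3 q ^ (n - 1)\<close> vectors satisfy \<open>u \<bullet> u \<noteq> 0\<close> and \<open>u \<bullet> y \<noteq> 0\<close>. Isotropic and other vectors \<open>y\<close>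
  are treated alike.
\<close>

lemma card_reflections:
  assumes y: "y \<in> vec n" "y \<noteq> vzero n"
  shows "q ^ n \<le> q * card ((\<lambda>h. act n h y) ` orth n) + 3 * q ^ (n - 1)"
proof -
  have n: "n \<ge> 1"
  proof (rule ccontr)
    assume "\<not> n \<ge> 1"
    then show False using y vec_eq_zero_iff[of y n] by auto
  qed
  define U where "U = {u\<in>vec n. dot n u u \<noteq> 0 \<and> dot n u y \<noteq> 0}"
  define Y where "Y = (\<lambda>u. act n (refl n u) y) ` U"
  have "vec n \<subseteq> U \<union> (sphere n 0 \<union> {u\<in>vec n. dot n u y = 0})" unfolding U_def sphere_def by auto
  then have "card (vec n) \<le> card (U \<union> (sphere n 0 \<union> {u\<in>vec n. dot n u y = 0}))"
    by (intro card_mono) (auto simp: U_def sphere_def)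
  also have "\<dots> \<le> card U + card (sphere n 0 \<union> {u\<in>vec n. dot n u y = 0})" by (rule card_Un_le)
  also have "\<dots> \<le> card U + (card (sphere n 0) + card {u\<in>vec n. dot n u y = 0})"
    by (rule add_left_mono) (rule card_Un_le)
  also have "\<dots> \<le> card U + (2 * q ^ (n - 1) + 1 * q ^ (n - 1))"
    using card_sphere_le[OF n zero_mem] card_hyperplane_le[OF y] by linarith
  finally have 1: "q ^ n \<le> card U + 3 * q ^ (n - 1)" by (simp add: card_vec)
  have finU: "finite U" unfolding U_def by simp
  have "card U = (\<Sum>z\<in>Y. card {u\<in>U. act n (refl n u) y = z})"
    using sum.group[of U Y "\<lambda>u. act n (refl n u) y" "\<lambda>_. 1::nat"] finU unfolding Y_def by simp
  also have "\<dots> \<le> (\<Sum>z\<in>Y. q)"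
  proof (rule sum_mono)
    fix z assume "z \<in> Y"
    have "{u\<in>U. act n (refl n u) y = z} \<subseteq> (\<lambda>s. \<lambda>i\<in>{..<n}. s * (y i - z i)) ` K"
    proof
      fix u assume "u \<in> {u\<in>U. act n (refl n u) y = z}"
      then have u: "u \<in> vec n" "dot n u u \<noteq> 0" "dot n u y \<noteq> 0" "act n (refl n u) y = z" unfolding U_def by auto
      define c where "c = 2 * iv (dot n u u) * dot n u y"
      have ivu: "iv (dot n u u) \<in> K" "iv (dot n u u) \<noteq> 0" using u iv iv_nz by auto
      have c: "c \<in> K" "c \<noteq> 0" unfolding c_def mult.assoc using ivu u y by auto
      have "u = (\<lambda>i\<in>{..<n}. iv c * (y i - z i))"
      proof
        fix i
        show "u i = (\<lambda>i\<in>{..<n}. iv c * (y i - z i)) i"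
        proof (cases "i < n")
          case True
          have "y i - z i = c * u i" using act_refl[OF u(1,2) y(1) True] unfolding u(4) c_def by simp
          then show ?thesis using True cancel_iv'[OF c, of "u i"] u by simp
        next
          case False then show ?thesis using u(1) PiE_arb[of u "{..<n}" "\<lambda>_. K" i] unfolding vec_def by simp
        qed
      qed
      then show "u \<in> (\<lambda>s. \<lambda>i\<in>{..<n}. s * (y i - z i)) ` K" using iv(1)[OF c] by blast
    qed
    then show "card {u\<in>U. act n (refl n u) y = z} \<le> q"
      by (rule surj_card_le[OF fin])
  qed
  also have "\<dots> = q * card Y" by simp
  also have "card Y \<le> card ((\<lambda>h. act n h y) ` orth n)"
    by (rule card_mono) (auto simp: Y_def U_def intro!: imageI refl_orth)
  finally show ?thesis using 1 by simp
qed

text \<open>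
  The sets of matrices moving \<open>x\<close> to the points of the orbit of \<open>y\<close> are disjoint and at least as large as
  the one for \<open>y\<close>. For \<open>q = 3\<close> the orbit bound is void, but then \<open>q ^ (n - 1) \<le> 3 ^ n\<close> makes the claim trivial.
\<close>

lemma card_transporter_le:
  assumes y: "y \<in> vec n" "y \<noteq> vzero n"
  shows "card (transporter n x y) * q ^ (n - 1) \<le> 3 ^ n * card (orth n)"
proof -
  define Y where "Y = (\<lambda>h. act n h y) ` orth n"
  have finY: "finite Y" unfolding Y_def by simp
  have n: "n \<ge> 1"
  proof (rule ccontr)
    assume "\<not> n \<ge> 1"
    then show False using y vec_eq_zero_iff[of y n] by auto
  qed
  have qn: "q ^ n = q * q ^ (n - 1)" using n by (metis Suc_diff_1 Suc_le_eq One_nat_def power_Suc)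
  have "card Y * card (transporter n x y) = (\<Sum>z\<in>Y. card (transporter n x y))" by simp
  also have "\<dots> \<le> (\<Sum>z\<in>Y. card (transporter n x z))"
    by (rule sum_mono) (auto simp: Y_def card_transporter_act)
  also have "\<dots> = card (\<Union>z\<in>Y. transporter n x z)"
    by (rule card_UN_disjoint[symmetric]) (auto simp: finY transporter_def)
  also have "\<dots> \<le> card (orth n)" by (rule card_mono) (auto simp: transporter_def)
  finally have YF: "card Y * card (transporter n x y) \<le> card (orth n)" .
  have "q = 3 \<or> q \<ge> 5"
  proof -
    have "q \<noteq> 4" using odd_card by auto
    then show ?thesis using q_ge by linarith
  qed
  then show ?thesis
  proof
    assume "q = 3"
    have "card (transporter n x y) \<le> card (orth n)" by (rule card_mono) (auto simp: transporter_def)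
    moreover have "q ^ (n - 1) \<le> 3 ^ n" unfolding \<open>q = 3\<close> by (intro power_increasing) auto
    ultimately show ?thesis by (metis mult.commute mult_le_mono)
  next
    assume q5: "q \<ge> 5"
    have "q * q ^ (n - 1) \<le> q * card Y + 3 * q ^ (n - 1)" using card_reflections[OF y] unfolding Y_def[symmetric] qn .
    then have "(q - 3) * q ^ (n - 1) \<le> q * card Y" by (simp add: diff_mult_distrib)
    moreover have "q * q ^ (n - 1) \<le> 3 * ((q - 3) * q ^ (n - 1))" using q5 by (simp add: mult.assoc[symmetric])
    ultimately have "q * q ^ (n - 1) \<le> q * (3 * card Y)" by linarith
    then have "q ^ (n - 1) \<le> 3 * card Y" using q_pos by simp
    then have "card (transporter n x y) * q ^ (n - 1) \<le> card (transporter n x y) * (3 * card Y)" by (rule mult_left_mono) simp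
    also have "\<dots> \<le> 3 * card (orth n)" using YF by (simp add: mult_ac)
    also have "\<dots> \<le> 3 ^ n * card (orth n)" using n by (intro mult_right_mono) (auto intro: order_trans[OF _ power_increasing[of 1 n 3]])
    finally show ?thesis .
  qed
qed

lemma identity_orth: "(\<lambda>i\<in>{..<n}. \<lambda>j\<in>{..<n}. if i = j then e else 0) \<in> orth n"
proof (rule orth_I)
  fix j k assume jk: "j < n" "k < n"
  have "(\<Sum>i<n. (if i = j then e else 0) * (if i = k then e else 0)) = (\<Sum>i<n. if i = j then (if i = k then e else 0) else 0)"
    by (intro sum.cong refl) auto
  then show "(\<Sum>i<n. (if i = j then e else 0) * (if i = k then e else 0)) = (if j = k then e else 0)" using jk by simp
qed auto

lemma act_identity: assumes "x \<in> vec n" shows "act n (\<lambda>i\<in>{..<n}. \<lambda>j\<in>{..<n}. if i = j then e else 0) x = x"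
proof (rule vec_eqI)
  fix i assume i: "i < n"
  have "(\<Sum>j<n. (if i = j then e else 0) * x j) = (\<Sum>j<n. if j = i then x j else 0)"
    using assms by (intro sum.cong refl) auto
  then show "act n (\<lambda>i\<in>{..<n}. \<lambda>j\<in>{..<n}. if i = j then e else 0) x i = x i" unfolding act_def using i by simp
qed (use assms identity_orth in auto)

lemma act_unit_vec: "g \<in> orth n \<Longrightarrow> k < n \<Longrightarrow> act n g (unit_vec n k) = col n g k"
proof (rule vec_eqI)
  fix i assume a: "g \<in> orth n" "k < n" "i < n"
  have "(\<Sum>j<n. g i j * unit_vec n k j) = (\<Sum>j<n. if j = k then g i j else 0)"
    unfolding unit_vec_def using a by (intro sum.cong refl) auto
  then show "act n g (unit_vec n k) i = col n g k i" unfolding act_def col_def using a by simp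
qed auto

text \<open>
  A matrix that fixes the last unit vector has this vector as its last column, and orthogonality of
  the columns makes it the last row too. What is left is an orthogonal matrix of smaller size.
\<close>

lemma card_stabiliser: "card (transporter (Suc n) (unit_vec (Suc n) n) (unit_vec (Suc n) n)) \<le> card (orth n)"
proof (rule card_inj_on_le)
  let ?F = "transporter (Suc n) (unit_vec (Suc n) n) (unit_vec (Suc n) n)"
  let ?r = "\<lambda>g. \<lambda>i\<in>{..<n}. \<lambda>j\<in>{..<n}. g i j"
  have g_col: "g i n = (if i = n then e else 0)" if "g \<in> ?F" "i \<le> n" for g i
  proof -
    have "g \<in> orth (Suc n)" "col (Suc n) g n = unit_vec (Suc n) n" using that act_unit_vec[of g "Suc n" n] by (auto simp: transporter_def)
    then have "col (Suc n) g n i = unit_vec (Suc n) n i" by simp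
    then show ?thesis using that unfolding col_def unit_vec_def by simp
  qed
  have g_row: "g n j = 0" if "g \<in> ?F" "j < n" for g j
  proof -
    have g: "g \<in> orth (Suc n)" using that by (auto simp: transporter_def)
    have "0 = (\<Sum>i<Suc n. g i j * g i n)" using orth_columns[OF g, of j n] that by simp
    also have "\<dots> = g n j" using g_col[OF that(1)] g that by simp
    finally show ?thesis by simp
  qed
  show "?r ` ?F \<subseteq> orth n"
  proof (clarify, rule orth_I)
    fix g assume g: "g \<in> ?F"
    then have go: "g \<in> orth (Suc n)" by (auto simp: transporter_def)
    show "g i j \<in> K" if "i < n" "j < n" for i j using go that by simp
    show "(\<Sum>i<n. g i j * g i k) = (if j = k then e else 0)" if "j < n" "k < n" for j k
      using orth_columns[OF go, of j k] that g_row[OF g that(1)] by simp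
  qed
  show "inj_on ?r ?F"
  proof (rule inj_onI)
    fix g h assume gh: "g \<in> ?F" "h \<in> ?F" "?r g = ?r h"
    show "g = h"
    proof (rule orth_eqI)
      show "g \<in> orth (Suc n)" "h \<in> orth (Suc n)" using gh by (auto simp: transporter_def)
      fix i j assume ij: "i < Suc n" "j < Suc n"
      show "g i j = h i j"
      proof (cases "j = n")
        case True then show ?thesis using g_col[OF gh(1), of i] g_col[OF gh(2), of i] ij by simp
      next
        case j: False
        show ?thesis
        proof (cases "i = n")
          case True then show ?thesis using g_row[OF gh(1), of j] g_row[OF gh(2), of j] j ij by simp
        next
          case False
          have "?r g i j = ?r h i j" using gh(3) by simp
          moreover have "i < n" "j < n" using False j ij by auto
          ultimately show ?thesis by simp
        qed
      qed
    qed
  qed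
qed simp

text \<open>
  The last unit vector has at most \<open>2 q\<^sup>n\<close> images, since they lie on the unit sphere, and the matrices
  with a given image, if there are any, form a coset of its stabiliser. The inverse of a matrix \<open>g\<close> comes from the fact that
  left multiplication by \<open>g\<close> is an injective map of a finite set to itself.
\<close>

lemma card_orth_Suc: "card (orth (Suc n)) \<le> 2 * q ^ n * card (orth n)"
proof -
  define u where "u = unit_vec (Suc n) n"
  have u: "u \<in> vec (Suc n)" unfolding u_def by simp
  have uu: "dot (Suc n) u u = e" 
  proof -
    have "unit_vec (Suc n) n n = e" by (simp add: unit_vec_def)
    then show ?thesis unfolding u_def by (subst dot_unit_vec) auto
  qed
  have transporter_le: "card (transporter (Suc n) u y) \<le> card (orth n)" for y
  proof (cases "transporter (Suc n) u y = {}")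
    case False
    then obtain g where g: "g \<in> orth (Suc n)" "act (Suc n) g u = y" unfolding transporter_def by blast
    have "mmul (Suc n) g ` orth (Suc n) = orth (Suc n)"
      by (rule endo_inj_surj) (use mmul_inj mmul_orth g in auto)
    then obtain h where h: "h \<in> orth (Suc n)" "mmul (Suc n) g h = (\<lambda>i\<in>{..<Suc n}. \<lambda>j\<in>{..<Suc n}. if i = j then e else 0)"
      using identity_orth[of "Suc n"] by (metis (no_types, lifting) imageE)
    have y: "y \<in> vec (Suc n)" using g u by auto
    have "act (Suc n) g (act (Suc n) h y) = act (Suc n) g u"
      unfolding act_mmul[symmetric] h(2) act_identity[OF y] g(2) ..
    then have "act (Suc n) h y = u" by (rule act_inj[OF g(1) act_mem[OF h(1) y] u])
    then show ?thesis using card_transporter_act[OF h(1), of u y] card_stabiliser[of n] unfolding u_def by simp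
  qed simp
  have "orth (Suc n) = (\<Union>y\<in>sphere (Suc n) e. transporter (Suc n) u y)"
    unfolding transporter_def sphere_def using dot_act[OF _ u u] u uu by auto
  also have "card \<dots> \<le> (\<Sum>y\<in>sphere (Suc n) e. card (transporter (Suc n) u y))"
    by (rule card_UN_le) (simp add: sphere_def)
  also have "\<dots> \<le> (\<Sum>y\<in>sphere (Suc n) e. card (orth n))" by (rule sum_mono, rule transporter_le)
  also have "\<dots> = card (sphere (Suc n) e) * card (orth n)" by simp
  also have "\<dots> \<le> 2 * q ^ n * card (orth n)"
    using card_sphere_le[of "Suc n" e] by (intro mult_right_mono) auto
  finally show ?thesis .
qed

lemma card_transporter_le_orth:
  assumes y: "y \<in> vec (Suc n)" "y \<noteq> vzero (Suc n)"
  shows "card (transporter (Suc n) x y) \<le> 2 * 3 ^ Suc n * card (orth n)"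
proof -
  have "card (transporter (Suc n) x y) * q ^ n \<le> 3 ^ Suc n * card (orth (Suc n))" using card_transporter_le[OF y] by simp
  also have "\<dots> \<le> 3 ^ Suc n * (2 * q ^ n * card (orth n))" using card_orth_Suc by (intro mult_left_mono) auto
  finally have "card (transporter (Suc n) x y) * q ^ n \<le> (2 * 3 ^ Suc n * card (orth n)) * q ^ n" by (simp add: mult_ac)
  then show ?thesis using q_pos by simp
qed

end

section \<open>Incidences between points and rigid motions\<close>

context char_fld
begin

definition fourier :: "nat \<Rightarrow> (nat \<Rightarrow> 'r) set \<Rightarrow> (nat \<Rightarrow> 'r) \<Rightarrow> complex" where
  "fourier n A m = (\<Sum>a\<in>A. \<chi> (dot n m a))"

text \<open>
  The subtracted term is the mean of the first one over all translations \<open>z\<close>.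
\<close>

definition discrepancy ::
    "nat \<Rightarrow> (nat \<Rightarrow> 'r) set \<Rightarrow> (nat \<Rightarrow> 'r) set \<Rightarrow> (nat \<Rightarrow> nat \<Rightarrow> 'r) \<Rightarrow> (nat \<Rightarrow> 'r) \<Rightarrow> real" where
  "discrepancy n A B g z =
     real (card {a\<in>A. vadd n (act n g a) z \<in> B}) - real (card A) * real (card B) / real q ^ n"

lemma discrepancy_transform:
  assumes A: "A \<subseteq> vec n" and B: "B \<subseteq> vec n" and g: "g \<in> orth n" and m: "m \<in> vec n"
  shows "(\<Sum>z\<in>vec n. of_real (discrepancy n A B g z) * \<chi> (dot n m z))
    = (if m = vzero n then 0 else fourier n B m * cnj (\<Sum>a\<in>A. \<chi> (dot n m (act n g a))))"
proof -
  have finA: "finite A" and finB: "finite B" using A B finite_subset finite_vec by blast+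
  have inner: "(\<Sum>z\<in>{z\<in>vec n. vadd n (act n g a) z \<in> B}. \<chi> (dot n m z)) = fourier n B m * cnj (\<chi> (dot n m (act n g a)))"
    if a: "a \<in> A" for a
  proof -
    have av: "act n g a \<in> vec n" using a A g by auto
    have "(\<Sum>z\<in>{z\<in>vec n. vadd n (act n g a) z \<in> B}. \<chi> (dot n m z)) = (\<Sum>b\<in>B. \<chi> (dot n m (vsub n b (act n g a))))"
    proof (rule sum.reindex_bij_witness[where i = "\<lambda>b. vsub n b (act n g a)" and j = "\<lambda>z. vadd n (act n g a) z"])
      fix z assume z: "z \<in> {z\<in>vec n. vadd n (act n g a) z \<in> B}"
      then have zv: "z \<in> vec n" by simp
      show eq: "vsub n (vadd n (act n g a) z) (act n g a) = z"
        by (rule vec_eqI[OF vsub_mem[OF vadd_mem[OF av zv] av] zv]) (simp add: vsub_def vadd_def)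
      show "vadd n (act n g a) z \<in> B" using z by simp
      show "\<chi> (dot n m (vsub n (vadd n (act n g a) z) (act n g a))) = \<chi> (dot n m z)" unfolding eq ..
    next
      fix b assume b: "b \<in> B"
      then have bv: "b \<in> vec n" using B by auto
      show eq: "vadd n (act n g a) (vsub n b (act n g a)) = b"
        by (rule vec_eqI[OF vadd_mem[OF av vsub_mem[OF bv av]] bv]) (simp add: vsub_def vadd_def)
      show "vsub n b (act n g a) \<in> {z\<in>vec n. vadd n (act n g a) z \<in> B}" using eq b bv av by simp
    qed
    also have "\<dots> = (\<Sum>b\<in>B. \<chi> (dot n m b) * cnj (\<chi> (dot n m (act n g a))))"
      using B av m by (intro sum.cong refl chi_dot_vsub) auto
    finally show ?thesis unfolding fourier_def by (simp add: sum_distrib_right)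
  qed
  have "(\<Sum>z\<in>vec n. of_real (real (card {a\<in>A. vadd n (act n g a) z \<in> B})) * \<chi> (dot n m z))
     = (\<Sum>z\<in>vec n. \<Sum>a\<in>A. if vadd n (act n g a) z \<in> B then \<chi> (dot n m z) else 0)"
  proof (rule sum.cong[OF refl])
    fix z
    have "(\<Sum>a\<in>A. if vadd n (act n g a) z \<in> B then \<chi> (dot n m z) else 0)
      = (\<Sum>a\<in>{a\<in>A. vadd n (act n g a) z \<in> B}. \<chi> (dot n m z))"
      using finA by (rule sum.inter_filter[symmetric])
    then show "of_real (real (card {a\<in>A. vadd n (act n g a) z \<in> B})) * \<chi> (dot n m z)
      = (\<Sum>a\<in>A. if vadd n (act n g a) z \<in> B then \<chi> (dot n m z) else 0)" by simp
  qed
  also have "\<dots> = (\<Sum>a\<in>A. \<Sum>z\<in>{z\<in>vec n. vadd n (act n g a) z \<in> B}. \<chi> (dot n m z))"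
    by (subst sum.swap) (simp add: sum.inter_filter)
  also have "\<dots> = (\<Sum>a\<in>A. fourier n B m * cnj (\<chi> (dot n m (act n g a))))"
    by (rule sum.cong[OF refl]) (rule inner)
  also have "\<dots> = fourier n B m * cnj (\<Sum>a\<in>A. \<chi> (dot n m (act n g a)))"
    by (simp add: sum_distrib_left)
  finally have count: "(\<Sum>z\<in>vec n. of_real (real (card {a\<in>A. vadd n (act n g a) z \<in> B})) * \<chi> (dot n m z))
     = fourier n B m * cnj (\<Sum>a\<in>A. \<chi> (dot n m (act n g a)))" .
  have const: "(\<Sum>z\<in>vec n. \<chi> (dot n m z)) = (if m = vzero n then of_nat (q ^ n) else 0)"
    using sum_chi_dot[OF m] by (simp add: dot_commute[of n m])
  have "(\<Sum>z\<in>vec n. of_real (discrepancy n A B g z) * \<chi> (dot n m z))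
    = fourier n B m * cnj (\<Sum>a\<in>A. \<chi> (dot n m (act n g a)))
      - of_real (real (card A) * real (card B) / real q ^ n) * (if m = vzero n then of_nat (q ^ n) else 0)"
    unfolding discrepancy_def of_real_diff left_diff_distrib sum_subtractf count sum_distrib_left[symmetric] const ..
  also have "\<dots> = (if m = vzero n then 0 else fourier n B m * cnj (\<Sum>a\<in>A. \<chi> (dot n m (act n g a))))"
  proof (cases "m = vzero n")
    case True
    have "dot n m x = 0" for x unfolding True dot_def vzero_def by simp
    moreover have "K \<noteq> {}" using e_mem by blast
    ultimately show ?thesis using True unfolding fourier_def by simp
  qed simp
  finally show ?thesis .
qed

text \<open>
  Parseval in the translation. Counting the \<open>a\<close> with \<open>g a + z \<in> B\<close> is a convolution in \<open>z\<close>, so its transform is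
  a product; the frequency zero is removed by the mean. The substitution of \<open>g m\<close> for \<open>m\<close> moves the matrix from
  \<open>A\<close> to \<open>B\<close>.
\<close>

lemma discrepancy_energy:
  assumes A: "A \<subseteq> vec n" and B: "B \<subseteq> vec n" and g: "g \<in> orth n"
  shows "real q ^ n * (\<Sum>z\<in>vec n. (discrepancy n A B g z)\<^sup>2)
    = (\<Sum>m\<in>vec n - {vzero n}. (cmod (fourier n B (act n g m)))\<^sup>2 * (cmod (fourier n A m))\<^sup>2)"
proof -
  define h where "h m = (cmod (fourier n B m))\<^sup>2 * (cmod (\<Sum>a\<in>A. \<chi> (dot n m (act n g a))))\<^sup>2" for m
  have "real q ^ n * (\<Sum>z\<in>vec n. (discrepancy n A B g z)\<^sup>2)
     = (\<Sum>m\<in>vec n. (cmod (\<Sum>z\<in>vec n. of_real (discrepancy n A B g z) * \<chi> (dot n m z)))\<^sup>2)"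
    using parseval[of "vec n" n "\<lambda>z. of_real (discrepancy n A B g z)"] by simp
  also have "\<dots> = (\<Sum>m\<in>vec n. if m = vzero n then 0 else h m)"
    using discrepancy_transform[OF A B g]
    by (intro sum.cong refl) (simp add: h_def norm_mult power_mult_distrib del: complex_cnj_cnj cnj_sum)
  also have "\<dots> = (\<Sum>m\<in>vec n - {vzero n}. h m)"
    by (subst sum.remove[of "vec n" "vzero n"]) (auto intro!: sum.cong)
  also have "\<dots> = (\<Sum>m\<in>vec n - {vzero n}. h (act n g m))"
    by (rule sum.reindex_bij_betw[OF bij_act_nz[OF g], symmetric])
  also have "\<dots> = (\<Sum>m\<in>vec n - {vzero n}. (cmod (fourier n B (act n g m)))\<^sup>2 * (cmod (fourier n A m))\<^sup>2)"
  proof (rule sum.cong[OF refl])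
    fix m assume m: "m \<in> vec n - {vzero n}"
    have "(\<Sum>a\<in>A. \<chi> (dot n (act n g m) (act n g a))) = fourier n A m"
      unfolding fourier_def using dot_act[OF g] m A by (intro sum.cong refl) auto
    then show "h (act n g m) = (cmod (fourier n B (act n g m)))\<^sup>2 * (cmod (fourier n A m))\<^sup>2"
      unfolding h_def by simp
  qed
  finally show ?thesis .
qed

lemma fourier_energy: "B \<subseteq> vec n \<Longrightarrow> (\<Sum>m\<in>vec n. (cmod (fourier n B m))\<^sup>2) = real q ^ n * real (card B)"
  unfolding fourier_def using parseval[of B n "\<lambda>_. 1"] by simp

text \<open>
  Averaging over the orthogonal group amounts to averaging over a sphere, up to a constant. As all terms
  are nonnegative, an upper bound for the number of matrices that move \<open>m\<close> to \<open>y\<close> suffices.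
\<close>

lemma orbit_average:
  assumes m: "m \<in> vec (Suc k)" "m \<noteq> vzero (Suc k)" and F: "\<And>y. F y \<ge> (0::real)"
  shows "(\<Sum>g\<in>orth (Suc k). F (act (Suc k) g m))
     \<le> real (2 * 3 ^ Suc k * card (orth k)) * (\<Sum>y\<in>sphere (Suc k) (dot (Suc k) m m) - {vzero (Suc k)}. F y)"
proof -
  let ?n = "Suc k"
  let ?S = "sphere ?n (dot ?n m m) - {vzero ?n}"
  have fin: "finite ?S" unfolding sphere_def by simp
  have "act ?n g m \<in> ?S" if g: "g \<in> orth ?n" for g
    using bij_betw_apply[OF bij_act_nz[OF g], of m] m dot_act[OF g m(1) m(1)] unfolding sphere_def by simp
  then have "(\<Sum>g\<in>orth ?n. F (act ?n g m)) = (\<Sum>y\<in>?S. \<Sum>g\<in>{g\<in>orth ?n. act ?n g m = y}. F (act ?n g m))"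
    by (intro sum.group[symmetric] fin finite_orth) auto
  also have "\<dots> = (\<Sum>y\<in>?S. real (card (transporter ?n m y)) * F y)"
    unfolding transporter_def by (intro sum.cong refl) simp
  also have "\<dots> \<le> (\<Sum>y\<in>?S. real (2 * 3 ^ Suc k * card (orth k)) * F y)"
  proof (rule sum_mono)
    fix y assume "y \<in> ?S"
    then have "y \<in> vec ?n" "y \<noteq> vzero ?n" unfolding sphere_def by auto
    from card_transporter_le_orth[OF this, of m]
    show "real (card (transporter ?n m y)) * F y \<le> real (2 * 3 ^ Suc k * card (orth k)) * F y"
      using F by (intro mult_right_mono of_nat_mono)
  qed
  finally show ?thesis by (simp only: sum_distrib_left)
qed

text \<open>
  Every motion in \<open>R\<close> maps all of \<open>A\<close> into \<open>B\<close> and has the same large discrepancy. The sum of the squares of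
  the discrepancies over all rigid motions is at most a constant times the order of the smaller
  orthogonal group times \<open>q ^ (- n) \<Sum> \<bar>A^(m)\<bar>\<^sup>2 \<bar>B^(y)\<bar>\<^sup>2\<close> over nonzero \<open>m\<close>, \<open>y\<close> with \<open>m \<bullet> m = y \<bullet> y\<close>, where \<open>A^\<close> and
  \<open>B^\<close> are the transforms. For fixed \<open>y\<close> the sum over \<open>m\<close> is an energy on a sphere, and Parseval for \<open>B\<close>
  handles the sum over \<open>y\<close>.
\<close>

lemma incidence_inequality:
  assumes k: "n = Suc k"
    and cases: "odd n \<or> ([n = 2] (mod 4) \<and> [q = 3] (mod 4))"
    and weil: "\<And>a b. a \<in> K - {0} \<Longrightarrow> b \<in> K - {0} \<Longrightarrow> cmod (\<Sum>s\<in>K - {0}. \<chi> (a * s + b * iv s)) \<le> 2 * sqrt (real q)"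
    and A: "A \<subseteq> vec n" and B: "B \<subseteq> vec n" and R: "R \<subseteq> orth n \<times> vec n"
    and maps: "\<And>g z a. (g, z) \<in> R \<Longrightarrow> a \<in> A \<Longrightarrow> vadd n (act n g a) z \<in> B"
  shows "real (card R) * (real (card A) * (1 - real (card B) / real q ^ n))\<^sup>2
    \<le> real (2 * 3 ^ n * card (orth k)) * real (card B)
       * (real q ^ k * real (card A) + 2 * sqrt (real q) ^ k * (real (card A))\<^sup>2)"
proof -
  define C where "C = real (2 * 3 ^ n * card (orth k))"
  define M where "M = real q ^ k * real (card A) + 2 * sqrt (real q) ^ k * (real (card A))\<^sup>2"
  define D where "D g z = (discrepancy n A B g z)\<^sup>2" for g z
  define a where "a m = (cmod (fourier n A m))\<^sup>2" for m
  define b where "b m = (cmod (fourier n B m))\<^sup>2" for m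
  let ?V = "vec n - {vzero n}"
  have C0: "C \<ge> 0" unfolding C_def by simp
  have a0: "a m \<ge> 0" and b0: "b m \<ge> 0" for m unfolding a_def b_def by auto
  have finR: "finite R" using R finite_subset[of R "orth n \<times> vec n"] by simp
  have Q: "real q ^ n > 0" using q_pos by simp
  have "real (card R) * (real (card A) * (1 - real (card B) / real q ^ n))\<^sup>2 = (\<Sum>(g, z)\<in>R. D g z)"
  proof -
    have "(case p of (g, z) \<Rightarrow> D g z) = (real (card A) * (1 - real (card B) / real q ^ n))\<^sup>2" if "p \<in> R" for p
    proof -
      obtain g z where p: "p = (g, z)" by fastforce
      have "{a\<in>A. vadd n (act n g a) z \<in> B} = A" using maps that p by auto
      then show ?thesis unfolding p D_def discrepancy_def by (simp add: right_diff_distrib)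
    qed
    then show ?thesis by simp
  qed
  also have "\<dots> \<le> (\<Sum>(g, z)\<in>orth n \<times> vec n. D g z)"
    using R by (intro sum_mono2) (auto simp: D_def)
  also have "\<dots> = (\<Sum>g\<in>orth n. \<Sum>z\<in>vec n. D g z)" by (simp add: sum.cartesian_product)
  finally have 1: "real (card R) * (real (card A) * (1 - real (card B) / real q ^ n))\<^sup>2 \<le> (\<Sum>g\<in>orth n. \<Sum>z\<in>vec n. D g z)" .
  have "real q ^ n * (\<Sum>g\<in>orth n. \<Sum>z\<in>vec n. D g z) = (\<Sum>g\<in>orth n. \<Sum>m\<in>?V. b (act n g m) * a m)"
    unfolding sum_distrib_left[of "real q ^ n" _ "orth n"] D_def a_def b_def
    by (intro sum.cong refl discrepancy_energy A B)
  also have "\<dots> = (\<Sum>m\<in>?V. a m * (\<Sum>g\<in>orth n. b (act n g m)))"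
    by (subst sum.swap) (simp add: sum_distrib_left mult.commute)
  also have "\<dots> \<le> (\<Sum>m\<in>?V. a m * (C * (\<Sum>y\<in>sphere n (dot n m m) - {vzero n}. b y)))"
    unfolding C_def k by (intro sum_mono mult_left_mono orbit_average a0 b0) auto
  also have "\<dots> = C * (\<Sum>m\<in>?V. \<Sum>y\<in>?V. if dot n y y = dot n m m then a m * b y else 0)"
  proof -
    have "a m * (C * (\<Sum>y\<in>sphere n (dot n m m) - {vzero n}. b y))
      = C * (\<Sum>y\<in>?V. if dot n y y = dot n m m then a m * b y else 0)" for m
    proof -
      have eq: "sphere n (dot n m m) - {vzero n} = {y\<in>?V. dot n y y = dot n m m}" unfolding sphere_def by auto
      have "(\<Sum>y\<in>sphere n (dot n m m) - {vzero n}. b y) = (\<Sum>y\<in>?V. if dot n y y = dot n m m then b y else 0)"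
        unfolding eq by (rule sum.inter_filter) simp
      then have "a m * (C * (\<Sum>y\<in>sphere n (dot n m m) - {vzero n}. b y)) = C * (\<Sum>y\<in>?V. a m * (if dot n y y = dot n m m then b y else 0))"
        by (simp only: sum_distrib_left mult.left_commute)
      also have "(\<Sum>y\<in>?V. a m * (if dot n y y = dot n m m then b y else 0)) = (\<Sum>y\<in>?V. if dot n y y = dot n m m then a m * b y else 0)"
        by (intro sum.cong refl) simp
      finally show ?thesis .
    qed
    then show ?thesis by (simp only: sum_distrib_left)
  qed
  also have "\<dots> = C * (\<Sum>y\<in>?V. b y * (\<Sum>m\<in>{m\<in>?V. dot n m m = dot n y y}. a m))"
  proof -
    have "(\<Sum>m\<in>?V. if dot n y y = dot n m m then a m * b y else 0) = b y * (\<Sum>m\<in>{m\<in>?V. dot n m m = dot n y y}. a m)" for y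
    proof -
      have "(\<Sum>m\<in>{m\<in>?V. dot n m m = dot n y y}. a m) = (\<Sum>m\<in>?V. if dot n m m = dot n y y then a m else 0)"
        by (rule sum.inter_filter) simp
      then show ?thesis by (simp add: sum_distrib_left) (intro sum.cong refl, auto)
    qed
    then show ?thesis by (subst sum.swap) simp
  qed
  also have "\<dots> \<le> C * (\<Sum>y\<in>?V. b y * M)"
  proof (intro mult_left_mono sum_mono C0 b0)
    fix y assume y: "y \<in> ?V"
    have "(\<Sum>m\<in>{m\<in>?V. dot n m m = dot n y y}. a m) \<le> (\<Sum>m\<in>sphere n (dot n y y). a m)"
      by (rule sum_mono2) (auto simp: sphere_def a0)
    also have "\<dots> \<le> M"
      unfolding a_def fourier_def M_def using sphere_energy[OF _ _ A cases weil, of "dot n y y"] y k by simp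
    finally show "(\<Sum>m\<in>{m\<in>?V. dot n m m = dot n y y}. a m) \<le> M" .
  qed
  also have "\<dots> = C * M * (\<Sum>y\<in>?V. b y)" by (simp add: sum_distrib_left mult_ac)
  also have "\<dots> \<le> C * M * (\<Sum>y\<in>vec n. b y)"
    using C0 b0 by (intro mult_left_mono sum_mono2) (auto simp: M_def)
  also have "\<dots> = real q ^ n * (C * real (card B) * M)"
    unfolding b_def fourier_energy[OF B] by (simp only: mult_ac)
  finally have "(\<Sum>g\<in>orth n. \<Sum>z\<in>vec n. D g z) \<le> C * real (card B) * M" using Q by (simp add: mult_le_cancel_left_pos)
  then show ?thesis using 1 unfolding C_def M_def by linarith
qed

end

section \<open>A ring that contains all finite fields\<close>

text \<open>
  The elements of the algebraic closure of a field of integers are of this type. Every finite field has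
  a copy whose elements are integers.
\<close>

type_synonym clos = "(int list \<times> nat) multiset \<Rightarrow> int"

text \<open>
  The product of all fields with elements in one type. It is a commutative ring, every factor is a
  field in it in the sense of \<open>fld\<close>, and so it contains every finite field together with an algebraic
  closure. Outside the index set the families are \<open>undefined\<close>, to make equality componentwise.
\<close>

typedef field_product = "{f :: clos ring \<Rightarrow> clos. \<forall>S. if field S then f S \<in> carrier S else f S = undefined}"
proof
  show "(\<lambda>S. if field S then \<zero>\<^bsub>S\<^esub> else undefined)
      \<in> {f :: clos ring \<Rightarrow> clos. \<forall>S. if field S then f S \<in> carrier S else f S = undefined}"
    using field.is_ring ring.ring_simprules(2) by auto
qed

definition component :: "field_product \<Rightarrow> clos ring \<Rightarrow> clos" where "component = Rep_field_product"

definition family :: "(clos ring \<Rightarrow> clos) \<Rightarrow> field_product" where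
  "family f = Abs_field_product (\<lambda>S. if field S then f S else undefined)"

lemma component_mem: "field S \<Longrightarrow> component x S \<in> carrier S"
  using Rep_field_product[of x] unfolding component_def by (auto split: if_splits)

lemma field_product_eqI: assumes "\<And>S. field S \<Longrightarrow> component x S = component y S" shows "x = y"
proof -
  have "Rep_field_product x S = Rep_field_product y S" for S
    using assms[of S] Rep_field_product[of x] Rep_field_product[of y] unfolding component_def
    by (cases "field S") auto
  then show ?thesis by (simp add: Rep_field_product_inject[symmetric] fun_eq_iff)
qed

lemma component_family:
  assumes "\<And>S. field S \<Longrightarrow> f S \<in> carrier S" "field S"
  shows "component (family f) S = f S"
  unfolding component_def family_def by (subst Abs_field_product_inverse) (use assms in auto)

text \<open>
  Without a field on the component type the product would be trivial, and zero would equal one.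
\<close>

lemma ex_field_clos: "\<exists>S :: clos ring. field S"
proof -
  have "field (residue_ring (int 2))" by (rule residues_prime.is_field) (simp add: residues_prime_def)
  then have "algebraic_closure (field.alg_closure (residue_ring (int 2))) (ring.indexed_const (residue_ring (int 2)) ` carrier (residue_ring (int 2)))"
    by (rule field.alg_closureE(1))
  then show ?thesis using algebraic_closure.axioms(1) by blast
qed

instantiation field_product :: comm_ring_1
begin

definition zero_field_product where "0 = family (\<lambda>S. \<zero>\<^bsub>S\<^esub>)"
definition one_field_product where "1 = family (\<lambda>S. \<one>\<^bsub>S\<^esub>)"
definition plus_field_product where "x + y = family (\<lambda>S. component x S \<oplus>\<^bsub>S\<^esub> component y S)"
definition times_field_product where "x * y = family (\<lambda>S. component x S \<otimes>\<^bsub>S\<^esub> component y S)"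
definition uminus_field_product where "- x = family (\<lambda>S. \<ominus>\<^bsub>S\<^esub> component x S)"
definition minus_field_product where "x - y = x + - (y :: field_product)"

lemma component_simps:
  assumes "field S"
  shows "component 0 S = \<zero>\<^bsub>S\<^esub>" "component 1 S = \<one>\<^bsub>S\<^esub>"
    "component (x + y) S = component x S \<oplus>\<^bsub>S\<^esub> component y S"
    "component (x * y) S = component x S \<otimes>\<^bsub>S\<^esub> component y S"
    "component (- x) S = \<ominus>\<^bsub>S\<^esub> component x S"
  unfolding zero_field_product_def one_field_product_def plus_field_product_def times_field_product_def
    uminus_field_product_def
  using assms by (auto intro!: component_family ring.ring_simprules component_mem
    dest: field.is_ring)

instance
proof
  fix x y z :: field_product
  have cr: "cring S" if "field S" for S :: "clos ring" using that by (simp add: field.axioms domain.axioms(1))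
  note simps = component_simps component_mem cring.cring_simprules[OF cr]
  show "x + y + z = x + (y + z)" "x + y = y + x" "0 + x = x" "- x + x = 0"
    "x * y * z = x * (y * z)" "x * y = y * x" "1 * x = x" "(x + y) * z = x * z + y * z"
    by (rule field_product_eqI, simp add: simps)+
  show "x - y = x + - y" by (rule minus_field_product_def)
  show "(0 :: field_product) \<noteq> 1"
  proof
    obtain S :: "clos ring" where S: "field S" using ex_field_clos by blast
    assume "(0 :: field_product) = 1"
    then have "\<zero>\<^bsub>S\<^esub> = \<one>\<^bsub>S\<^esub>" using component_simps(1,2)[OF S] by metis
    then show False using domain.one_not_zero[OF field.axioms(1)[OF S]] by simp
  qed
qed

end

definition in_factor :: "clos ring \<Rightarrow> clos \<Rightarrow> field_product" where
  "in_factor S x = family (\<lambda>T. if T = S then x else \<zero>\<^bsub>T\<^esub>)"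

lemma component_in_factor:
  assumes "field S" "x \<in> carrier S" "field T"
  shows "component (in_factor S x) T = (if T = S then x else \<zero>\<^bsub>T\<^esub>)"
  unfolding in_factor_def
  by (subst component_family) (use assms ring.ring_simprules(2)[OF field.is_ring] in auto)

lemma in_factor_hom:
  assumes S: "field S" and x: "x \<in> carrier S" and y: "y \<in> carrier S"
  shows "in_factor S (x \<oplus>\<^bsub>S\<^esub> y) = in_factor S x + in_factor S y"
    "in_factor S (x \<otimes>\<^bsub>S\<^esub> y) = in_factor S x * in_factor S y"
    "in_factor S (\<ominus>\<^bsub>S\<^esub> x) = - in_factor S x"
    "in_factor S \<zero>\<^bsub>S\<^esub> = 0"
proof -
  interpret S: field S by (rule S)
  have z: "\<zero>\<^bsub>T\<^esub> \<oplus>\<^bsub>T\<^esub> \<zero>\<^bsub>T\<^esub> = \<zero>\<^bsub>T\<^esub>" "\<zero>\<^bsub>T\<^esub> \<otimes>\<^bsub>T\<^esub> \<zero>\<^bsub>T\<^esub> = \<zero>\<^bsub>T\<^esub>"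
    "\<ominus>\<^bsub>T\<^esub> \<zero>\<^bsub>T\<^esub> = \<zero>\<^bsub>T\<^esub>" if "field T" for T :: "clos ring"
  proof -
    interpret T: field T by (rule that)
    show "\<zero>\<^bsub>T\<^esub> \<oplus>\<^bsub>T\<^esub> \<zero>\<^bsub>T\<^esub> = \<zero>\<^bsub>T\<^esub>" "\<zero>\<^bsub>T\<^esub> \<otimes>\<^bsub>T\<^esub> \<zero>\<^bsub>T\<^esub> = \<zero>\<^bsub>T\<^esub>" by simp_all
    then show "\<ominus>\<^bsub>T\<^esub> \<zero>\<^bsub>T\<^esub> = \<zero>\<^bsub>T\<^esub>" by (intro T.minus_equality) simp_all
  qed
  note simps = component_simps component_in_factor[OF S] x y z
  show "in_factor S (x \<oplus>\<^bsub>S\<^esub> y) = in_factor S x + in_factor S y"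
    "in_factor S (x \<otimes>\<^bsub>S\<^esub> y) = in_factor S x * in_factor S y"
    "in_factor S (\<ominus>\<^bsub>S\<^esub> x) = - in_factor S x"
    "in_factor S \<zero>\<^bsub>S\<^esub> = 0"
    by (rule field_product_eqI, simp add: simps)+
qed

lemma inj_in_factor: assumes "field S" shows "inj_on (in_factor S) (carrier S)"
  by (rule inj_onI) (metis component_in_factor[OF assms _ assms])

lemma (in algebraically_closed) ex_sqrt:
  assumes x: "x \<in> carrier L"
  shows "\<exists>y\<in>carrier L. y \<otimes> y = x"
proof -
  let ?p = "[\<one>, \<zero>, \<ominus> x]"
  have p: "?p \<in> carrier (poly_ring L)"
    using x unfolding univ_poly_carrier[symmetric] polynomial_def by simp
  have "size (roots ?p) = 2" using roots_over_carrier[OF p] unfolding splitted_def by simp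
  then obtain y where "y \<in># roots ?p" by (metis size_empty multiset_nonemptyE zero_neq_numeral)
  then have y: "y \<in> carrier L" "eval ?p y = \<zero>"
    using roots_mem_iff_is_root[OF p] unfolding is_root_def by auto
  then have "y \<otimes> y \<oplus> \<ominus> x = \<zero>" using x by (simp add: numeral_2_eq_2)
  then have "y \<otimes> y = x" using x y by (metis a_minus_def m_closed r_right_minus_eq)
  then show ?thesis using y by blast
qed

section \<open>Passing from abstract fields to subsets of the ring\<close>

locale field_embedding = F: field F + fld_ext M K e
  for F :: "'a ring" and h :: "'a \<Rightarrow> 'r::comm_ring_1" and M K :: "'r set" and e :: 'r +
  assumes bij: "bij_betw h (carrier F) K"
    and h_add: "\<And>x y. x \<in> carrier F \<Longrightarrow> y \<in> carrier F \<Longrightarrow> h (x \<oplus>\<^bsub>F\<^esub> y) = h x + h y"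
    and h_mult: "\<And>x y. x \<in> carrier F \<Longrightarrow> y \<in> carrier F \<Longrightarrow> h (x \<otimes>\<^bsub>F\<^esub> y) = h x * h y"
    and h_one: "h \<one>\<^bsub>F\<^esub> = e" and h_zero: "h \<zero>\<^bsub>F\<^esub> = 0"
    and sqrt: "\<And>x. x \<in> M \<Longrightarrow> \<exists>y\<in>M. y * y = x"

lemma fld_image:
  assumes S: "field S" and h: "inj_on h (carrier S)"
    and h_add: "\<And>x y. x \<in> carrier S \<Longrightarrow> y \<in> carrier S \<Longrightarrow> h (x \<oplus>\<^bsub>S\<^esub> y) = h x + (h y :: 'r::comm_ring_1)"
    and h_mult: "\<And>x y. x \<in> carrier S \<Longrightarrow> y \<in> carrier S \<Longrightarrow> h (x \<otimes>\<^bsub>S\<^esub> y) = h x * h y"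
  shows "fld (h ` carrier S) (h \<one>\<^bsub>S\<^esub>)" "h \<zero>\<^bsub>S\<^esub> = 0"
proof -
  interpret S: field S by (rule S)
  have "h \<zero>\<^bsub>S\<^esub> = h \<zero>\<^bsub>S\<^esub> + h \<zero>\<^bsub>S\<^esub>" using h_add[of "\<zero>\<^bsub>S\<^esub>" "\<zero>\<^bsub>S\<^esub>"] by simp
  then show h0: "h \<zero>\<^bsub>S\<^esub> = 0" by simp
  show "fld (h ` carrier S) (h \<one>\<^bsub>S\<^esub>)"
  proof
    show "h \<one>\<^bsub>S\<^esub> \<in> h ` carrier S" by simp
    show "h \<one>\<^bsub>S\<^esub> \<noteq> 0" using inj_onD[OF h, of "\<one>\<^bsub>S\<^esub>" "\<zero>\<^bsub>S\<^esub>"] h0 by auto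
    fix x assume "x \<in> h ` carrier S"
    then obtain a where a: "a \<in> carrier S" "x = h a" by blast
    have "h a + h (\<ominus>\<^bsub>S\<^esub> a) = 0" using h_add[of a "\<ominus>\<^bsub>S\<^esub> a"] a h0 by (simp add: S.r_neg)
    then have "- x = h (\<ominus>\<^bsub>S\<^esub> a)" using a by (simp add: add_eq_0_iff)
    then show "- x \<in> h ` carrier S" using a by simp
    show "h \<one>\<^bsub>S\<^esub> * x = x" using h_mult[of "\<one>\<^bsub>S\<^esub>" a] a by simp
    show "\<exists>y\<in>h ` carrier S. x * y = h \<one>\<^bsub>S\<^esub>" if "x \<noteq> 0"
    proof -
      have "a \<noteq> \<zero>\<^bsub>S\<^esub>" using that a h0 by auto
      then have "inv\<^bsub>S\<^esub> a \<in> carrier S" "a \<otimes>\<^bsub>S\<^esub> inv\<^bsub>S\<^esub> a = \<one>\<^bsub>S\<^esub>" using a S.field_Units by auto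
      then show ?thesis using h_mult[of a "inv\<^bsub>S\<^esub> a"] a by auto
    qed
    fix y assume "y \<in> h ` carrier S"
    then obtain b where b: "b \<in> carrier S" "y = h b" by blast
    show "x + y \<in> h ` carrier S" using h_add[of a b] a b by (metis S.a_closed imageI)
    show "x * y \<in> h ` carrier S" using h_mult[of a b] a b by (metis S.m_closed imageI)
  qed
qed

text \<open>
  The finite field is copied to a field of integers, mapped into its algebraic closure and then put
  into the corresponding factor of the product.
\<close>

lemma ex_field_embedding:
  fixes F :: "'a ring"
  assumes F: "field F" and fin: "finite (carrier F)" and odd: "odd (card (carrier F))" and pp: "primepow (card (carrier F))"
  obtains h :: "'a \<Rightarrow> field_product" and M K e where "field_embedding F h M K e"
proof -
  obtain f :: "'a \<Rightarrow> nat" where "inj_on f (carrier F)" using finite_imp_inj_to_nat_seg[OF fin] by blast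
  then have f: "inj_on (int \<circ> f) (carrier F)" by (simp add: comp_inj_on)
  define F1 where "F1 = image_ring (int \<circ> f) F"
  have F1: "field F1" unfolding F1_def by (rule field.inj_imp_image_ring_is_field[OF F f])
  have f_hom: "int \<circ> f \<in> ring_hom F F1"
    using inj_imp_image_ring_iso[OF f] unfolding F1_def ring_iso_def by blast
  define L where "L = field.alg_closure F1"
  have cl: "algebraic_closure L (ring.indexed_const F1 ` carrier F1)" and c_hom: "ring.indexed_const F1 \<in> ring_hom F1 L"
    unfolding L_def by (rule field.alg_closureE[OF F1])+
  interpret L: algebraic_closure L "ring.indexed_const F1 ` carrier F1" by (rule cl)
  have L: "field L" by (rule L.field_axioms)
  define g :: "'a \<Rightarrow> clos" where "g = ring.indexed_const F1 \<circ> (int \<circ> f)"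
  have g_hom: "g \<in> ring_hom F L" unfolding g_def by (rule ring_hom_trans[OF f_hom c_hom])
  have g_inj: "inj_on g (carrier F)" by (rule non_trivial_field_hom_is_inj[OF g_hom F L])
  have g_mem: "g x \<in> carrier L" if "x \<in> carrier F" for x using ring_hom_memE(1)[OF g_hom that] .
  define h where "h = in_factor L \<circ> g"
  define M where "M = in_factor L ` carrier L"
  define K where "K = h ` carrier F"
  define e where "e = in_factor L \<one>\<^bsub>L\<^esub>"
  have h_inj: "inj_on h (carrier F)"
    unfolding h_def by (rule comp_inj_on[OF g_inj]) (rule inj_on_subset[OF inj_in_factor[OF L]], use g_mem in blast)
  have h_one: "h \<one>\<^bsub>F\<^esub> = e" unfolding h_def e_def using ring_hom_one[OF g_hom] by simp
  have h_add: "h (x \<oplus>\<^bsub>F\<^esub> y) = h x + h y" and h_mult: "h (x \<otimes>\<^bsub>F\<^esub> y) = h x * h y"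
    if "x \<in> carrier F" "y \<in> carrier F" for x y
    unfolding h_def using that g_mem ring_hom_add[OF g_hom that] ring_hom_mult[OF g_hom that] in_factor_hom(1,2)[OF L] by auto
  have M: "fld M e" unfolding M_def e_def
    by (rule fld_image(1)[OF L inj_in_factor[OF L]]) (simp_all add: in_factor_hom(1,2)[OF L])
  have K: "fld K e" and h_zero: "h \<zero>\<^bsub>F\<^esub> = 0" unfolding K_def h_one[symmetric]
    by (rule fld_image[OF F h_inj]; simp add: h_add h_mult)+
  have card_K: "card K = card (carrier F)" unfolding K_def by (rule card_image[OF h_inj])
  have KM: "K \<subseteq> M" unfolding K_def M_def h_def using g_mem by auto
  have "finite_fld K e"
    by (intro finite_fld.intro finite_fld_axioms.intro K) (use fin odd in \<open>simp_all add: card_K\<close>, simp add: K_def)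
  then have ext: "fld_ext M K e"
    using M KM pp by (intro fld_ext.intro fld_ext_axioms.intro) (simp_all add: card_K)
  have "\<exists>y\<in>M. y * y = x" if "x \<in> M" for x
  proof -
    obtain a where a: "a \<in> carrier L" "x = in_factor L a"
      using \<open>x \<in> M\<close> unfolding M_def by (rule imageE) (rule that)
    obtain b where b: "b \<in> carrier L" "b \<otimes>\<^bsub>L\<^esub> b = a" using L.ex_sqrt[OF a(1)] by (rule bexE)
    have "in_factor L b * in_factor L b = x" unfolding a(2) b(2)[symmetric] by (rule in_factor_hom(2)[OF L b(1) b(1), symmetric])
    moreover have "in_factor L b \<in> M" unfolding M_def using b(1) by (rule imageI)
    ultimately show ?thesis by (rule bexI)
  qed
  then have "field_embedding F h M K e"
    using ext F h_add h_mult h_one h_zero h_inj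
    by (intro field_embedding.intro field_embedding_axioms.intro) (auto simp: K_def bij_betw_def)
  then show thesis by (rule that)
qed

context field_embedding
begin

lemma h_mem [simp]: "x \<in> carrier F \<Longrightarrow> h x \<in> K" using bij bij_betwE by blast

lemma h_inj: "x \<in> carrier F \<Longrightarrow> y \<in> carrier F \<Longrightarrow> h x = h y \<Longrightarrow> x = y"
  using bij by (auto simp: bij_betw_def dest: inj_onD)

lemma h_finsum: assumes "finite I" "\<And>i. i \<in> I \<Longrightarrow> f i \<in> carrier F"
  shows "h (finsum F f I) = (\<Sum>i\<in>I. h (f i))"
  using assms by (induction I) (auto simp: h_zero h_add Pi_def)

definition hvec :: "nat \<Rightarrow> (nat \<Rightarrow> 'a) \<Rightarrow> nat \<Rightarrow> 'r" where
  "hvec n x = (\<lambda>i\<in>{..<n}. h (x i))"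

definition hmat :: "nat \<Rightarrow> (nat \<Rightarrow> nat \<Rightarrow> 'a) \<Rightarrow> nat \<Rightarrow> nat \<Rightarrow> 'r" where
  "hmat n g = (\<lambda>i\<in>{..<n}. \<lambda>j\<in>{..<n}. h (g i j))"

lemma vecs_nth: "x \<in> vecs F n \<Longrightarrow> i < n \<Longrightarrow> x i \<in> carrier F"
  unfolding vecs_def using PiE_mem[of x "{..<n}" "\<lambda>_. carrier F" i] by simp

lemma hvec_mem [simp]: "x \<in> vecs F n \<Longrightarrow> hvec n x \<in> K.vec n"
  by (subst K.vec_def) (simp add: hvec_def vecs_nth)

lemma hvec_inj: "inj_on (hvec n) (vecs F n)"
proof (rule inj_onI)
  fix x y assume xy: "x \<in> vecs F n" "y \<in> vecs F n" "hvec n x = hvec n y"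
  show "x = y"
  proof (rule PiE_ext)
    show "x \<in> {..<n} \<rightarrow>\<^sub>E carrier F" "y \<in> {..<n} \<rightarrow>\<^sub>E carrier F" using xy unfolding vecs_def by simp_all
    fix i assume i: "i \<in> {..<n}"
    have "hvec n x i = hvec n y i" using xy by simp
    then show "x i = y i"
      using i h_inj[OF vecs_nth[OF xy(1)] vecs_nth[OF xy(2)]] unfolding hvec_def by simp
  qed
qed

lemma sq_mats_nth: "g \<in> sq_mats F n \<Longrightarrow> i < n \<Longrightarrow> j < n \<Longrightarrow> g i j \<in> carrier F"
  unfolding sq_mats_def
  using PiE_mem[of g "{..<n}" "\<lambda>_. {..<n} \<rightarrow>\<^sub>E carrier F" i] PiE_mem[of "g i" "{..<n}" "\<lambda>_. carrier F" j]
  by simp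

lemma hmat_inj: "inj_on (hmat n) (sq_mats F n)"
proof (rule inj_onI)
  fix x y assume xy: "x \<in> sq_mats F n" "y \<in> sq_mats F n" "hmat n x = hmat n y"
  show "x = y"
  proof (rule PiE_ext)
    show "x \<in> {..<n} \<rightarrow>\<^sub>E ({..<n} \<rightarrow>\<^sub>E carrier F)" "y \<in> {..<n} \<rightarrow>\<^sub>E ({..<n} \<rightarrow>\<^sub>E carrier F)" using xy unfolding sq_mats_def by simp_all
    fix i assume i: "i \<in> {..<n}"
    show "x i = y i"
    proof (rule PiE_ext)
      show "x i \<in> {..<n} \<rightarrow>\<^sub>E carrier F" "y i \<in> {..<n} \<rightarrow>\<^sub>E carrier F" using xy(1,2) i PiE_mem[of x "{..<n}" "\<lambda>_. {..<n} \<rightarrow>\<^sub>E carrier F" i]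
          PiE_mem[of y "{..<n}" "\<lambda>_. {..<n} \<rightarrow>\<^sub>E carrier F" i] unfolding sq_mats_def by simp_all
      fix j assume j: "j \<in> {..<n}"
      have "hmat n x i j = hmat n y i j" using xy by simp
      then show "x i j = y i j"
        using i j h_inj[OF sq_mats_nth[OF xy(1)] sq_mats_nth[OF xy(2)]] unfolding hmat_def by simp
    qed
  qed
qed

lemma orthogonal_iff:
  assumes g: "g \<in> sq_mats F n"
  shows "g \<in> orthogonal_group F n \<longleftrightarrow> hmat n g \<in> K.orth n"
proof -
  have entry: "h (mat_times F n (mat_transpose n g) g j k) = (\<Sum>i<n. hmat n g i j * hmat n g i k)"
    "mat_times F n (mat_transpose n g) g j k \<in> carrier F" if "j < n" "k < n" for j k
  proof -
    have c: "mat_transpose n g j i \<otimes>\<^bsub>F\<^esub> g i k \<in> carrier F" "mat_transpose n g j i = g i j" if "i < n" for i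
      using sq_mats_nth[OF g] that \<open>j < n\<close> \<open>k < n\<close> unfolding mat_transpose_def by auto
    have e: "mat_times F n (mat_transpose n g) g j k = (\<Oplus>\<^bsub>F\<^esub>i\<in>{..<n}. mat_transpose n g j i \<otimes>\<^bsub>F\<^esub> g i k)"
      unfolding mat_times_def using that by simp
    show "mat_times F n (mat_transpose n g) g j k \<in> carrier F"
      unfolding e using c(1) by (intro F.finsum_closed) auto
    have "h (mat_times F n (mat_transpose n g) g j k) = (\<Sum>i<n. h (mat_transpose n g j i \<otimes>\<^bsub>F\<^esub> g i k))"
      unfolding e using c(1) by (intro h_finsum) auto
    also have "\<dots> = (\<Sum>i<n. hmat n g i j * hmat n g i k)"
      using c(2) that sq_mats_nth[OF g] by (intro sum.cong refl) (simp add: h_mult hmat_def)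
    finally show "h (mat_times F n (mat_transpose n g) g j k) = (\<Sum>i<n. hmat n g i j * hmat n g i k)" .
  qed
  have id_entry: "h (mat_id F n j k) = (if j = k then e else 0)" "mat_id F n j k \<in> carrier F" if "j < n" "k < n" for j k
    using that unfolding mat_id_def by (auto simp: h_one h_zero)
  have "mat_times F n (mat_transpose n g) g = mat_id F n
     \<longleftrightarrow> (\<forall>j<n. \<forall>k<n. mat_times F n (mat_transpose n g) g j k = mat_id F n j k)" (is "?l = ?r")
  proof
    assume r: ?r
    show ?l
    proof (rule ext, rule ext)
      fix j k
      show "mat_times F n (mat_transpose n g) g j k = mat_id F n j k"
      proof (cases "j < n \<and> k < n")
        case True then show ?thesis using r by blast
      next
        case False then show ?thesis unfolding mat_times_def mat_id_def by (auto simp: restrict_def)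
      qed
    qed
  qed simp
  also have "\<dots> \<longleftrightarrow> (\<forall>j<n. \<forall>k<n. (\<Sum>i<n. hmat n g i j * hmat n g i k) = (if j = k then e else 0))"
  proof -
    have "mat_times F n (mat_transpose n g) g j k = mat_id F n j k
      \<longleftrightarrow> (\<Sum>i<n. hmat n g i j * hmat n g i k) = (if j = k then e else 0)" if jk: "j < n" "k < n" for j k
      unfolding entry(1)[OF jk, symmetric] id_entry(1)[OF jk, symmetric]
      using h_inj[OF entry(2)[OF jk] id_entry(2)[OF jk]] arg_cong[of _ _ h] by (rule iffI[rotated])
    then show ?thesis by simp
  qed
  finally have "mat_times F n (mat_transpose n g) g = mat_id F n
     \<longleftrightarrow> (\<forall>j<n. \<forall>k<n. (\<Sum>i<n. hmat n g i j * hmat n g i k) = (if j = k then e else 0))" .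
  moreover have "hmat n g \<in> {..<n} \<rightarrow>\<^sub>E ({..<n} \<rightarrow>\<^sub>E K)"
    using sq_mats_nth[OF g] unfolding hmat_def by simp
  ultimately show ?thesis using g unfolding orthogonal_group_def K.orth_def by simp
qed

lemma hmat_surj: assumes "k \<in> K.orth n" obtains g where "g \<in> sq_mats F n" "hmat n g = k"
proof -
  define u where "u = inv_into (carrier F) h"
  have u: "u y \<in> carrier F" "h (u y) = y" if "y \<in> K" for y
    using bij that unfolding u_def bij_betw_def by (auto intro: inv_into_into f_inv_into_f)
  define g where "g = (\<lambda>i\<in>{..<n}. \<lambda>j\<in>{..<n}. u (k i j))"
  have k: "k i j \<in> K" if "i < n" "j < n" for i j using assms that by simp
  have "g \<in> sq_mats F n" unfolding sq_mats_def g_def using u k by simp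
  moreover have "hmat n g \<in> K.orth n"
  proof -
    have "hmat n g = (\<lambda>i\<in>{..<n}. \<lambda>j\<in>{..<n}. k i j)"
      unfolding hmat_def g_def using u(2)[OF k] by (auto intro!: restrict_ext)
    then show ?thesis
      using K.orth_I[of n k] k K.orth_columns[OF assms] by simp
  qed
  moreover have "hmat n g = k"
    by (rule K.orth_eqI[OF calculation(2) assms]) (simp add: hmat_def g_def u(2)[OF k])
  ultimately show thesis using that by blast
qed

lemma bij_hmat: "bij_betw (hmat n) (orthogonal_group F n) (K.orth n)"
  unfolding bij_betw_def
proof
  have sub: "orthogonal_group F n \<subseteq> sq_mats F n" unfolding orthogonal_group_def by auto
  show "inj_on (hmat n) (orthogonal_group F n)" by (rule inj_on_subset[OF hmat_inj sub])
  show "hmat n ` orthogonal_group F n = K.orth n"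
  proof
    show "hmat n ` orthogonal_group F n \<subseteq> K.orth n" using orthogonal_iff sub by blast
    show "K.orth n \<subseteq> hmat n ` orthogonal_group F n"
    proof
      fix k assume k: "k \<in> K.orth n"
      then obtain g where "g \<in> sq_mats F n" "hmat n g = k" by (rule hmat_surj)
      then show "k \<in> hmat n ` orthogonal_group F n" using orthogonal_iff k by blast
    qed
  qed
qed

lemma rigid_map_entry:
  assumes g: "g \<in> sq_mats F n" and z: "z \<in> vecs F n" and x: "x \<in> vecs F n" and i: "i < n"
  shows "rigid_map F n (g, z) x i = (\<Oplus>\<^bsub>F\<^esub>j\<in>{..<n}. g i j \<otimes>\<^bsub>F\<^esub> x j) \<oplus>\<^bsub>F\<^esub> z i"
    "(\<Oplus>\<^bsub>F\<^esub>j\<in>{..<n}. g i j \<otimes>\<^bsub>F\<^esub> x j) \<in> carrier F"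
  using sq_mats_nth[OF g] vecs_nth[OF x] i
  by (auto simp: rigid_map_def vec_plus_def mat_app_def intro!: F.finsum_closed)

lemma rigid_map_mem:
  assumes g: "g \<in> sq_mats F n" and z: "z \<in> vecs F n" and x: "x \<in> vecs F n"
  shows "rigid_map F n (g, z) x \<in> vecs F n"
  unfolding vecs_def
proof (rule PiE_I)
  fix i assume "i \<in> {..<n}"
  then show "rigid_map F n (g, z) x i \<in> carrier F"
    using rigid_map_entry[OF g z x, of i] vecs_nth[OF z] by simp
qed (simp add: rigid_map_def vec_plus_def)

end

lemma (in field_embedding) hvec_rigid_map:
  assumes g: "g \<in> sq_mats F n" and z: "z \<in> vecs F n" and x: "x \<in> vecs F n"
  shows "hvec n (rigid_map F n (g, z) x) = (\<lambda>i\<in>{..<n}. K.act n (hmat n g) (hvec n x) i + hvec n z i)"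
proof -
  have "h (rigid_map F n (g, z) x i) = K.act n (hmat n g) (hvec n x) i + hvec n z i" if i: "i < n" for i
  proof -
    have c: "g i j \<otimes>\<^bsub>F\<^esub> x j \<in> carrier F" "h (g i j \<otimes>\<^bsub>F\<^esub> x j) = hmat n g i j * hvec n x j" if "j < n" for j
      using sq_mats_nth[OF g i that] vecs_nth[OF x that] i that by (auto simp: h_mult hmat_def hvec_def)
    have "h (\<Oplus>\<^bsub>F\<^esub>j\<in>{..<n}. g i j \<otimes>\<^bsub>F\<^esub> x j) = (\<Sum>j<n. h (g i j \<otimes>\<^bsub>F\<^esub> x j))"
      using c(1) by (intro h_finsum) auto
    also have "\<dots> = (\<Sum>j<n. hmat n g i j * hvec n x j)" using c(2) by simp
    also have "\<dots> = K.act n (hmat n g) (hvec n x) i" using i by (simp add: K.act_def)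
    finally show ?thesis
      using rigid_map_entry[OF g z x i] vecs_nth[OF z i] i by (simp add: h_add hvec_def)
  qed
  then show ?thesis unfolding hvec_def[of n "rigid_map F n (g, z) x"] by (auto intro!: restrict_ext)
qed

lemma (in field_embedding) rigid_motion_incidences:
  assumes n: "n = Suc k" and A: "A \<subseteq> vecs F n" and R: "R \<subseteq> rigid_motions F n"
    and cases: "odd n \<or> ([n = 2] (mod 4) \<and> [card (carrier F) = 3] (mod 4))"
  defines "B \<equiv> (\<Union>r\<in>R. rigid_map F n r ` A)"
  shows "real (card R) * (real (card A) * (1 - real (card B) / real (card (carrier F)) ^ n))\<^sup>2
    \<le> real (2 * 3 ^ n * card (orthogonal_group F k)) * real (card B)
       * (real (card (carrier F)) ^ k * real (card A) + 2 * sqrt (real (card (carrier F))) ^ k * (real (card A))\<^sup>2)"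
proof -
  obtain \<psi> where "char_fld K e \<psi>" by (rule K.ex_character[OF card_primepow])
  then interpret C: char_fld K e \<psi> .
  have q: "card (carrier F) = card K" using bij by (rule bij_betw_same_card)
  have weil: "cmod (\<Sum>s\<in>K - {0}. \<psi> (a * s + b * K.iv s)) \<le> 2 * sqrt (real (card K))"
    if "a \<in> K - {0}" "b \<in> K - {0}" for a b
  proof -
    have "(\<Sum>s\<in>K - {0}. \<psi> (a * s + b * K.iv s)) = (\<Sum>s\<in>K - {0}. \<psi> (a * s + b * iv s))"
      by (intro sum.cong refl) (simp add: iv_K)
    then show ?thesis using kloosterman_weil[OF sqrt C.char_fld_axioms that] by simp
  qed
  have R': "g \<in> sq_mats F n" "g \<in> orthogonal_group F n" "z \<in> vecs F n" if "(g, z) \<in> R" for g z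
    using that R unfolding rigid_motions_def orthogonal_group_def by auto
  have B_sub: "B \<subseteq> vecs F n"
  proof
    fix y assume "y \<in> B"
    then obtain r x where r: "r \<in> R" "x \<in> A" "y = rigid_map F n r x" unfolding B_def by blast
    obtain g z where gz: "r = (g, z)" by fastforce
    show "y \<in> vecs F n" unfolding r(3) gz using R'[of g z] r gz A by (intro rigid_map_mem) auto
  qed
  define A' where "A' = hvec n ` A"
  define B' where "B' = hvec n ` B"
  define Rh where "Rh = map_prod (hmat n) (hvec n) ` R"
  have cA: "card A' = card A" unfolding A'_def by (rule card_image) (rule inj_on_subset[OF hvec_inj A])
  have cB: "card B' = card B" unfolding B'_def by (rule card_image) (rule inj_on_subset[OF hvec_inj B_sub])
  have R_sub: "R \<subseteq> sq_mats F n \<times> vecs F n" using R' by auto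
  have cR: "card Rh = card R" unfolding Rh_def
    by (rule card_image) (rule inj_on_subset[OF map_prod_inj_on[OF hmat_inj hvec_inj] R_sub])
  have "real (card Rh) * (real (card A') * (1 - real (card B') / real (card K) ^ n))\<^sup>2
    \<le> real (2 * 3 ^ n * card (K.orth k)) * real (card B')
       * (real (card K) ^ k * real (card A') + 2 * sqrt (real (card K)) ^ k * (real (card A'))\<^sup>2)"
  proof (rule C.incidence_inequality[OF n])
    show "odd n \<or> ([n = 2] (mod 4) \<and> [card K = 3] (mod 4))" using cases unfolding q .
    show "cmod (\<Sum>s\<in>K - {0}. \<psi> (a * s + b * K.iv s)) \<le> 2 * sqrt (real (card K))"
      if "a \<in> K - {0}" "b \<in> K - {0}" for a b by (rule weil[OF that])
    show "A' \<subseteq> K.vec n" unfolding A'_def using A by auto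
    show "B' \<subseteq> K.vec n" unfolding B'_def using B_sub by auto
    show "Rh \<subseteq> K.orth n \<times> K.vec n" unfolding Rh_def using R' bij_betwE[OF bij_hmat] by auto
    show "K.vadd n (K.act n g a) z \<in> B'" if "(g, z) \<in> Rh" "a \<in> A'" for g z a
    proof -
      obtain g0 z0 where gz: "(g0, z0) \<in> R" "g = hmat n g0" "z = hvec n z0" using \<open>(g, z) \<in> Rh\<close> unfolding Rh_def by auto
      obtain a0 where a0: "a0 \<in> A" "a = hvec n a0" using \<open>a \<in> A'\<close> unfolding A'_def by auto
      have "K.vadd n (K.act n g a) z = hvec n (rigid_map F n (g0, z0) a0)"
        using hvec_rigid_map[OF R'(1,3)[OF gz(1)], of a0] a0 A gz unfolding K.vadd_def by auto
      moreover have "rigid_map F n (g0, z0) a0 \<in> B" unfolding B_def using gz a0 by blast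
      ultimately show ?thesis unfolding B'_def by simp
    qed
  qed
  moreover have "card (orthogonal_group F k) = card (K.orth k)" by (rule bij_betw_same_card[OF bij_hmat])
  ultimately show ?thesis unfolding cA cB cR q by simp
qed

lemma (in field_embedding) card_orthogonal_group_pos: "card (orthogonal_group F k) > 0"
proof -
  have "card (orthogonal_group F k) = card (K.orth k)" by (rule bij_betw_same_card[OF bij_hmat])
  moreover have "K.orth k \<noteq> {}" using K.identity_orth by blast
  ultimately show ?thesis by (simp add: card_gt_0_iff)
qed

section \<open>Growth under rigid motions\<close>

text \<open>
  If \<open>B\<close> is at least half of the space there is nothing to do. Otherwise the left side of the incidence
  inequality is at least \<open>R N\<^sup>2 / 4\<close>, and of the two terms on the right, up to a constant, the first
  one dominates for \<open>N < s\<close> and the second one for \<open>N \<ge> s\<close>.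
\<close>

lemma growth_of_incidence:
  fixes Q N R B C H s :: real
  assumes inc: "R * (N * (1 - B / Q))\<^sup>2 \<le> (C * H) * B * (s * s * N + 2 * s * N\<^sup>2)"
    and pos: "Q > 0" "H > 0" "s > 0" "C \<ge> 1" and nonneg: "N \<ge> 0" "R \<ge> 0" "B \<ge> 0"
  shows "N < s \<Longrightarrow> B \<ge> 1 / (12 * C) * min Q (N * R / (s * s * H))"
    and "s \<le> N \<Longrightarrow> B \<ge> 1 / (12 * C) * min Q (R / (s * H))"
proof -
  have c: "0 < 1 / (12 * C)" "1 / (12 * C) \<le> 1 / 2" using pos by (auto simp: field_simps)
  have large: "1 / (12 * C) * min Q t \<le> B" if "B \<ge> Q / 2" for t
  proof -
    have "1 / (12 * C) * min Q t \<le> 1 / (12 * C) * Q" using c by (intro mult_left_mono) auto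
    also have "\<dots> \<le> 1 / 2 * Q" using c pos by (intro mult_right_mono) auto
    finally show ?thesis using that by simp
  qed
  have small: "1 / (12 * C) * min Q t \<le> B" if "t \<le> 12 * C * B" for t
  proof -
    have "1 / (12 * C) * min Q t \<le> 1 / (12 * C) * (12 * C * B)" using c that by (intro mult_left_mono) auto
    then show ?thesis using pos by simp
  qed
  have quarter: "R * N\<^sup>2 \<le> 4 * ((C * H) * B * (s * s * N + 2 * s * N\<^sup>2))" if "\<not> B \<ge> Q / 2"
  proof -
    have "1 / 2 \<le> 1 - B / Q" using that pos by (simp add: field_simps)
    then have "N * (1 / 2) \<le> N * (1 - B / Q)" using nonneg by (intro mult_left_mono) auto
    then have "(N * (1 / 2))\<^sup>2 \<le> (N * (1 - B / Q))\<^sup>2" using nonneg by (intro power_mono) auto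
    then have "R * (N * (1 / 2))\<^sup>2 \<le> R * (N * (1 - B / Q))\<^sup>2" using nonneg by (intro mult_left_mono) auto
    also note inc
    finally show ?thesis by (simp add: power_mult_distrib power2_eq_square)
  qed
  have CB: "C * H * B \<ge> 0" using pos nonneg by simp
  show "B \<ge> 1 / (12 * C) * min Q (N * R / (s * s * H))" if Ns: "N < s"
  proof (cases "B \<ge> Q / 2 \<or> N = 0")
    case True
    then show ?thesis using large nonneg pos by auto
  next
    case False
    have "s * N * N \<le> s * N * s" using Ns pos nonneg by (intro mult_left_mono) auto
    then have "s * s * N + 2 * s * N\<^sup>2 \<le> 3 * (s * s) * N" by (simp add: power2_eq_square mult_ac)
    then have "(C * H * B) * (s * s * N + 2 * s * N\<^sup>2) \<le> (C * H * B) * (3 * (s * s) * N)" using CB by (rule mult_left_mono)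
    then have "R * N\<^sup>2 \<le> 4 * ((C * H * B) * (3 * (s * s) * N))" using quarter False by simp
    then have "N * (N * R) \<le> N * (12 * C * B * (s * s * H))" by (simp add: power2_eq_square mult_ac)
    then have "N * R \<le> 12 * C * B * (s * s * H)" using False nonneg by simp
    then have "N * R / (s * s * H) \<le> 12 * C * B" using pos by (simp add: pos_divide_le_eq)
    then show ?thesis by (rule small)
  qed
  show "B \<ge> 1 / (12 * C) * min Q (R / (s * H))" if Ns: "s \<le> N"
  proof (cases "B \<ge> Q / 2")
    case True
    then show ?thesis by (rule large)
  next
    case False
    have N: "N > 0" using Ns pos by simp
    have "s * N * s \<le> s * N * N" using Ns pos nonneg by (intro mult_left_mono) auto
    then have "s * s * N + 2 * s * N\<^sup>2 \<le> 3 * s * N\<^sup>2" by (simp add: power2_eq_square mult_ac)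
    then have "(C * H * B) * (s * s * N + 2 * s * N\<^sup>2) \<le> (C * H * B) * (3 * s * N\<^sup>2)" using CB by (rule mult_left_mono)
    then have "R * N\<^sup>2 \<le> 4 * ((C * H * B) * (3 * s * N\<^sup>2))" using quarter False by simp
    then have "N\<^sup>2 * R \<le> N\<^sup>2 * (12 * C * B * (s * H))" by (simp add: mult_ac)
    then have "R \<le> 12 * C * B * (s * H)" using N by simp
    then have "R / (s * H) \<le> 12 * C * B" using pos by (simp add: pos_divide_le_eq)
    then show ?thesis by (rule small)
  qed
qed

theorem theorem1p10:
  fixes d :: nat
  assumes "d \<ge> 2"
  shows "\<exists>c::real. c > 0 \<and>
    (\<forall>(q::nat) (F::'a ring) (A::(nat \<Rightarrow> 'a) set) (R::((nat \<Rightarrow> nat \<Rightarrow> 'a) \<times> (nat \<Rightarrow> 'a)) set).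
      primepow q \<longrightarrow> odd q \<longrightarrow>
      field F \<longrightarrow> finite (carrier F) \<longrightarrow> card (carrier F) = q \<longrightarrow>
      A \<subseteq> vecs F d \<longrightarrow> R \<subseteq> rigid_motions F d \<longrightarrow>
      ((d \<ge> 3 \<and> odd d) \<or> ([d = 2] (mod 4) \<and> [q = 3] (mod 4))) \<longrightarrow>
      (real (card A) < real q powr ((real d - 1) / 2) \<longrightarrow>
        real (card (\<Union>r\<in>R. rigid_map F d r ` A))
          \<ge> c * min (real q ^ d)
                 (real (card A) * real (card R)
                   / (real q ^ (d - 1) * real (card (orthogonal_group F (d - 1)))))) \<and>
      (real q powr ((real d - 1) / 2) \<le> real (card A) \<and>
       real (card A) \<le> real q powr ((real d + 1) / 2) \<longrightarrow>
        real (card (\<Union>r\<in>R. rigid_map F d r ` A))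
          \<ge> c * min (real q ^ d)
                 (real (card R)
                   / (real q powr ((real d - 1) / 2) * real (card (orthogonal_group F (d - 1)))))))"
proof (intro exI[of _ "1 / (12 * (2 * 3 ^ d))"] conjI allI impI)
  show "(0::real) < 1 / (12 * (2 * 3 ^ d))" by simp
next
  fix q :: nat and F :: "'a ring" and A :: "(nat \<Rightarrow> 'a) set" and R :: "((nat \<Rightarrow> nat \<Rightarrow> 'a) \<times> (nat \<Rightarrow> 'a)) set"
  assume prime_power: "primepow q" and odd: "odd q" and F: "field F" and fin: "finite (carrier F)" and q: "card (carrier F) = q"
    and A: "A \<subseteq> vecs F d" and R: "R \<subseteq> rigid_motions F d"
    and cases: "(d \<ge> 3 \<and> odd d) \<or> ([d = 2] (mod 4) \<and> [q = 3] (mod 4))"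
  obtain k where k: "d = Suc k" using assms by (cases d) auto
  obtain h :: "'a \<Rightarrow> field_product" and M K e where "field_embedding F h M K e"
    using ex_field_embedding[OF F fin] odd prime_power q by metis
  then interpret field_embedding F h M K e .
  define s where "s = sqrt (real q) ^ k"
  have q0: "q > 0" using prime_power by (rule primepow_gt_0_nat)
  have s0: "s > 0" unfolding s_def using q0 by simp
  have ss: "s * s = real q ^ k" unfolding s_def by (simp flip: power_mult_distrib)
  have sp: "real q powr ((real d - 1) / 2) = s"
  proof -
    have "real q powr ((real d - 1) / 2) = (real q powr (1 / 2)) powr real k"
      unfolding powr_powr k by simp
    also have "\<dots> = s" unfolding s_def using q0 by (simp add: powr_half_sqrt powr_realpow)
    finally show ?thesis .
  qed
  have inc: "real (card R) * (real (card A) * (1 - real (card (\<Union>r\<in>R. rigid_map F d r ` A)) / real q ^ d))\<^sup>2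
    \<le> ((2 * 3 ^ d) * real (card (orthogonal_group F k))) * real (card (\<Union>r\<in>R. rigid_map F d r ` A))
       * (s * s * real (card A) + 2 * s * (real (card A))\<^sup>2)"
    using rigid_motion_incidences[OF k A R] cases unfolding q ss s_def[symmetric] by auto
  have H: "0 < real (card (orthogonal_group F k))" using card_orthogonal_group_pos by simp
  have Q: "0 < real q ^ d" using q0 by simp
  have C: "1 \<le> (2 * 3 ^ d :: real)"
  proof -
    have "(1::real) \<le> 3 ^ d" by simp
    then show ?thesis by linarith
  qed
  note growth = growth_of_incidence[OF inc Q H s0 C of_nat_0_le_iff of_nat_0_le_iff of_nat_0_le_iff]
  have dk: "d - 1 = k" using k by simp
  show "1 / (12 * (2 * 3 ^ d)) * min (real q ^ d) (real (card A) * real (card R) / (real q ^ (d - 1) * real (card (orthogonal_group F (d - 1)))))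
      \<le> real (card (\<Union>r\<in>R. rigid_map F d r ` A))" if "real (card A) < real q powr ((real d - 1) / 2)"
    using growth(1) that unfolding sp dk ss[symmetric] by simp
  show "1 / (12 * (2 * 3 ^ d)) * min (real q ^ d) (real (card R) / (real q powr ((real d - 1) / 2) * real (card (orthogonal_group F (d - 1)))))
      \<le> real (card (\<Union>r\<in>R. rigid_map F d r ` A))"
    if "real q powr ((real d - 1) / 2) \<le> real (card A) \<and> real (card A) \<le> real q powr ((real d + 1) / 2)"
    using growth(2) that unfolding sp dk by simp
qed

end
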